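(* Let $M$ be a closed connected oriented smooth manifold of dimension $2n+1$, let $\lambda_0$ be a positive contact form on $M$, and let $\mathcal F=\{F_1,\dots,F_N\}\subset C^\infty(M,\mathbb R)$. Let $\mathfrak C$ denote either $\mathfrak C^+(M)$ (big phase space) or $\mathfrak C^+(M,\xi)$ with $\xi=\ker\lambda_0$ (small phase space), and assume that the observation map $\mathcal O_{\mathcal F}:\mathfrak C\to\mathbb R^N$ is a submersion, i.e. $d\mathcal O_{\mathcal F}(\lambda)$ is surjective for every $\lambda\in\mathfrak C$. Let $B_{\mathcal F}=\mathcal O_{\mathcal F}(\mathfrak C)\subset\mathbb R^N$ and equip the one-jet bundle $J^1B_{\mathcal F}$, with canonical coordinates $(q_1,\dots,q_N,p_1,\dots,p_N,z)$, with the standard contact form $\Lambda=dz-\sum_{i=1}^N p_i\,dq_i$. Then the contact thermodynamic equilibrium $R_{\mathcal S_{\lambda_0};\mathcal F}\subset J^1B_{\mathcal F}$ is a finite dimensional (immersed) Legendrian submanifold of $J^1B_{\mathcal F}$ of dimension $N$.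
   Context: A contact form on $M$ is $\lambda\in\Omega^1(M)$ with $\mu_\lambda:=\lambda\wedge(d\lambda)^n$ nowhere vanishing; it is positive if $\mu_\lambda$ is positive for the orientation. $\mathfrak C^+(M)$ is the set of positive contact forms, an open subset of $\Omega^1(M)$, with tangent space $\Omega^1(M)$ at each point. For a contact structure $\xi$, $\mathfrak C^+(M,\xi)$ is the set of positive contact forms $\lambda$ with $\ker\lambda=\xi$; its tangent space at $\lambda$ is $\{h\lambda: h\in C^\infty(M,\mathbb R)\}$. $\mu_\lambda$ also denotes the associated measure. Observation map: $\mathcal O_{F_i}(\lambda)=\int_M F_i\,d\mu_\lambda$ and $\mathcal O_{\mathcal F}=(\mathcal O_{F_1},\dots,\mathcal O_{F_N})$. Relative entropy: $\mathcal S_{\lambda_0}(\lambda)=\int_M\log\left(\frac{d\mu_\lambda}{d\mu_{\lambda_0}}\right)d\mu_\lambda$. Vertical critical set: $\Sigma_{\mathcal S_{\lambda_0};\mathcal F}=\{\lambda\in\mathfrak C: d\mathcal S_{\lambda_0}(\lambda)\text{ vanishes on }\ker d\mathcal O_{\mathcal F}(\lambda)\}$. For $\lambda\in\Sigma_{\mathcal S_{\lambda_0};\mathcal F}$ there is a unique $p=(p_1,\dots,p_N)\in\mathbb R^N$ (the Lagrange multiplier) with $d\mathcal S_{\lambda_0}(\lambda)=\sum_i p_i\,d\mathcal O_{F_i}(\lambda)$; it represents the horizontal differential $D^h\mathcal S_{\lambda_0}(\lambda)\in T^*_{\mathcal O_{\mathcal F}(\lambda)}B_{\mathcal F}$. Define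 $\iota_{\mathcal S_{\lambda_0}}:\Sigma_{\mathcal S_{\lambda_0};\mathcal F}\to J^1B_{\mathcal F}$ by $\iota_{\mathcal S_{\lambda_0}}(\lambda)=(\mathcal O_{\mathcal F}(\lambda),D^h\mathcal S_{\lambda_0}(\lambda),\mathcal S_{\lambda_0}(\lambda))$, i.e. $q=\mathcal O_{\mathcal F}(\lambda)$, $p=(p_1,\dots,p_N)$ the unique Lagrange multiplier with $d\mathcal S_{\lambda_0}(\lambda)=\sum_{i=1}^N p_i\,d\mathcal O_{F_i}(\lambda)$, $z=\mathcal S_{\lambda_0}(\lambda)$. The contact thermodynamic equilibrium is the image $R_{\mathcal S_{\lambda_0};\mathcal F}=\operatorname{Image}\iota_{\mathcal S_{\lambda_0}}$. An (immersed) submanifold of the $(2N+1)$-dimensional contact manifold $(J^1B_{\mathcal F},\ker\Lambda)$ is Legendrian if it has dimension $N$ and $\Lambda$ pulls back to zero on it. *)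

theory Defs
  imports "HOL-Analysis.Analysis"
begin

section \<open>Smooth maps between Euclidean spaces\<close>

text \<open>Only used for open \<open>S\<close>.  On an open subset of a finite-dimensional space, continuity of
  all iterated directional derivatives up to order \<open>k\<close> is the usual class \<open>C^k\<close>.\<close>

primrec Ck_on :: "nat \<Rightarrow> 'a::real_normed_vector set \<Rightarrow> ('a \<Rightarrow> 'b::real_normed_vector) \<Rightarrow> bool"
  where
    "Ck_on 0 S f \<longleftrightarrow> continuous_on S f"
  | "Ck_on (Suc k) S f \<longleftrightarrow>
       (\<forall>x\<in>S. f differentiable (at x)) \<and> (\<forall>v. Ck_on k S (\<lambda>x. frechet_derivative f (at x) v))"

definition smooth_on :: "'a::real_normed_vector set \<Rightarrow> ('a \<Rightarrow> 'b::real_normed_vector) \<Rightarrow> bool"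
  where "smooth_on S f \<longleftrightarrow> (\<forall>k. Ck_on k S f)"

section \<open>Smooth manifolds\<close>

text \<open>A chart is a pair of a domain and a coordinate map; the values of the coordinate map
  outside the domain are irrelevant.  The dimension of a manifold is \<open>CARD('d)\<close>.\<close>

type_synonym ('m, 'd) chart = "'m set \<times> ('m \<Rightarrow> real^'d)"

definition cdom :: "('m, 'd::finite) chart \<Rightarrow> 'm set"
  where "cdom c = fst c"

definition cimg :: "('m, 'd::finite) chart \<Rightarrow> (real^'d) set"
  where "cimg c = snd c ` cdom c"

definition cinv :: "('m, 'd::finite) chart \<Rightarrow> real^'d \<Rightarrow> 'm"
  where "cinv c = inv_into (cdom c) (snd c)"

definition overlap :: "('m, 'd::finite) chart \<Rightarrow> ('m, 'd) chart \<Rightarrow> (real^'d) set"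
  where "overlap c c' = snd c ` (cdom c \<inter> cdom c')"

definition transition :: "('m, 'd::finite) chart \<Rightarrow> ('m, 'd) chart \<Rightarrow> real^'d \<Rightarrow> real^'d"
  where "transition c c' = snd c' \<circ> cinv c"

definition is_chart :: "'m topology \<Rightarrow> ('m, 'd::finite) chart \<Rightarrow> bool"
  where "is_chart X c \<longleftrightarrow>
    openin X (cdom c) \<and> open (cimg c) \<and>
    homeomorphic_map (subtopology X (cdom c)) (top_of_set (cimg c)) (snd c)"

definition second_countable_space :: "'m topology \<Rightarrow> bool"
  where "second_countable_space X \<longleftrightarrow>
    (\<exists>\<B>. countable \<B> \<and> (\<forall>V\<in>\<B>. openin X V) \<and>
         (\<forall>U x. openin X U \<and> x \<in> U \<longrightarrow> (\<exists>V\<in>\<B>. x \<in> V \<and> V \<subseteq> U)))"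

definition smooth_manifold :: "'m topology \<Rightarrow> ('m, 'd::finite) chart set \<Rightarrow> bool"
  where "smooth_manifold X A \<longleftrightarrow>
    Hausdorff_space X \<and> second_countable_space X \<and>
    (\<forall>c\<in>A. is_chart X c) \<and> topspace X = (\<Union>c\<in>A. cdom c) \<and>
    (\<forall>c\<in>A. \<forall>c'\<in>A. smooth_on (overlap c c') (transition c c'))"

text \<open>The orientation is the one for which all charts of the atlas are positive.\<close>

definition closed_connected_oriented_manifold ::
    "'m topology \<Rightarrow> ('m, 'd::finite) chart set \<Rightarrow> bool"
  where "closed_connected_oriented_manifold X A \<longleftrightarrow>
    smooth_manifold X A \<and> compact_space X \<and> connected_space X \<and>
    (\<forall>c\<in>A. \<forall>c'\<in>A. \<forall>x\<in>overlap c c'.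
       det (matrix (frechet_derivative (transition c c') (at x))) > 0)"

definition smooth_fun :: "('m, 'd::finite) chart set \<Rightarrow> ('m \<Rightarrow> real) \<Rightarrow> bool"
  where "smooth_fun A f \<longleftrightarrow> (\<forall>c\<in>A. smooth_on (cimg c) (f \<circ> cinv c))"

section \<open>Differential forms\<close>

text \<open>A 1-form is given by its local representatives \<open>\<alpha> c\<close> on the chart images, which are
  related by pullback along the transition maps: \<open>\<alpha> c x v\<close> is the value at the point with
  coordinates \<open>x\<close> on the tangent vector with coordinates \<open>v\<close>.  Off the atlas and off the chart
  images representatives are set to zero, so that equality of 1-forms is equality of functions.\<close>

type_synonym ('m, 'd) oneform = "('m, 'd) chart \<Rightarrow> real^'d \<Rightarrow> real^'d \<Rightarrow> real"

definition Omega1 :: "('m, 'd::finite) chart set \<Rightarrow> ('m, 'd) oneform set"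
  where "Omega1 A = {\<alpha>.
    (\<forall>c x v. \<not> (c \<in> A \<and> x \<in> cimg c) \<longrightarrow> \<alpha> c x v = 0) \<and>
    (\<forall>c\<in>A. (\<forall>x\<in>cimg c. linear (\<alpha> c x)) \<and> (\<forall>v. smooth_on (cimg c) (\<lambda>x. \<alpha> c x v))) \<and>
    (\<forall>c\<in>A. \<forall>c'\<in>A. \<forall>x\<in>overlap c c'. \<forall>v.
       \<alpha> c x v = \<alpha> c' (transition c c' x) (frechet_derivative (transition c c') (at x) v))}"

definition form_add_scaled ::
    "('m, 'd::finite) oneform \<Rightarrow> real \<Rightarrow> ('m, 'd) oneform \<Rightarrow> ('m, 'd) oneform"
  where "form_add_scaled lam t \<alpha> = (\<lambda>c x v. lam c x v + t * \<alpha> c x v)"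

definition fun_mult_form ::
    "('m \<Rightarrow> real) \<Rightarrow> ('m, 'd::finite) oneform \<Rightarrow> ('m, 'd) oneform"
  where "fun_mult_form h \<alpha> = (\<lambda>c x v. h (cinv c x) * \<alpha> c x v)"

type_synonym ('m, 'd) plane_field = "('m, 'd) chart \<Rightarrow> real^'d \<Rightarrow> (real^'d) set"

definition form_kernel :: "('m, 'd::finite) oneform \<Rightarrow> ('m, 'd) plane_field"
  where "form_kernel \<alpha> c x = {v. \<alpha> c x v = 0}"

text \<open>An alternating \<open>k\<close>-form on a vector space is a function of a sequence of vectors that
  depends only on the first \<open>k\<close> entries.  The wedge product is normalised so that
  \<open>e^1 \<and> \<dots> \<and> e^d\<close> is the determinant.\<close>

type_synonym 'v altform = "(nat \<Rightarrow> 'v) \<Rightarrow> real"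

definition wedge :: "nat \<Rightarrow> nat \<Rightarrow> 'v altform \<Rightarrow> 'v altform \<Rightarrow> 'v altform"
  where "wedge k l \<alpha> \<beta> = (\<lambda>v.
    (\<Sum>\<sigma> | \<sigma> permutes {..<k + l}.
       of_int (sign \<sigma>) * \<alpha> (\<lambda>i. v (\<sigma> i)) * \<beta> (\<lambda>i. v (\<sigma> (k + i)))) / (fact k * fact l))"

primrec wedge_power :: "nat \<Rightarrow> 'v altform \<Rightarrow> nat \<Rightarrow> 'v altform"
  where
    "wedge_power k \<alpha> 0 = (\<lambda>v. 1)"
  | "wedge_power k \<alpha> (Suc m) = wedge k (k * m) \<alpha> (wedge_power k \<alpha> m)"

definition one_altform :: "('v \<Rightarrow> real) \<Rightarrow> 'v altform"
  where "one_altform a = (\<lambda>v. a (v 0))"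

definition ext_deriv :: "(real^'d::finite \<Rightarrow> real^'d \<Rightarrow> real) \<Rightarrow> real^'d \<Rightarrow> (real^'d) altform"
  where "ext_deriv a x = (\<lambda>v.
    frechet_derivative (\<lambda>y. a y (v 1)) (at x) (v 0) -
    frechet_derivative (\<lambda>y. a y (v 0)) (at x) (v 1))"

type_synonym ('m, 'd) form_family = "('m, 'd) chart \<Rightarrow> real^'d \<Rightarrow> (real^'d) altform"

definition contact_volume_form :: "nat \<Rightarrow> ('m, 'd::finite) oneform \<Rightarrow> ('m, 'd) form_family"
  where "contact_volume_form n lam c x =
    wedge 1 (2 * n) (one_altform (lam c x)) (wedge_power 2 (ext_deriv (lam c) x) n)"

text \<open>The standard basis of \<open>real^'d\<close>, enumerated along the order of the index type.\<close>

definition std_frame :: "nat \<Rightarrow> real^'d::{finite,wellorder}"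
  where "std_frame i = axis (sorted_list_of_set (UNIV :: 'd set) ! i) 1"

text \<open>The measure of a positive top-degree form: in every chart of the oriented atlas its density
  with respect to Lebesgue measure is the coefficient of the form.\<close>

definition form_measure ::
    "'m topology \<Rightarrow> ('m, 'd::{finite,wellorder}) chart set \<Rightarrow>
     ('m, 'd) form_family \<Rightarrow> 'm measure"
  where "form_measure X A \<omega> = (THE \<mu>.
    space \<mu> = topspace X \<and> sets \<mu> = sigma_sets (topspace X) {U. openin X U} \<and>
    (\<forall>c\<in>A. \<forall>E\<in>sets \<mu>. E \<subseteq> cdom c \<longrightarrow>
       emeasure \<mu> E = (\<integral>\<^sup>+x\<in>snd c ` E. ennreal (\<omega> c x std_frame) \<partial>lborel)))"

section \<open>Contact forms\<close>

definition pos_contact_forms ::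
    "('m, 'd::{finite,wellorder}) chart set \<Rightarrow> nat \<Rightarrow> ('m, 'd) oneform set"
  where "pos_contact_forms A n = {lam \<in> Omega1 A.
    \<forall>c\<in>A. \<forall>x\<in>cimg c. contact_volume_form n lam c x std_frame > 0}"

definition pos_contact_forms_ker ::
    "('m, 'd::{finite,wellorder}) chart set \<Rightarrow> nat \<Rightarrow> ('m, 'd) plane_field \<Rightarrow>
     ('m, 'd) oneform set"
  where "pos_contact_forms_ker A n \<xi> = {lam \<in> pos_contact_forms A n. form_kernel lam = \<xi>}"

definition conformal_tangent ::
    "('m, 'd::finite) chart set \<Rightarrow> ('m, 'd) oneform \<Rightarrow> ('m, 'd) oneform set"
  where "conformal_tangent A lam = {fun_mult_form h lam | h. smooth_fun A h}"

definition contact_measure ::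
    "'m topology \<Rightarrow> ('m, 'd::{finite,wellorder}) chart set \<Rightarrow> nat \<Rightarrow> ('m, 'd) oneform \<Rightarrow> 'm measure"
  where "contact_measure X A n lam = form_measure X A (contact_volume_form n lam)"

section \<open>Observation map, relative entropy and equilibrium\<close>

definition obs ::
    "'m topology \<Rightarrow> ('m, 'd::{finite,wellorder}) chart set \<Rightarrow> nat \<Rightarrow> ('m \<Rightarrow> real) \<Rightarrow>
     ('m, 'd) oneform \<Rightarrow> real"
  where "obs X A n f lam = (\<integral>x. f x \<partial>contact_measure X A n lam)"

definition observation_map ::
    "'m topology \<Rightarrow> ('m, 'd::{finite,wellorder}) chart set \<Rightarrow> nat \<Rightarrow> ('N::finite \<Rightarrow> 'm \<Rightarrow> real) \<Rightarrow>
     ('m, 'd) oneform \<Rightarrow> real^'N"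
  where "observation_map X A n F lam = (\<chi> i. obs X A n (F i) lam)"

definition rel_entropy ::
    "'m topology \<Rightarrow> ('m, 'd::{finite,wellorder}) chart set \<Rightarrow> nat \<Rightarrow> ('m, 'd) oneform \<Rightarrow>
     ('m, 'd) oneform \<Rightarrow> real"
  where "rel_entropy X A n lam0 lam =
    (\<integral>x. ln (enn2real (RN_deriv (contact_measure X A n lam0) (contact_measure X A n lam) x))
       \<partial>contact_measure X A n lam)"

text \<open>The differential of a functional on a space of 1-forms, as its directional derivative.  It
  is only applied to directions tangent to the space; for both spaces of contact forms the
  segment \<open>lam + t \<alpha>\<close> with \<open>\<alpha>\<close> tangent stays inside the space for small \<open>t\<close>.\<close>

definition form_differential ::
    "(('m, 'd::finite) oneform \<Rightarrow> real) \<Rightarrow> ('m, 'd) oneform \<Rightarrow> ('m, 'd) oneform \<Rightarrow> real"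
  where "form_differential \<Phi> lam \<alpha> = deriv (\<lambda>t. \<Phi> (form_add_scaled lam t \<alpha>)) 0"

definition obs_differential ::
    "'m topology \<Rightarrow> ('m, 'd::{finite,wellorder}) chart set \<Rightarrow> nat \<Rightarrow> ('N::finite \<Rightarrow> 'm \<Rightarrow> real) \<Rightarrow>
     ('m, 'd) oneform \<Rightarrow> ('m, 'd) oneform \<Rightarrow> real^'N"
  where "obs_differential X A n F lam \<alpha> = (\<chi> i. form_differential (obs X A n (F i)) lam \<alpha>)"

text \<open>In the following, \<open>C\<close> is a phase space and \<open>T\<close> assigns to each point its tangent space.\<close>

definition observation_submersion ::
    "'m topology \<Rightarrow> ('m, 'd::{finite,wellorder}) chart set \<Rightarrow> nat \<Rightarrow> ('N::finite \<Rightarrow> 'm \<Rightarrow> real) \<Rightarrow>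
     ('m, 'd) oneform set \<Rightarrow> (('m, 'd) oneform \<Rightarrow> ('m, 'd) oneform set) \<Rightarrow> bool"
  where "observation_submersion X A n F C T \<longleftrightarrow>
    (\<forall>lam\<in>C. obs_differential X A n F lam ` T lam = UNIV)"

definition vertical_critical_set ::
    "'m topology \<Rightarrow> ('m, 'd::{finite,wellorder}) chart set \<Rightarrow> nat \<Rightarrow> ('N::finite \<Rightarrow> 'm \<Rightarrow> real) \<Rightarrow>
     ('m, 'd) oneform set \<Rightarrow> (('m, 'd) oneform \<Rightarrow> ('m, 'd) oneform set) \<Rightarrow>
     ('m, 'd) oneform \<Rightarrow> ('m, 'd) oneform set"
  where "vertical_critical_set X A n F C T lam0 = {lam \<in> C.
    \<forall>\<alpha>\<in>T lam. obs_differential X A n F lam \<alpha> = 0 \<longrightarrow>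
      form_differential (rel_entropy X A n lam0) lam \<alpha> = 0}"

definition lagrange_multiplier ::
    "'m topology \<Rightarrow> ('m, 'd::{finite,wellorder}) chart set \<Rightarrow> nat \<Rightarrow> ('N::finite \<Rightarrow> 'm \<Rightarrow> real) \<Rightarrow>
     (('m, 'd) oneform \<Rightarrow> ('m, 'd) oneform set) \<Rightarrow>
     ('m, 'd) oneform \<Rightarrow> ('m, 'd) oneform \<Rightarrow> real^'N"
  where "lagrange_multiplier X A n F T lam0 lam = (THE p. \<forall>\<alpha>\<in>T lam.
    form_differential (rel_entropy X A n lam0) lam \<alpha> =
      (\<Sum>i\<in>UNIV. p $ i * form_differential (obs X A n (F i)) lam \<alpha>))"

text \<open>Points \<open>(q, p, z)\<close> of the one-jet bundle.\<close>

type_synonym 'N jet = "(real^'N) \<times> (real^'N) \<times> real"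

definition jet_bundle :: "(real^'N::finite) set \<Rightarrow> 'N jet set"
  where "jet_bundle B = B \<times> UNIV \<times> UNIV"

definition std_contact_form :: "'N::finite jet \<Rightarrow> 'N jet \<Rightarrow> real"
  where "std_contact_form = (\<lambda>(q, p, z) (dq, dp, dz). dz - (\<Sum>i\<in>UNIV. p $ i * dq $ i))"

definition equilibrium_embedding ::
    "'m topology \<Rightarrow> ('m, 'd::{finite,wellorder}) chart set \<Rightarrow> nat \<Rightarrow> ('N::finite \<Rightarrow> 'm \<Rightarrow> real) \<Rightarrow>
     (('m, 'd) oneform \<Rightarrow> ('m, 'd) oneform set) \<Rightarrow>
     ('m, 'd) oneform \<Rightarrow> ('m, 'd) oneform \<Rightarrow> 'N jet"
  where "equilibrium_embedding X A n F T lam0 lam =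
    (observation_map X A n F lam, lagrange_multiplier X A n F T lam0 lam, rel_entropy X A n lam0 lam)"

definition thermodynamic_equilibrium ::
    "'m topology \<Rightarrow> ('m, 'd::{finite,wellorder}) chart set \<Rightarrow> nat \<Rightarrow> ('N::finite \<Rightarrow> 'm \<Rightarrow> real) \<Rightarrow>
     ('m, 'd) oneform set \<Rightarrow> (('m, 'd) oneform \<Rightarrow> ('m, 'd) oneform set) \<Rightarrow>
     ('m, 'd) oneform \<Rightarrow> 'N jet set"
  where "thermodynamic_equilibrium X A n F C T lam0 =
    equilibrium_embedding X A n F T lam0 ` vertical_critical_set X A n F C T lam0"

section \<open>Immersed Legendrian submanifolds of the one-jet bundle\<close>

text \<open>\<open>X\<close> and \<open>A\<close> make \<open>L\<close> a smooth manifold of dimension \<open>CARD('k)\<close> whose inclusion into the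
  ambient Euclidean space is a smooth immersion; the topology of \<open>X\<close> may be finer than the
  subspace topology.\<close>

definition immersed_submanifold ::
    "'e::euclidean_space set \<Rightarrow> 'e topology \<Rightarrow> ('e, 'k::finite) chart set \<Rightarrow> bool"
  where "immersed_submanifold L X A \<longleftrightarrow>
    topspace X = L \<and> smooth_manifold X A \<and>
    (\<forall>c\<in>A. smooth_on (cimg c) (cinv c) \<and>
       (\<forall>x\<in>cimg c. inj (frechet_derivative (cinv c) (at x))))"

definition immersed_legendrian :: "'N::finite jet set \<Rightarrow> 'N jet set \<Rightarrow> bool"
  where "immersed_legendrian J L \<longleftrightarrow> L \<subseteq> J \<and>
    (\<exists>X (A :: ('N jet, 'N) chart set). immersed_submanifold L X A \<and>
       (\<forall>c\<in>A. \<forall>x\<in>cimg c. \<forall>v.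
          std_contact_form (cinv c x) (frechet_derivative (cinv c) (at x) v) = 0))"

end

theory Submission
  imports Defs
begin

text \<open>Write \<open>f\<close> for the density of the measure of a contact form relative to that of \<open>lam0\<close>.  Observables
  are \<open>\<integral> F i * f\<close> and the entropy is \<open>\<integral> f * ln f\<close>, both over the measure of \<open>lam0\<close>; if \<open>f'\<close> is the variation
  of \<open>f\<close> in some direction, then their differentials are \<open>\<integral> F i * f'\<close> and \<open>\<integral> (ln f + 1) * f'\<close>.  Multiplying
  a contact form by \<open>h\<close> multiplies its volume form by \<open>h ^ (n + 1)\<close>, so the conformal directions \<open>h * lam\<close>
  give \<open>f' = (n + 1) * h * f\<close> with arbitrary smooth \<open>h\<close>.  Therefore, in either phase space, a form is
  critical with multiplier \<open>p\<close> exactly if \<open>ln f + 1 = (\<Sum>i. p i * F i)\<close>: the critical densities are the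
  exponential family \<open>exp ((\<Sum>i. p i * F i) - 1)\<close> (\<open>multiplier_critical\<close>, \<open>critical_multiplier\<close>).

  Every \<open>p\<close> occurs, because the multiple of \<open>lam0\<close> by the \<open>(n + 1)\<close>-st root of this density is a form in
  the phase space with the prescribed density (\<open>equilibrium_form\<close>).  Since observations, multiplier and
  entropy of a critical form depend on \<open>p\<close> only, the equilibrium is the image of one map from the space of
  multipliers, with components \<open>q\<close>, \<open>p\<close>, \<open>z\<close> (\<open>thermodynamic_equilibrium_range\<close>).  This map is
  inverse to the projection to \<open>p\<close>, which is therefore a global chart.  Its components \<open>q\<close> and \<open>z\<close> are built
  from moments of the exponential family.  They are smooth, \<open>q\<close> is the gradient of the total mass \<open>Z p\<close>, and \<open>z = (\<Sum>i. p i * q i) - Z p\<close>;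
  hence \<open>dz = (\<Sum>i. p i * dq i)\<close>.

  The geometric input is that the volume form of a 1-form is multiplied by the Jacobian determinant under
  a change of coordinates (\<open>vol_transition\<close>), so that relative densities are functions on the manifold and
  the measures exist (\<open>has_density_exists\<close>), and that densities vary differentiably along segments of
  forms, uniformly on the compact manifold (\<open>dens_taylor\<close>).\<close>

section \<open>Calculus of smooth functions\<close>

lemma has_derivative_frechet:
  "f differentiable (at x) \<Longrightarrow> (f has_derivative frechet_derivative f (at x)) (at x)"
  by (simp add: frechet_derivative_works)

lemma frechet_derivative_eqI:
  "(f has_derivative D) (at x) \<Longrightarrow> frechet_derivative f (at x) = D"
  by (metis frechet_derivative_at)

lemma has_derivative_cong_open:
  assumes "open S" "x \<in> S" "\<And>y. y \<in> S \<Longrightarrow> f y = g y"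
  shows "(f has_derivative D) (at x) \<longleftrightarrow> (g has_derivative D) (at x)"
  using assms has_derivative_transform_within_open[of f D x UNIV S g]
    has_derivative_transform_within_open[of g D x UNIV S f] by auto

lemma frechet_derivative_cong_open:
  assumes "open S" "x \<in> S" "\<And>y. y \<in> S \<Longrightarrow> f y = g y"
  shows "frechet_derivative f (at x) = frechet_derivative g (at x)"
  unfolding frechet_derivative_def using has_derivative_cong_open[OF assms] by simp

lemma Ck_on_cong:
  assumes "open S" "\<And>x. x \<in> S \<Longrightarrow> f x = g x" "Ck_on k S f"
  shows "Ck_on k S g"
  using assms(2,3)
proof (induction k arbitrary: f g)
  case 0
  then show ?case by (simp cong: continuous_on_cong)
next
  case (Suc k)
  have diff: "g differentiable (at x)" if "x \<in> S" for x
    using that Suc.prems has_derivative_cong_open[OF assms(1) that, of f g]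
    unfolding differentiable_def Ck_on.simps by blast
  have "Ck_on k S (\<lambda>x. frechet_derivative g (at x) v)" for v
  proof (rule Suc.IH)
    show "frechet_derivative f (at x) v = frechet_derivative g (at x) v" if "x \<in> S" for x
      by (simp only: frechet_derivative_cong_open[OF assms(1) that Suc.prems(1)])
    show "Ck_on k S (\<lambda>x. frechet_derivative f (at x) v)" using Suc.prems(2) by simp
  qed
  with diff show ?case unfolding Ck_on.simps by blast
qed

lemma Ck_on_Suc_I:
  assumes "open S" "\<And>x. x \<in> S \<Longrightarrow> (f has_derivative D x) (at x)"
    "\<And>v. Ck_on k S (\<lambda>x. D x v)"
  shows "Ck_on (Suc k) S f"
proof -
  have "Ck_on k S (\<lambda>x. frechet_derivative f (at x) v)" for v
    by (rule Ck_on_cong[OF assms(1) _ assms(3)[of v]]) (simp add: frechet_derivative_eqI[OF assms(2)])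
  then show ?thesis using assms(2) unfolding Ck_on.simps differentiable_def by blast
qed

lemma Ck_on_Suc_imp: "Ck_on (Suc k) S f \<Longrightarrow> Ck_on k S f"
proof (induction k arbitrary: f)
  case 0
  then show ?case
    by (auto intro!: continuous_at_imp_continuous_on differentiable_imp_continuous_within)
next
  case (Suc k)
  then show ?case unfolding Ck_on.simps(2)[of "Suc k"] Ck_on.simps(2)[of k] by blast
qed

lemma Ck_on_const: "open S \<Longrightarrow> Ck_on k S (\<lambda>x. c)"
proof (induction k arbitrary: c)
  case (Suc k)
  show ?case
    by (rule Ck_on_Suc_I[where D="\<lambda>x v. 0"]) (rule Suc.prems has_derivative_const Suc.IH)+
qed simp

lemma Ck_on_linear: "open S \<Longrightarrow> bounded_linear f \<Longrightarrow> Ck_on k S f"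
proof (cases k)
  case 0
  assume "bounded_linear f" with 0 show ?thesis
    by (simp add: linear_continuous_on)
next
  case (Suc j)
  assume "open S" "bounded_linear f" then show ?thesis unfolding Suc
    by (intro Ck_on_Suc_I[where D="\<lambda>x. f"] Ck_on_const bounded_linear_imp_has_derivative)
qed

lemma Ck_on_add:
  "open S \<Longrightarrow> Ck_on k S f \<Longrightarrow> Ck_on k S g \<Longrightarrow> Ck_on k S (\<lambda>x. f x + g x)"
proof (induction k arbitrary: f g)
  case (Suc k)
  then show ?case
    by (intro Ck_on_Suc_I[where D="\<lambda>x v. frechet_derivative f (at x) v + frechet_derivative g (at x) v"])
      (auto intro!: derivative_eq_intros has_derivative_frechet)
qed (auto intro: continuous_intros)

lemma Ck_on_mult:
  fixes f g :: "'a::real_normed_vector \<Rightarrow> real"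
  shows "open S \<Longrightarrow> Ck_on k S f \<Longrightarrow> Ck_on k S g \<Longrightarrow> Ck_on k S (\<lambda>x. f x * g x)"
proof (induction k arbitrary: f g)
  case (Suc k)
  have "Ck_on k S (\<lambda>x. f x * frechet_derivative g (at x) v + frechet_derivative f (at x) v * g x)" for v
    using Suc.prems Ck_on_Suc_imp by (intro Ck_on_add Suc.IH) auto
  then show ?case using Suc.prems
    by (intro Ck_on_Suc_I[where D="\<lambda>x v. f x * frechet_derivative g (at x) v + frechet_derivative f (at x) v * g x"])
      (auto intro!: derivative_eq_intros has_derivative_frechet)
qed (auto intro: continuous_intros)

lemma Ck_on_bounded_linear_compose:
  assumes "open S" "bounded_linear L"
  shows "Ck_on k S f \<Longrightarrow> Ck_on k S (\<lambda>x. L (f x))"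
proof (induction k arbitrary: f)
  case 0
  then show ?case using bounded_linear.continuous_on[OF assms(2)] by auto
next
  case (Suc k)
  show ?case
  proof (rule Ck_on_Suc_I[OF assms(1), where D="\<lambda>x v. L (frechet_derivative f (at x) v)"])
    show "((\<lambda>x. L (f x)) has_derivative (\<lambda>v. L (frechet_derivative f (at x) v))) (at x)"
      if "x \<in> S" for x
      using that Suc.prems by (intro bounded_linear.has_derivative[OF assms(2)] has_derivative_frechet) simp
    show "Ck_on k S (\<lambda>x. L (frechet_derivative f (at x) v))" for v
      by (rule Suc.IH) (use Suc.prems in simp)
  qed
qed

text \<open>Carrying the whole sequence of derivatives of the outer function along makes the chain rule
  an induction that does not mention the chain rule for higher derivatives.\<close>

lemma Ck_on_real_compose:
  fixes g :: "'a::real_normed_vector \<Rightarrow> real" and \<phi> :: "nat \<Rightarrow> real \<Rightarrow> real"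
  assumes "open S" "\<And>x. x \<in> S \<Longrightarrow> g x \<in> I"
    and "\<And>j y. y \<in> I \<Longrightarrow> (\<phi> j has_real_derivative \<phi> (Suc j) y) (at y)"
  shows "Ck_on k S g \<Longrightarrow> Ck_on k S (\<lambda>x. \<phi> j (g x))"
proof (induction k arbitrary: j)
  case 0
  have "continuous_on I (\<phi> j)"
    by (meson DERIV_isCont assms(3) continuous_at_imp_continuous_on)
  then show ?case using 0 assms(2) continuous_on_compose2[of I "\<phi> j" S g]
    unfolding Ck_on.simps by blast
next
  case (Suc k)
  have "Ck_on k S (\<lambda>x. \<phi> (Suc j) (g x) * frechet_derivative g (at x) v)" for v
    using Suc.prems Ck_on_Suc_imp by (intro Ck_on_mult Suc.IH assms(1)) auto
  moreover have "((\<lambda>x. \<phi> j (g x)) has_derivative (\<lambda>v. \<phi> (Suc j) (g x) * frechet_derivative g (at x) v)) (at x)"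
    if "x \<in> S" for x
  proof -
    have "(g has_derivative frechet_derivative g (at x)) (at x)"
      using that Suc.prems by (intro has_derivative_frechet) simp
    from DERIV_compose_FDERIV[OF assms(3)[OF assms(2)[OF that], of j] this]
    show ?thesis by (simp only: mult.commute)
  qed
  ultimately show ?case
    by (intro Ck_on_Suc_I[where D="\<lambda>x v. \<phi> (Suc j) (g x) * frechet_derivative g (at x) v"] assms(1))
qed

lemma smooth_on_const: "open S \<Longrightarrow> smooth_on S (\<lambda>x. c)"
  by (simp add: smooth_on_def Ck_on_const)

lemma smooth_on_cong:
  "open S \<Longrightarrow> (\<And>x. x \<in> S \<Longrightarrow> f x = g x) \<Longrightarrow> smooth_on S f \<Longrightarrow> smooth_on S g"
  using Ck_on_cong[of S f g] by (auto simp: smooth_on_def)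

lemma smooth_on_add:
  "open S \<Longrightarrow> smooth_on S f \<Longrightarrow> smooth_on S g \<Longrightarrow> smooth_on S (\<lambda>x. f x + g x)"
  by (simp add: smooth_on_def Ck_on_add)

lemma smooth_on_mult:
  fixes f g :: "'a::real_normed_vector \<Rightarrow> real"
  shows "open S \<Longrightarrow> smooth_on S f \<Longrightarrow> smooth_on S g \<Longrightarrow> smooth_on S (\<lambda>x. f x * g x)"
  by (simp add: smooth_on_def Ck_on_mult)

lemma smooth_on_sum:
  assumes "open S" "\<And>i. i \<in> I \<Longrightarrow> smooth_on S (f i)"
  shows "smooth_on S (\<lambda>x. \<Sum>i\<in>I. f i x)"
proof (cases "finite I")
  case True
  then show ?thesis using assms(2)
  proof (induction I)
    case empty
    then show ?case by (simp add: smooth_on_const assms(1))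
  next
    case (insert i I)
    have "smooth_on S (\<lambda>x. f i x + (\<Sum>i\<in>I. f i x))"
      by (rule smooth_on_add[OF assms(1)]) (use insert in blast)+
    moreover have "(\<lambda>x. \<Sum>i\<in>insert i I. f i x) = (\<lambda>x. f i x + (\<Sum>i\<in>I. f i x))"
      using insert.hyps by simp
    ultimately show ?case by metis
  qed
next
  case False
  show ?thesis unfolding sum.infinite[OF False] by (rule smooth_on_const[OF assms(1)])
qed

lemma smooth_on_bounded_linear_compose:
  "open S \<Longrightarrow> bounded_linear L \<Longrightarrow> smooth_on S f \<Longrightarrow> smooth_on S (\<lambda>x. L (f x))"
  by (simp add: smooth_on_def Ck_on_bounded_linear_compose)

lemma smooth_on_linear: "open S \<Longrightarrow> bounded_linear f \<Longrightarrow> smooth_on S f"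
  by (simp add: smooth_on_def Ck_on_linear)

lemma smooth_on_Pair:
  assumes "open S" "smooth_on S f" "smooth_on S g"
  shows "smooth_on S (\<lambda>x. (f x, g x))"
proof -
  have "smooth_on S (\<lambda>x. (f x, 0) + (0, g x))"
    using assms
    by (intro smooth_on_add smooth_on_bounded_linear_compose[where L="\<lambda>y. (y, 0)"]
        smooth_on_bounded_linear_compose[where L="\<lambda>y. (0, y)"] bounded_linear_Pair
        bounded_linear_ident bounded_linear_zero)
  then show ?thesis by simp
qed

lemma smooth_on_vec_lambda:
  fixes f :: "'i::finite \<Rightarrow> 'a::real_normed_vector \<Rightarrow> real"
  assumes "open S" "\<And>i. smooth_on S (f i)"
  shows "smooth_on S (\<lambda>x. \<chi> i. f i x)"
proof -
  have "smooth_on S (\<lambda>x. f i x *\<^sub>R axis i (1::real))" for i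
    by (rule smooth_on_bounded_linear_compose[OF assms(1) bounded_linear_scaleR_left assms(2)])
  then have "smooth_on S (\<lambda>x. \<Sum>i\<in>UNIV. f i x *\<^sub>R axis i (1::real))"
    by (rule smooth_on_sum[OF assms(1)])
  moreover have "(\<lambda>x. \<Sum>i\<in>UNIV. f i x *\<^sub>R axis i (1::real)) = (\<lambda>x. \<chi> i. f i x)"
    by (simp add: fun_eq_iff vec_eq_iff axis_def if_distrib cong: if_cong)
  ultimately show ?thesis by metis
qed

lemma smooth_on_imp_continuous_on: "smooth_on S f \<Longrightarrow> continuous_on S f"
  using Ck_on.simps(1) smooth_on_def by blast

lemma smooth_on_imp_differentiable: "smooth_on S f \<Longrightarrow> x \<in> S \<Longrightarrow> f differentiable (at x)"
  using Ck_on.simps(2) smooth_on_def by blast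

lemma smooth_on_imp_has_derivative:
  "smooth_on S f \<Longrightarrow> x \<in> S \<Longrightarrow> (f has_derivative frechet_derivative f (at x)) (at x)"
  by (simp add: has_derivative_frechet smooth_on_imp_differentiable)

lemma smooth_on_frechet_derivative:
  "smooth_on S f \<Longrightarrow> smooth_on S (\<lambda>x. frechet_derivative f (at x) v)"
  using Ck_on.simps(2) unfolding smooth_on_def by blast

lemma smooth_on_exp:
  fixes g :: "'a::real_normed_vector \<Rightarrow> real"
  shows "open S \<Longrightarrow> smooth_on S g \<Longrightarrow> smooth_on S (\<lambda>x. exp (g x))"
  unfolding smooth_on_def
  using Ck_on_real_compose[where \<phi>="\<lambda>_. exp" and I=UNIV] DERIV_exp by blast

lemma smooth_on_ln:
  fixes g :: "'a::real_normed_vector \<Rightarrow> real"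
  assumes "open S" "smooth_on S g" "\<And>x. x \<in> S \<Longrightarrow> g x > 0"
  shows "smooth_on S (\<lambda>x. ln (g x))"
proof -
  define \<phi> :: "nat \<Rightarrow> real \<Rightarrow> real" where
    "\<phi> j y = (case j of 0 \<Rightarrow> ln y | Suc i \<Rightarrow> (- 1) ^ i * fact i * inverse y ^ Suc i)" for j y
  have "(\<phi> j has_real_derivative \<phi> (Suc j) y) (at y)" if "y \<in> {0<..}" for j y
  proof (cases j)
    case 0
    have "(ln has_real_derivative inverse y) (at y)"
      using that by (auto intro!: derivative_eq_intros simp: field_simps)
    then show ?thesis using 0 by (simp add: \<phi>_def[abs_def])
  next
    case (Suc i)
    have "((\<lambda>y. inverse y ^ Suc i) has_real_derivative
        (1 + of_nat i) * (- (inverse y ^ Suc (Suc 0)) * inverse y ^ i)) (at y)"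
      by (rule DERIV_power_Suc[OF DERIV_inverse]) (use that in simp)
    from DERIV_cmult[OF this, of "(- 1) ^ i * fact i"]
    have "((\<lambda>y. (- 1) ^ i * fact i * inverse y ^ Suc i) has_real_derivative
        (- 1) ^ Suc i * fact (Suc i) * inverse y ^ Suc (Suc i)) (at y)"
      by (rule DERIV_cong) (simp add: power_Suc2 del: power_inverse power_Suc)
    then show ?thesis using Suc by (simp add: \<phi>_def[abs_def] del: power_Suc fact_Suc)
  qed
  then have "Ck_on k S (\<lambda>x. \<phi> 0 (g x))" for k
    using assms by (intro Ck_on_real_compose[where I="{0<..}" and \<phi>=\<phi>]) (simp_all add: smooth_on_def del: Ck_on.simps)
  then show ?thesis by (simp add: smooth_on_def \<phi>_def)
qed

section \<open>Symmetry of second derivatives\<close>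

lemma has_real_derivative_along_line:
  fixes g :: "'a::real_normed_vector \<Rightarrow> real"
  assumes "g differentiable (at (z + s *\<^sub>R u))"
  shows "((\<lambda>s. g (z + s *\<^sub>R u)) has_real_derivative frechet_derivative g (at (z + s *\<^sub>R u)) u) (at s)"
proof -
  let ?D = "frechet_derivative g (at (z + s *\<^sub>R u))"
  have D: "(g has_derivative ?D) (at (z + s *\<^sub>R u))"
    by (rule has_derivative_frechet[OF assms])
  have "((\<lambda>s. z + s *\<^sub>R u) has_derivative (\<lambda>h. h *\<^sub>R u)) (at s)"
    by (auto intro!: derivative_eq_intros)
  from has_derivative_compose[OF this D]
  have "((\<lambda>s. g (z + s *\<^sub>R u)) has_derivative (\<lambda>h. ?D (h *\<^sub>R u))) (at s)"
    by simp
  moreover have "?D (h *\<^sub>R u) = ?D u * h" for h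
    using D by (simp add: has_derivative_def bounded_linear.linear linear_scale)
  ultimately show ?thesis by (simp add: has_field_derivative_def)
qed

text \<open>The second difference quotient below is symmetric in \<open>u\<close> and \<open>w\<close>, while two applications
  of the mean value theorem identify its limit as an iterated derivative in a prescribed order.\<close>

lemma second_difference_limit:
  fixes f :: "'a::real_normed_vector \<Rightarrow> real" and x u w :: 'a
  assumes S: "open S" "x \<in> S" and f: "smooth_on S f"
  defines "G \<equiv> \<lambda>y. frechet_derivative (\<lambda>y. frechet_derivative f (at y) u) (at y) w"
  shows "((\<lambda>h. (f (x + h *\<^sub>R u + h *\<^sub>R w) - f (x + h *\<^sub>R u) - f (x + h *\<^sub>R w) + f x) / h^2) \<longlongrightarrow> G x)
    (at_right 0)"
proof (rule tendstoI)
  fix e :: real assume "e > 0"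
  let ?fu = "\<lambda>y. frechet_derivative f (at y) u"
  have fu: "smooth_on S ?fu" by (rule smooth_on_frechet_derivative[OF f])
  have "continuous_on S G"
    unfolding G_def using smooth_on_frechet_derivative[OF fu] smooth_on_imp_continuous_on by blast
  then obtain d1 where "d1 > 0" and d1: "\<And>y. y \<in> S \<Longrightarrow> dist y x < d1 \<Longrightarrow> dist (G y) (G x) < e"
    using \<open>x \<in> S\<close> \<open>e > 0\<close> unfolding continuous_on_iff by meson
  obtain d2 where "d2 > 0" and d2: "ball x d2 \<subseteq> S" using S open_contains_ball by blast
  define d where "d = min d1 d2 / (norm u + norm w + 1)"
  have N: "norm u + norm w + 1 > 0" by (smt (verit) norm_ge_zero)
  have "d > 0" using \<open>d1 > 0\<close> \<open>d2 > 0\<close> N by (simp add: d_def)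
  have close: "x + s *\<^sub>R u + t *\<^sub>R w \<in> S \<and> dist (x + s *\<^sub>R u + t *\<^sub>R w) x < d1"
    if "0 \<le> s" "s < d" "0 \<le> t" "t < d" for s t
  proof -
    have "dist (x + s *\<^sub>R u + t *\<^sub>R w) x = norm (s *\<^sub>R u + t *\<^sub>R w)"
      by (simp add: dist_norm)
    also have "\<dots> \<le> s * norm u + t * norm w"
      using that norm_triangle_ineq[of "s *\<^sub>R u" "t *\<^sub>R w"] by simp
    also have "\<dots> \<le> d * norm u + d * norm w"
      using that by (intro add_mono mult_right_mono) auto
    also have "\<dots> < d * (norm u + norm w + 1)" using \<open>d > 0\<close> by (simp add: algebra_simps)
    also have "\<dots> = min d1 d2" using N by (simp add: d_def)
    finally have "dist (x + s *\<^sub>R u + t *\<^sub>R w) x < min d1 d2" .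
    then show ?thesis using d2 by (auto simp: dist_commute)
  qed
  have "dist ((f (x + h *\<^sub>R u + h *\<^sub>R w) - f (x + h *\<^sub>R u) - f (x + h *\<^sub>R w) + f x) / h^2) (G x) < e"
    if h: "0 < h" "h < d" for h
  proof -
    define a where "a s = f ((x + h *\<^sub>R w) + s *\<^sub>R u) - f (x + s *\<^sub>R u)" for s
    have "(a has_real_derivative ?fu ((x + h *\<^sub>R w) + s *\<^sub>R u) - ?fu (x + s *\<^sub>R u)) (at s)"
      if "0 \<le> s" "s \<le> h" for s
      unfolding a_def[abs_def] using close[of s h] close[of s 0] that h f
      by (intro DERIV_diff has_real_derivative_along_line smooth_on_imp_differentiable[OF f])
        (auto simp: algebra_simps)
    from MVT2[OF h(1) this] obtain s where s: "0 < s" "s < h"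
      and as: "a h - a 0 = h * (?fu ((x + h *\<^sub>R w) + s *\<^sub>R u) - ?fu (x + s *\<^sub>R u))" by auto
    have "((\<lambda>t. ?fu ((x + s *\<^sub>R u) + t *\<^sub>R w)) has_real_derivative G ((x + s *\<^sub>R u) + t *\<^sub>R w)) (at t)"
      if "0 \<le> t" "t \<le> h" for t
      unfolding G_def using close[of s t] that h s
      by (intro has_real_derivative_along_line smooth_on_imp_differentiable[OF fu]) auto
    from MVT2[OF h(1) this] obtain t where t: "0 < t" "t < h"
      and at: "?fu ((x + s *\<^sub>R u) + h *\<^sub>R w) - ?fu (x + s *\<^sub>R u) = h * G (x + s *\<^sub>R u + t *\<^sub>R w)" by auto
    have "f (x + h *\<^sub>R u + h *\<^sub>R w) - f (x + h *\<^sub>R u) - f (x + h *\<^sub>R w) + f x = a h - a 0"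
      by (simp add: a_def algebra_simps)
    also have "\<dots> = h^2 * G (x + s *\<^sub>R u + t *\<^sub>R w)"
      using as at by (simp add: algebra_simps power2_eq_square)
    finally have eq: "(f (x + h *\<^sub>R u + h *\<^sub>R w) - f (x + h *\<^sub>R u) - f (x + h *\<^sub>R w) + f x) / h^2
        = G (x + s *\<^sub>R u + t *\<^sub>R w)" using h by simp
    show ?thesis unfolding eq using close[of s t] s t h by (intro d1) auto
  qed
  then show "\<forall>\<^sub>F h in at_right 0. dist ((f (x + h *\<^sub>R u + h *\<^sub>R w) - f (x + h *\<^sub>R u) - f (x + h *\<^sub>R w) + f x) / h^2) (G x) < e"
    unfolding eventually_at_right_field using \<open>d > 0\<close> by blast
qed

lemma symmetric_second_frechet_derivative:
  fixes f :: "'a::real_normed_vector \<Rightarrow> real"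
  assumes "open S" "x \<in> S" "smooth_on S f"
  shows "frechet_derivative (\<lambda>y. frechet_derivative f (at y) u) (at x) w =
    frechet_derivative (\<lambda>y. frechet_derivative f (at y) w) (at x) u"
proof -
  have sym: "f (x + h *\<^sub>R u + h *\<^sub>R w) - f (x + h *\<^sub>R u) - f (x + h *\<^sub>R w) + f x =
      f (x + h *\<^sub>R w + h *\<^sub>R u) - f (x + h *\<^sub>R w) - f (x + h *\<^sub>R u) + f x" for h
    by (simp add: add_ac)
  show ?thesis
    by (rule tendsto_unique[OF _ second_difference_limit[OF assms, of u w, unfolded sym]
        second_difference_limit[OF assms, of w u]]) simp
qed

section \<open>Alternating multilinear forms\<close>

definition multilinear_form :: "nat \<Rightarrow> ('v::real_vector) altform \<Rightarrow> bool" where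
  "multilinear_form m \<omega> \<longleftrightarrow> (\<forall>v. \<forall>i<m. linear (\<lambda>a. \<omega> (v(i := a)))) \<and>
     (\<forall>v w. (\<forall>i<m. v i = w i) \<longrightarrow> \<omega> v = \<omega> w)"

definition alternating_form :: "nat \<Rightarrow> 'v altform \<Rightarrow> bool" where
  "alternating_form m \<omega> \<longleftrightarrow>
     (\<forall>\<tau> v. \<tau> permutes {..<m} \<longrightarrow> \<omega> (\<lambda>i. v (\<tau> i)) = of_int (sign \<tau>) * \<omega> v)"

lemma multilinear_form_cong:
  "multilinear_form m \<omega> \<Longrightarrow> (\<And>i. i < m \<Longrightarrow> v i = w i) \<Longrightarrow> \<omega> v = \<omega> w"
  by (simp add: multilinear_form_def)

lemma multilinear_form_add:
  "multilinear_form m \<omega> \<Longrightarrow> i < m \<Longrightarrow> \<omega> (v(i := a + b)) = \<omega> (v(i := a)) + \<omega> (v(i := b))"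
  by (simp add: multilinear_form_def linear_iff)

lemma multilinear_form_scale:
  "multilinear_form m \<omega> \<Longrightarrow> i < m \<Longrightarrow> \<omega> (v(i := c *\<^sub>R a)) = c * \<omega> (v(i := a))"
  by (simp add: multilinear_form_def linear_iff)

lemma multilinear_form_zero:
  assumes "multilinear_form m \<omega>" "i < m" "v i = 0" shows "\<omega> v = 0"
  using multilinear_form_scale[OF assms(1,2), of v 0 0] assms(3) fun_upd_triv[of v i] by simp

lemma multilinear_form_compose_linear:
  assumes \<omega>: "multilinear_form m \<omega>" and L: "linear L"
  shows "multilinear_form m (\<lambda>v. \<omega> (\<lambda>i. L (v i)))"
proof -
  have upd: "(\<lambda>j. L ((v(i := a)) j)) = (\<lambda>j. L (v j))(i := L a)" for v i a by auto
  have "linear (\<lambda>a. \<omega> (\<lambda>j. L ((v(i := a)) j)))" if "i < m" for v i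
    unfolding upd using \<omega> that linear_compose[OF L, of "\<lambda>a. \<omega> ((\<lambda>j. L (v j))(i := a))"]
    by (simp add: multilinear_form_def o_def)
  moreover have "\<omega> (\<lambda>i. L (v i)) = \<omega> (\<lambda>i. L (w i))" if "\<forall>i<m. v i = w i" for v w
    using that by (intro multilinear_form_cong[OF \<omega>]) simp
  ultimately show ?thesis unfolding multilinear_form_def by blast
qed

lemma alternating_form_compose:
  assumes "alternating_form m \<omega>"
  shows "alternating_form m (\<lambda>v. \<omega> (\<lambda>i. L (v i)))"
  unfolding alternating_form_def
proof (intro allI impI)
  fix \<tau> v assume "\<tau> permutes {..<m}"
  with assms show "\<omega> (\<lambda>i. L (v (\<tau> i))) = of_int (sign \<tau>) * \<omega> (\<lambda>i. L (v i))"
    unfolding alternating_form_def by (elim allE[of _ \<tau>] allE[of _ "\<lambda>i. L (v i)"]) simp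
qed

lemma alternating_form_swap:
  assumes "alternating_form m \<omega>" "i < m" "j < m" "i \<noteq> j"
  shows "\<omega> (\<lambda>k. v (Transposition.transpose i j k)) = - \<omega> v"
  using assms by (auto simp: alternating_form_def permutes_swap_id sign_swap_id)

lemma alternating_form_equal:
  assumes "alternating_form m \<omega>" "i < m" "j < m" "i \<noteq> j" "v i = v j"
  shows "\<omega> v = 0"
proof -
  have "(\<lambda>k. v (Transposition.transpose i j k)) = v"
    using assms(5) by (auto simp: Transposition.transpose_def)
  with alternating_form_swap[OF assms(1-4), of v] show ?thesis by simp
qed

lemma multilinear_form_scale_all:
  assumes "multilinear_form m \<omega>" "k \<le> m"
  shows "\<omega> (\<lambda>i. if i < k then c i *\<^sub>R v i else v i) = (\<Prod>i<k. c i) * \<omega> v"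
  using assms(2)
proof (induction k)
  case (Suc k)
  let ?v = "\<lambda>i. if i < k then c i *\<^sub>R v i else v i"
  have "(\<lambda>i. if i < Suc k then c i *\<^sub>R v i else v i) = ?v(k := c k *\<^sub>R v k)"
    by (auto simp: fun_eq_iff less_Suc_eq)
  moreover have "?v(k := v k) = ?v" by auto
  ultimately show ?case
    using multilinear_form_scale[OF assms(1), of k ?v "c k" "v k"] Suc by simp
qed simp

lemma bij_betw_lessThan_obtain:
  assumes "bij_betw f {..<n} UNIV" obtains i where "i < n" "f i = k"
proof -
  have "k \<in> f ` {..<n}" using bij_betw_imp_surj_on[OF assms] by simp
  then show ?thesis using that by (elim imageE) simp
qed

text \<open>A top-degree alternating form is determined by its value on one frame.  Quantifying over
  all forms inside the induction on row operations makes the column swaps harmless: swapping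
  columns precomposes the form with a linear map.\<close>

lemma alternating_form_rows:
  fixes \<omega> :: "(real^'d::finite) altform" and M :: "real^'d^'d"
  assumes idx: "bij_betw idx {..<CARD('d)} (UNIV :: 'd set)"
    and "multilinear_form CARD('d) \<omega>" "alternating_form CARD('d) \<omega>"
  shows "\<omega> (\<lambda>i. row (idx i) M) = det M * \<omega> (\<lambda>i. axis (idx i) 1)"
  using assms(2,3)
proof (induction M arbitrary: \<omega> rule: induct_matrix_row_operations)
  case (1 M k)
  note zero_row = this
  obtain i where i: "i < CARD('d)" "idx i = k" using bij_betw_lessThan_obtain[OF idx] by metis
  have "\<omega> (\<lambda>i. row (idx i) M) = 0"
    by (rule multilinear_form_zero[OF zero_row(2) i(1)]) (simp only: i(2) zero_row(1))
  moreover have "det M = 0" by (rule det_zero_row(2)[OF zero_row(1)])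
  ultimately show ?case by simp
next
  case (2 M)
  note diagonal = this
  have "row k M = M $ k $ k *\<^sub>R axis k 1" for k
    using diagonal(1)[of k] by (auto simp: vec_eq_iff row_def axis_def)
  then have "\<omega> (\<lambda>i. row (idx i) M) =
      \<omega> (\<lambda>i. if i < CARD('d) then M $ idx i $ idx i *\<^sub>R axis (idx i) 1 else axis (idx i) 1)"
    by (intro multilinear_form_cong[OF diagonal(2)]) simp
  also have "\<dots> = (\<Prod>i<CARD('d). M $ idx i $ idx i) * \<omega> (\<lambda>i. axis (idx i) 1)"
    by (rule multilinear_form_scale_all[OF diagonal(2)]) simp
  also have "(\<Prod>i<CARD('d). M $ idx i $ idx i) = (\<Prod>k\<in>UNIV. M $ k $ k)"
    by (rule prod.reindex_bij_betw[OF idx])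
  also have "\<dots> = det M" using diagonal(1) by (simp add: det_diagonal)
  finally show ?case .
next
  case (3 M a b)
  note swap_cols = "3.hyps" "3.prems"
  let ?S = "\<lambda>x::real^'d. \<chi> j. x $ Transposition.transpose a b j"
  obtain i j where ij: "i < CARD('d)" "idx i = a" "j < CARD('d)" "idx j = b"
    using bij_betw_lessThan_obtain[OF idx] by metis
  have S: "linear ?S" by (auto simp: linear_iff vec_eq_iff)
  have ne: "i \<noteq> j" using ij swap_cols(1) by auto
  have "?S (axis (idx k) 1) = axis (idx (Transposition.transpose i j k)) 1" if "k < CARD('d)" for k
    using that ij idx by (auto simp: vec_eq_iff axis_def Transposition.transpose_def bij_betw_def inj_on_def)
  then have "\<omega> (\<lambda>k. ?S (axis (idx k) 1)) = \<omega> (\<lambda>k. axis (idx (Transposition.transpose i j k)) 1)"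
    by (intro multilinear_form_cong[OF swap_cols(2)])
  also have "\<dots> = - \<omega> (\<lambda>k. axis (idx k) 1)"
    by (rule alternating_form_swap[OF swap_cols(3) ij(1,3) ne])
  finally have ax: "\<omega> (\<lambda>k. ?S (axis (idx k) 1)) = - \<omega> (\<lambda>k. axis (idx k) 1)" .
  have "\<omega> (\<lambda>k. row (idx k) (\<chi> i j. M $ i $ Transposition.transpose a b j)) =
      \<omega> (\<lambda>k. ?S (row (idx k) M))"
    by (simp add: row_def)
  also have "\<dots> = det M * \<omega> (\<lambda>k. ?S (axis (idx k) 1))"
    using "3.IH"[OF multilinear_form_compose_linear[OF swap_cols(2) S]
        alternating_form_compose[OF swap_cols(3)]] .
  also have "\<dots> = - det M * \<omega> (\<lambda>k. axis (idx k) 1)" using ax by simp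
  also have "- det M = det (\<chi> i j. M $ i $ Transposition.transpose a b j)"
    using det_permute_columns[of "Transposition.transpose a b" M] swap_cols(1)
    by (simp add: permutes_swap_id sign_swap_id)
  finally show ?case .
next
  case (4 M a b c)
  note row_op = "4.IH" "4.hyps" "4.prems"
  obtain i j where ij: "i < CARD('d)" "idx i = a" "j < CARD('d)" "idx j = b"
    using bij_betw_lessThan_obtain[OF idx] by metis
  let ?M = "\<chi> i. if i = a then row a M + c *\<^sub>R row b M else row i M"
  let ?v = "\<lambda>k. row (idx k) M"
  have "\<omega> (\<lambda>k. row (idx k) ?M) = \<omega> (?v(i := ?v i + c *\<^sub>R ?v j))"
    using idx ij
    by (intro multilinear_form_cong[OF row_op(3)])
      (auto simp: row_def vec_eq_iff bij_betw_def inj_on_def)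
  also have "\<dots> = \<omega> ?v + c * \<omega> (?v(i := ?v j))"
    by (simp only: multilinear_form_add[OF row_op(3) ij(1)] multilinear_form_scale[OF row_op(3) ij(1)]
        fun_upd_triv[of ?v i])
  also have "\<omega> (?v(i := ?v j)) = 0"
    using ij row_op(2) by (intro alternating_form_equal[OF row_op(4) ij(1,3)]) auto
  also have "\<omega> ?v + c * 0 = det M * \<omega> (\<lambda>k. axis (idx k) 1)" using row_op by simp
  also have "det M = det ?M" by (rule det_row_operation[OF row_op(2), of M c, unfolded scalar_mult_eq_scaleR, symmetric])
  finally show ?case .
qed

lemma std_frame_bij:
  "bij_betw (\<lambda>i. sorted_list_of_set (UNIV :: 'd::{finite,wellorder} set) ! i) {..<CARD('d)} UNIV"
  by (rule bij_betw_nth) auto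

lemma alternating_form_linear_image:
  fixes \<omega> :: "(real^'d::{finite,wellorder}) altform"
  assumes "multilinear_form CARD('d) \<omega>" "alternating_form CARD('d) \<omega>" "linear L"
  shows "\<omega> (\<lambda>i. L (std_frame i)) = det (matrix L) * \<omega> std_frame"
proof -
  have "row k (transpose (matrix L)) = L (axis k 1)" for k
    by (simp add: row_transpose matrix_def column_def vec_eq_iff)
  then show ?thesis
    using alternating_form_rows[OF std_frame_bij assms(1,2), of "transpose (matrix L)"]
    by (simp add: std_frame_def[abs_def] det_transpose)
qed

section \<open>Wedge products\<close>

text \<open>The wedge product is an antisymmetrisation: permuting the arguments only reindexes its sum over
  permutations.\<close>

lemma alternating_form_wedge: "alternating_form (k + l) (wedge k l \<alpha> \<beta>)"
  unfolding alternating_form_def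
proof (intro allI impI)
  fix \<tau> :: "nat \<Rightarrow> nat" and v :: "nat \<Rightarrow> 'a" assume \<tau>: "\<tau> permutes {..<k + l}"
  let ?P = "{\<sigma>. \<sigma> permutes {..<k + l}}"
  let ?t = "\<lambda>\<sigma>. of_int (sign \<sigma>) * \<alpha> (\<lambda>i. v (\<sigma> i)) * \<beta> (\<lambda>i. v (\<sigma> (k + i)))"
  have perm: "permutation \<sigma>" if "\<sigma> \<in> ?P" for \<sigma>
    using that permutation_permutes by blast
  have "(\<Sum>\<sigma>\<in>?P. of_int (sign \<sigma>) * \<alpha> (\<lambda>i. v (\<tau> (\<sigma> i))) * \<beta> (\<lambda>i. v (\<tau> (\<sigma> (k + i))))) =
      (\<Sum>\<sigma>\<in>?P. of_int (sign \<tau>) * ?t (\<tau> \<circ> \<sigma>))"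
    using perm \<tau> by (intro sum.cong) (auto simp: sign_compose sign_idempotent simp flip: mult.assoc of_int_mult)
  also have "\<dots> = (\<Sum>\<sigma>\<in>?P. of_int (sign \<tau>) * ?t \<sigma>)"
    by (rule sum.reindex_bij_witness[of _ "\<lambda>\<sigma>. inv \<tau> \<circ> \<sigma>" "\<lambda>\<sigma>. \<tau> \<circ> \<sigma>"])
      (use \<tau> in \<open>auto simp: permutes_compose permutes_inv o_assoc permutes_inv_o\<close>)
  finally show "wedge k l \<alpha> \<beta> (\<lambda>i. v (\<tau> i)) = of_int (sign \<tau>) * wedge k l \<alpha> \<beta> v"
    by (simp add: wedge_def sum_distrib_left algebra_simps)
qed

lemma multilinear_form_wedge:
  assumes \<alpha>: "multilinear_form k \<alpha>" and \<beta>: "multilinear_form l \<beta>"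
  shows "multilinear_form (k + l) (wedge k l \<alpha> \<beta>)"
  unfolding multilinear_form_def
proof (intro conjI allI impI)
  fix v w :: "nat \<Rightarrow> 'a" assume vw: "\<forall>i<k + l. v i = w i"
  have "v (\<sigma> i) = w (\<sigma> i)" if "\<sigma> permutes {..<k + l}" "i < k + l" for \<sigma> i
    using vw that permutes_in_image[of \<sigma>] by auto
  then show "wedge k l \<alpha> \<beta> v = wedge k l \<alpha> \<beta> w"
    unfolding wedge_def
    by (intro arg_cong2[where f="(/)"] sum.cong arg_cong2[where f="(*)"] refl
        multilinear_form_cong[OF \<alpha>] multilinear_form_cong[OF \<beta>]) auto
next
  fix v :: "nat \<Rightarrow> 'a" and j assume j: "j < k + l"
  have lin: "linear (\<lambda>a. \<alpha> (\<lambda>i. (v(j := a)) (\<sigma> i)) * \<beta> (\<lambda>i. (v(j := a)) (\<sigma> (k + i))))"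
    if \<sigma>: "\<sigma> permutes {..<k + l}" for \<sigma>
  proof -
    obtain i where i: "i < k + l" "\<sigma> i = j"
      using \<sigma> j by (metis lessThan_iff permutes_def permutes_in_image)
    have inj: "\<sigma> a = j \<longleftrightarrow> a = i" for a using \<sigma> i by (metis permutes_inverses(2))
    show ?thesis
    proof (cases "i < k")
      case True
      have 1: "(\<lambda>b. (v(j := a)) (\<sigma> b)) = (\<lambda>b. v (\<sigma> b))(i := a)" for a
        using inj by (auto simp: fun_eq_iff)
      have 2: "\<beta> (\<lambda>b. (v(j := a)) (\<sigma> (k + b))) = \<beta> (\<lambda>b. v (\<sigma> (k + b)))" for a
        using inj True by (intro multilinear_form_cong[OF \<beta>]) auto
      show ?thesis unfolding 1 2
        using multilinear_form_add[OF \<alpha> True] multilinear_form_scale[OF \<alpha> True]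
        by (auto simp: linear_iff algebra_simps)
    next
      case False
      then have l: "i - k < l" using i by simp
      have 1: "(\<lambda>b. (v(j := a)) (\<sigma> (k + b))) = (\<lambda>b. v (\<sigma> (k + b)))(i - k := a)" for a
        using inj False by (auto simp: fun_eq_iff)
      have 2: "\<alpha> (\<lambda>b. (v(j := a)) (\<sigma> b)) = \<alpha> (\<lambda>b. v (\<sigma> b))" for a
        using inj False by (intro multilinear_form_cong[OF \<alpha>]) auto
      show ?thesis unfolding 1 2
        using multilinear_form_add[OF \<beta> l] multilinear_form_scale[OF \<beta> l]
        by (auto simp: linear_iff algebra_simps)
    qed
  qed
  have "linear (\<lambda>a. \<Sum>\<sigma> | \<sigma> permutes {..<k + l}.
      (of_int (sign \<sigma>) / (fact k * fact l)) *\<^sub>R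
      (\<alpha> (\<lambda>i. (v(j := a)) (\<sigma> i)) * \<beta> (\<lambda>i. (v(j := a)) (\<sigma> (k + i)))))"
    by (intro linear_compose_sum linear_compose_scale_right ballI lin) simp
  then show "linear (\<lambda>a. wedge k l \<alpha> \<beta> (v(j := a)))"
    by (simp add: wedge_def sum_divide_distrib mult.assoc)
qed

lemma multilinear_form_wedge_power:
  "multilinear_form k \<alpha> \<Longrightarrow> multilinear_form (k * m) (wedge_power k \<alpha> m)"
proof (induction m)
  case 0
  then show ?case by (simp add: multilinear_form_def)
next
  case (Suc m)
  then show ?case using multilinear_form_wedge[of k \<alpha> "k * m"] by simp
qed

lemma wedge_compose:
  "wedge k l (\<lambda>v. \<alpha> (\<lambda>i. L (v i))) (\<lambda>v. \<beta> (\<lambda>i. L (v i))) v = wedge k l \<alpha> \<beta> (\<lambda>i. L (v i))"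
  by (simp add: wedge_def)

lemma wedge_power_compose:
  "wedge_power k (\<lambda>v. \<alpha> (\<lambda>i. L (v i))) m = (\<lambda>v. wedge_power k \<alpha> m (\<lambda>i. L (v i)))"
  by (induction m) (auto simp: wedge_compose intro!: ext)

lemma multilinear_form_one_altform: "linear a \<Longrightarrow> multilinear_form 1 (one_altform a)"
  by (auto simp: multilinear_form_def one_altform_def)

text \<open>On vectors of a subspace \<open>K\<close>, powers of a 2-form depend only on its restriction to \<open>K\<close>.\<close>

lemma wedge_power_restrict_scale:
  assumes "\<And>v. v 0 \<in> K \<Longrightarrow> v 1 \<in> K \<Longrightarrow> \<beta> v = c * \<gamma> v"
  shows "(\<And>i. i < 2 * m \<Longrightarrow> v i \<in> K) \<Longrightarrow> wedge_power 2 \<beta> m v = c ^ m * wedge_power 2 \<gamma> m v"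
proof (induction m arbitrary: v)
  case (Suc m)
  have mem: "v (\<sigma> i) \<in> K" if "\<sigma> permutes {..<2 + 2 * m}" "i < 2 + 2 * m" for \<sigma> i
    using Suc.prems that permutes_in_image[of \<sigma> "{..<2 + 2 * m}" i] by auto
  have "of_int (sign \<sigma>) * \<beta> (\<lambda>i. v (\<sigma> i)) * wedge_power 2 \<beta> m (\<lambda>i. v (\<sigma> (2 + i))) =
    c ^ Suc m * (of_int (sign \<sigma>) * \<gamma> (\<lambda>i. v (\<sigma> i)) * wedge_power 2 \<gamma> m (\<lambda>i. v (\<sigma> (2 + i))))"
    if "\<sigma> permutes {..<2 + 2 * m}" for \<sigma>
    using assms[of "\<lambda>i. v (\<sigma> i)"] Suc.IH[of "\<lambda>i. v (\<sigma> (2 + i))"] mem[OF that] by simp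
  then have "(\<Sum>\<sigma> | \<sigma> permutes {..<2 + 2 * m}.
      of_int (sign \<sigma>) * \<beta> (\<lambda>i. v (\<sigma> i)) * wedge_power 2 \<beta> m (\<lambda>i. v (\<sigma> (2 + i)))) =
    c ^ Suc m * (\<Sum>\<sigma> | \<sigma> permutes {..<2 + 2 * m}.
      of_int (sign \<sigma>) * \<gamma> (\<lambda>i. v (\<sigma> i)) * wedge_power 2 \<gamma> m (\<lambda>i. v (\<sigma> (2 + i))))"
    unfolding sum_distrib_left by (intro sum.cong) auto
  then show ?case unfolding wedge_power.simps wedge_def by simp
qed simp

text \<open>A summand of the wedge product can be nonzero only if its permutation puts the one vector outside
  the kernel into the 1-form; the 2-forms then see vectors of the kernel only.\<close>

lemma wedge_restrict_scale:
  assumes \<omega>: "\<omega>' = (\<lambda>v. h * \<omega> v)" and K: "\<And>i. i \<in> {1..2 * n} \<Longrightarrow> \<omega> (v i) = 0"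
    and \<beta>: "\<And>w. \<omega> (w 0) = 0 \<Longrightarrow> \<omega> (w 1) = 0 \<Longrightarrow> \<beta> w = h * \<gamma> w"
  shows "wedge 1 (2 * n) (one_altform \<omega>') (wedge_power 2 \<beta> n) v =
    h ^ Suc n * wedge 1 (2 * n) (one_altform \<omega>) (wedge_power 2 \<gamma> n) v"
proof -
  have "of_int (sign \<sigma>) * one_altform \<omega>' (\<lambda>i. v (\<sigma> i)) * wedge_power 2 \<beta> n (\<lambda>i. v (\<sigma> (1 + i))) =
    h ^ Suc n * (of_int (sign \<sigma>) * one_altform \<omega> (\<lambda>i. v (\<sigma> i)) * wedge_power 2 \<gamma> n (\<lambda>i. v (\<sigma> (1 + i))))"
    if \<sigma>: "\<sigma> permutes {..<1 + 2 * n}" for \<sigma>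
  proof (cases "\<sigma> 0 = 0")
    case True
    have "v (\<sigma> (1 + i)) \<in> {a. \<omega> a = 0}" if "i < 2 * n" for i
    proof -
      have "\<sigma> (1 + i) < 1 + 2 * n" using permutes_in_image[OF \<sigma>, of "1 + i"] that by simp
      moreover have "\<sigma> (1 + i) \<noteq> 0" using True \<sigma> by (metis add_is_0 permutes_inverses(2) zero_neq_one)
      ultimately show ?thesis using K by simp
    qed
    then have "wedge_power 2 \<beta> n (\<lambda>i. v (\<sigma> (1 + i))) = h ^ n * wedge_power 2 \<gamma> n (\<lambda>i. v (\<sigma> (1 + i)))"
      using \<beta> by (intro wedge_power_restrict_scale[where K="{a. \<omega> a = 0}"]) auto
    then show ?thesis by (simp add: one_altform_def \<omega>)
  next
    case False
    have "\<sigma> 0 < 1 + 2 * n" using permutes_in_image[OF \<sigma>, of 0] by simp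
    with False have "\<omega> (v (\<sigma> 0)) = 0" using K by simp
    then show ?thesis by (simp add: one_altform_def \<omega>)
  qed
  then have "(\<Sum>\<sigma> | \<sigma> permutes {..<1 + 2 * n}.
      of_int (sign \<sigma>) * one_altform \<omega>' (\<lambda>i. v (\<sigma> i)) * wedge_power 2 \<beta> n (\<lambda>i. v (\<sigma> (1 + i)))) =
    h ^ Suc n * (\<Sum>\<sigma> | \<sigma> permutes {..<1 + 2 * n}.
      of_int (sign \<sigma>) * one_altform \<omega> (\<lambda>i. v (\<sigma> i)) * wedge_power 2 \<gamma> n (\<lambda>i. v (\<sigma> (1 + i))))"
    unfolding sum_distrib_left by (intro sum.cong) auto
  then show ?thesis unfolding wedge_def by simp
qed

text \<open>The coefficient of a wedge product on a fixed frame is a polynomial in the coefficients of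
  its factors, so it lies in every algebra of functions containing them.\<close>

definition function_algebra :: "('z \<Rightarrow> real) set \<Rightarrow> bool" where
  "function_algebra Q \<longleftrightarrow> (\<forall>c. (\<lambda>z. c) \<in> Q) \<and>
    (\<forall>f\<in>Q. \<forall>g\<in>Q. (\<lambda>z. f z + g z) \<in> Q \<and> (\<lambda>z. f z * g z) \<in> Q)"

lemma function_algebra_sum:
  assumes "function_algebra Q" "\<And>i. i \<in> I \<Longrightarrow> f i \<in> Q"
  shows "(\<lambda>z. \<Sum>i\<in>I. f i z) \<in> Q"
proof (cases "finite I")
  case True
  then show ?thesis using assms(2)
    by (induction I) (use assms(1) in \<open>auto simp: function_algebra_def\<close>)
next
  case False
  then show ?thesis using assms(1) by (simp add: function_algebra_def)
qed

lemma function_algebra_wedge: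
  assumes Q: "function_algebra Q"
    and "\<And>s. (\<lambda>z. \<alpha> z (\<lambda>i. e (s i))) \<in> Q" "\<And>s. (\<lambda>z. \<beta> z (\<lambda>i. e (s i))) \<in> Q"
  shows "(\<lambda>z. wedge k l (\<alpha> z) (\<beta> z) (\<lambda>i. e (s i))) \<in> Q"
proof -
  have c: "(\<lambda>z. c) \<in> Q" and m: "f \<in> Q \<Longrightarrow> g \<in> Q \<Longrightarrow> (\<lambda>z. f z * g z) \<in> Q" for c f g
    using Q by (auto simp: function_algebra_def)
  have "(\<lambda>z. (\<Sum>\<sigma> | \<sigma> permutes {..<k + l}. of_int (sign \<sigma>) *
       \<alpha> z (\<lambda>i. e (s (\<sigma> i))) * \<beta> z (\<lambda>i. e (s (\<sigma> (k + i))))) * (1 / (fact k * fact l))) \<in> Q"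
    using assms(2)[of "\<lambda>i. s (_ i)"] assms(3)[of "\<lambda>i. s (_ (k + i))"]
    by (intro m function_algebra_sum[OF Q] c)
  then show ?thesis by (simp add: wedge_def)
qed

lemma function_algebra_wedge_power:
  assumes Q: "function_algebra Q" and "\<And>s. (\<lambda>z. \<alpha> z (\<lambda>i. e (s i))) \<in> Q"
  shows "(\<lambda>z. wedge_power k (\<alpha> z) m (\<lambda>i. e (s i))) \<in> Q"
proof (induction m arbitrary: s)
  case 0
  then show ?case using Q by (simp add: function_algebra_def)
next
  case (Suc m)
  then show ?case using function_algebra_wedge[OF Q, where e=e and \<alpha>=\<alpha>] assms(2) by simp
qed

section \<open>The contact volume form\<close>

definition covector_field :: "(real^'d::finite) set \<Rightarrow> (real^'d \<Rightarrow> real^'d \<Rightarrow> real) \<Rightarrow> bool" where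
  "covector_field U a \<longleftrightarrow> (\<forall>x\<in>U. linear (a x)) \<and> (\<forall>v. smooth_on U (\<lambda>x. a x v))"

lemma covector_field_has_derivative:
  "covector_field U a \<Longrightarrow> x \<in> U \<Longrightarrow>
    ((\<lambda>y. a y v) has_derivative frechet_derivative (\<lambda>y. a y v) (at x)) (at x)"
  unfolding covector_field_def by (blast intro: smooth_on_imp_has_derivative)

lemma linear_frechet_derivative_argument:
  assumes U: "open U" "x \<in> U" and a: "covector_field U a"
  shows "linear (\<lambda>v. frechet_derivative (\<lambda>y. a y v) (at x) u)"
proof (rule linearI)
  fix v w
  have eq: "a y v + a y w = a y (v + w)" if "y \<in> U" for y
    using a that by (simp add: covector_field_def linear_add)
  have "((\<lambda>y. a y (v + w)) has_derivative (\<lambda>u. frechet_derivative (\<lambda>y. a y v) (at x) u +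
      frechet_derivative (\<lambda>y. a y w) (at x) u)) (at x)"
    by (rule iffD1[OF has_derivative_cong_open[OF U] has_derivative_add[OF
            covector_field_has_derivative[OF a U(2), of v]
            covector_field_has_derivative[OF a U(2), of w]]]) (rule eq)
  from frechet_derivative_eqI[OF this]
  show "frechet_derivative (\<lambda>y. a y (v + w)) (at x) u =
      frechet_derivative (\<lambda>y. a y v) (at x) u + frechet_derivative (\<lambda>y. a y w) (at x) u" by simp
next
  fix r v
  have eq: "r * a y v = a y (r *\<^sub>R v)" if "y \<in> U" for y
    using a that by (simp add: covector_field_def linear_scale)
  have "((\<lambda>y. a y (r *\<^sub>R v)) has_derivative (\<lambda>u. r * frechet_derivative (\<lambda>y. a y v) (at x) u)) (at x)"
    by (rule iffD1[OF has_derivative_cong_open[OF U] has_derivative_mult_right[OF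
            covector_field_has_derivative[OF a U(2), of v]]]) (rule eq)
  from frechet_derivative_eqI[OF this]
  show "frechet_derivative (\<lambda>y. a y (r *\<^sub>R v)) (at x) u = r *\<^sub>R frechet_derivative (\<lambda>y. a y v) (at x) u"
    by simp
qed

lemma multilinear_form_ext_deriv:
  assumes U: "open U" "x \<in> U" and a: "covector_field U a"
  shows "multilinear_form 2 (ext_deriv a x)"
proof -
  have arg: "linear (\<lambda>v. frechet_derivative (\<lambda>y. a y v) (at x) u)" for u
    by (rule linear_frechet_derivative_argument[OF assms])
  have dir: "linear (frechet_derivative (\<lambda>y. a y v) (at x))" for v
    by (rule has_derivative_linear[OF covector_field_has_derivative[OF a U(2)]])
  have "linear (\<lambda>b. ext_deriv a x (v(i := b)))" if "i < 2" for v i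
  proof -
    have "i = 0 \<or> i = 1" using that by auto
    then show ?thesis
      by (elim disjE) (use arg dir in \<open>simp_all add: ext_deriv_def linear_compose_sub\<close>)
  qed
  moreover have "ext_deriv a x v = ext_deriv a x w" if "\<forall>i<2. v i = w i" for v w
    using that by (simp add: ext_deriv_def)
  ultimately show ?thesis unfolding multilinear_form_def by blast
qed

lemma linear_axis_expansion:
  fixes f :: "real^'d::finite \<Rightarrow> real"
  assumes "linear f" shows "f v = (\<Sum>k\<in>UNIV. v $ k * f (axis k 1))"
proof -
  have "f v = f (\<Sum>k\<in>UNIV. v $ k *\<^sub>R axis k 1)"
    using basis_expansion[of v] by (simp add: scalar_mult_eq_scaleR)
  then show ?thesis using assms by (simp add: linear_sum linear_scale)
qed

text \<open>The terms with second derivatives of the coordinate change are symmetric in the two vectors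
  and cancel; this is why the exterior derivative is independent of coordinates.\<close>

lemma ext_deriv_pullback:
  fixes \<tau> :: "real^'d::finite \<Rightarrow> real^'d"
  assumes U: "open U" "x \<in> U" and V: "open V" and \<tau>: "smooth_on U \<tau>" "\<tau> ` U \<subseteq> V"
    and a: "covector_field V a"
    and b: "\<And>y w. y \<in> U \<Longrightarrow> b y w = a (\<tau> y) (frechet_derivative \<tau> (at y) w)"
  shows "ext_deriv b x v = ext_deriv a (\<tau> x) (\<lambda>i. frechet_derivative \<tau> (at x) (v i))"
proof -
  let ?D = "frechet_derivative \<tau> (at x)"
  define H where "H k w u = frechet_derivative (\<lambda>y. frechet_derivative (\<lambda>y. \<tau> y $ k) (at y) w) (at x) u" for k w u
  have comp: "smooth_on U (\<lambda>y. \<tau> y $ k)" for k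
    by (rule smooth_on_bounded_linear_compose[OF U(1) bounded_linear_vec_nth \<tau>(1)])
  have comp_deriv: "frechet_derivative (\<lambda>y. \<tau> y $ k) (at y) w = frechet_derivative \<tau> (at y) w $ k"
    if "y \<in> U" for y k w
    using frechet_derivative_eqI[OF bounded_linear.has_derivative[OF bounded_linear_vec_nth
          smooth_on_imp_has_derivative[OF \<tau>(1) that]]] by simp
  have \<tau>x: "\<tau> x \<in> V" using U \<tau> by blast
  have main: "frechet_derivative (\<lambda>y. b y w) (at x) u =
      (\<Sum>k\<in>UNIV. H k w u * a (\<tau> x) (axis k 1)) + frechet_derivative (\<lambda>z. a z (?D w)) (at (\<tau> x)) (?D u)" for w u
  proof -
    let ?g = "\<lambda>y. \<Sum>k\<in>UNIV. frechet_derivative (\<lambda>y. \<tau> y $ k) (at y) w * a (\<tau> y) (axis k 1)"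
    let ?g' = "\<lambda>u. \<Sum>k\<in>UNIV. frechet_derivative (\<lambda>y. \<tau> y $ k) (at x) w *
        frechet_derivative (\<lambda>z. a z (axis k 1)) (at (\<tau> x)) (?D u) + H k w u * a (\<tau> x) (axis k 1)"
    have gb: "?g y = b y w" if "y \<in> U" for y
    proof -
      have "linear (a (\<tau> y))" using a that \<tau> by (auto simp: covector_field_def)
      then show ?thesis unfolding b[OF that] comp_deriv[OF that] by (rule linear_axis_expansion[symmetric])
    qed
    have "(?g has_derivative ?g') (at x)"
      unfolding H_def
      by (intro has_derivative_sum has_derivative_mult
          smooth_on_imp_has_derivative[OF smooth_on_frechet_derivative[OF comp] U(2)]
          has_derivative_compose[OF smooth_on_imp_has_derivative[OF \<tau>(1) U(2)]
            covector_field_has_derivative[OF a \<tau>x]])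
    then have "((\<lambda>y. b y w) has_derivative ?g') (at x)"
      by (rule iffD1[OF has_derivative_cong_open[OF U], rotated]) (rule gb)
    from frechet_derivative_eqI[OF this]
    have "frechet_derivative (\<lambda>y. b y w) (at x) u = (\<Sum>k\<in>UNIV. H k w u * a (\<tau> x) (axis k 1)) +
        (\<Sum>k\<in>UNIV. ?D w $ k * frechet_derivative (\<lambda>z. a z (axis k 1)) (at (\<tau> x)) (?D u))"
      by (simp add: sum.distrib comp_deriv[OF U(2)] add.commute)
    also have "(\<Sum>k\<in>UNIV. ?D w $ k * frechet_derivative (\<lambda>z. a z (axis k 1)) (at (\<tau> x)) (?D u)) =
        frechet_derivative (\<lambda>z. a z (?D w)) (at (\<tau> x)) (?D u)"
      by (rule linear_axis_expansion[OF linear_frechet_derivative_argument[OF V \<tau>x a], symmetric])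
    finally show ?thesis .
  qed
  have "H k w u = H k u w" for k w u
    unfolding H_def by (rule symmetric_second_frechet_derivative[OF U comp])
  then have "(\<Sum>k\<in>UNIV. H k (v 1) (v 0) * a (\<tau> x) (axis k 1)) =
      (\<Sum>k\<in>UNIV. H k (v 0) (v 1) * a (\<tau> x) (axis k 1))" by metis
  then show ?thesis unfolding ext_deriv_def main by linarith
qed

lemma multilinear_contact_volume_form:
  assumes "open U" "x \<in> U" "covector_field U (lam c)"
  shows "multilinear_form (1 + 2 * n) (contact_volume_form n lam c x)"
  unfolding contact_volume_form_def
  using assms by (intro multilinear_form_wedge multilinear_form_one_altform
      multilinear_form_wedge_power multilinear_form_ext_deriv) (auto simp: covector_field_def)

lemma alternating_contact_volume_form:
  "alternating_form (1 + 2 * n) (contact_volume_form n lam c x)"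
  unfolding contact_volume_form_def by (rule alternating_form_wedge)

text \<open>Both sides of the conformal law are top-degree alternating forms, so it suffices to compare
  them on an orthogonal frame whose vectors except the first lie in the kernel of the contact form.
  There the term with the derivative of \<open>h\<close> disappears.\<close>

lemma contact_volume_form_fun_mult:
  fixes c :: "('m, 'd::{finite,wellorder}) chart" and lam :: "('m, 'd) oneform"
  assumes dim: "CARD('d) = 2 * n + 1"
    and U: "open (cimg c)" "x \<in> cimg c" and a: "covector_field (cimg c) (lam c)"
    and h: "smooth_on (cimg c) (h \<circ> cinv c)"
  shows "contact_volume_form n (fun_mult_form h lam) c x std_frame =
    h (cinv c x) ^ Suc n * contact_volume_form n lam c x std_frame"
proof (cases "\<forall>v. lam c x v = 0")
  case True
  then show ?thesis
    by (simp add: contact_volume_form_def wedge_def one_altform_def fun_mult_form_def)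
next
  case False
  let ?h = "h \<circ> cinv c" and ?mu = "fun_mult_form h lam"
  have lin: "linear (lam c x)" using a U by (simp add: covector_field_def)
  define g where "g = (\<chi> k. lam c x (axis k 1))"
  have g: "lam c x v = g \<bullet> v" for v
    unfolding linear_axis_expansion[OF lin, of v] by (simp add: g_def inner_vec_def mult.commute)
  then have "g \<noteq> 0" using False by auto
  then have "norm (g /\<^sub>R norm g) = 1" by simp
  from orthogonal_matrix_exists_basis[OF this] obtain B where B: "orthogonal_matrix B"
    "B *v (std_frame 0 :: (real, 'd) vec) = g /\<^sub>R norm g" unfolding std_frame_def by metis
  have ot: "orthogonal_transformation ((*v) B)" using B(1) by (simp add: orthogonal_transformation_matrix)
  have "lam c x (B *v std_frame i) = 0" if "i \<in> {1..2 * n}" for i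
  proof -
    have "g = norm g *\<^sub>R (B *v (std_frame 0 :: (real, 'd) vec))" unfolding B(2) using \<open>g \<noteq> 0\<close> by simp
    then have "lam c x (B *v std_frame i) = norm g * ((B *v (std_frame 0 :: (real, 'd) vec)) \<bullet> (B *v std_frame i))"
      unfolding g by (metis inner_scaleR_left)
    also have "\<dots> = norm g * ((std_frame 0 :: (real, 'd) vec) \<bullet> std_frame i)"
      using ot by (simp add: orthogonal_transformation_def)
    also have "(std_frame 0 :: (real, 'd) vec) \<bullet> std_frame i = 0"
      using that dim inj_on_eq_iff[OF bij_betw_imp_inj_on[OF std_frame_bij[where 'd='d]], of 0 i]
      by (simp add: std_frame_def inner_axis_axis)
    finally show ?thesis by simp
  qed
  note kernel = this
  have hx: "(?h has_derivative frechet_derivative ?h (at x)) (at x)"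
    by (rule smooth_on_imp_has_derivative[OF h U(2)])
  have "frechet_derivative (\<lambda>y. ?mu c y v) (at x) u =
      h (cinv c x) * frechet_derivative (\<lambda>y. lam c y v) (at x) u" if "lam c x v = 0" for u v
    using frechet_derivative_eqI[OF has_derivative_mult[OF hx covector_field_has_derivative[OF a U(2), of v]]] that
    by (simp add: fun_mult_form_def)
  then have d: "ext_deriv (?mu c) x w = h (cinv c x) * ext_deriv (lam c) x w"
    if "lam c x (w 0) = 0" "lam c x (w 1) = 0" for w
    using that by (simp add: ext_deriv_def algebra_simps)
  have frame: "contact_volume_form n ?mu c x (\<lambda>i. B *v std_frame i) =
      h (cinv c x) ^ Suc n * contact_volume_form n lam c x (\<lambda>i. B *v std_frame i)"
    unfolding contact_volume_form_def
    by (rule wedge_restrict_scale) (use kernel d in \<open>auto simp: fun_mult_form_def\<close>)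
  have mu: "covector_field (cimg c) (?mu c)"
    unfolding covector_field_def
  proof (intro conjI allI ballI)
    show "linear (?mu c y)" if "y \<in> cimg c" for y
      using a that linear_compose_scale_right[of "lam c y" "h (cinv c y)"]
      by (simp add: fun_mult_form_def[abs_def] covector_field_def)
    show "smooth_on (cimg c) (\<lambda>y. ?mu c y v)" for v
      using smooth_on_mult[OF U(1) h, of "\<lambda>y. lam c y v"] a
      by (simp add: fun_mult_form_def covector_field_def)
  qed
  have img: "contact_volume_form n \<alpha> c x (\<lambda>i. B *v std_frame i) = det B * contact_volume_form n \<alpha> c x std_frame"
    if "covector_field (cimg c) (\<alpha> c)" for \<alpha> :: "('m, 'd) oneform"
    using alternating_form_linear_image[of "contact_volume_form n \<alpha> c x" "(*v) B"]
      multilinear_contact_volume_form[of _ x \<alpha> c n, OF U that] alternating_contact_volume_form[of n \<alpha> c x] dim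
    by (simp add: add.commute)
  have "det B \<noteq> 0" using det_orthogonal_matrix[OF B(1)] by auto
  then show ?thesis using frame unfolding img[of ?mu, OF mu] img[of lam, OF a] by simp
qed

lemma function_algebra_contact_volume_form:
  assumes Q: "function_algebra Q" and "\<And>v. (\<lambda>z. lam z c (x z) v) \<in> Q"
    and "\<And>v w. (\<lambda>z. frechet_derivative (\<lambda>y. lam z c y v) (at (x z)) w) \<in> Q"
  shows "(\<lambda>z. contact_volume_form n (lam z) c (x z) std_frame) \<in> Q"
proof -
  have add: "f \<in> Q \<Longrightarrow> g \<in> Q \<Longrightarrow> (\<lambda>z. f z + g z) \<in> Q"
    and mult: "f \<in> Q \<Longrightarrow> g \<in> Q \<Longrightarrow> (\<lambda>z. f z * g z) \<in> Q" and const: "(\<lambda>z. r) \<in> Q" for f g r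
    using Q by (auto simp: function_algebra_def)
  have d: "(\<lambda>z. ext_deriv (lam z c) (x z) (\<lambda>i. std_frame (s i))) \<in> Q" for s
    using add[OF assms(3) mult[OF const[of "-1"] assms(3)]] by (simp add: ext_deriv_def)
  have o: "(\<lambda>z. one_altform (lam z c (x z)) (\<lambda>i. std_frame (s i))) \<in> Q" for s
    using assms(2) by (simp add: one_altform_def)
  show ?thesis
    unfolding contact_volume_form_def
    using function_algebra_wedge[OF Q, where e=std_frame and s=id and k=1 and l="2 * n" and
        \<alpha>="\<lambda>z. one_altform (lam z c (x z))" and \<beta>="\<lambda>z. wedge_power 2 (ext_deriv (lam z c) (x z)) n"]
      function_algebra_wedge_power[OF Q, where e=std_frame and k=2 and m=n and \<alpha>="\<lambda>z. ext_deriv (lam z c) (x z)"] o d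
    by simp
qed

section \<open>Charts of an oriented manifold\<close>

locale closed_oriented_manifold =
  fixes X :: "'m topology" and A :: "('m, 'd::{finite,wellorder}) chart set"
  assumes closed_oriented: "closed_connected_oriented_manifold X A"
begin

lemma smooth: "smooth_manifold X A" and compact: "compact_space X"
  and oriented: "c \<in> A \<Longrightarrow> c' \<in> A \<Longrightarrow> x \<in> overlap c c' \<Longrightarrow>
    det (matrix (frechet_derivative (transition c c') (at x))) > 0"
  using closed_oriented by (auto simp: closed_connected_oriented_manifold_def)

lemma topspace_charts: "topspace X = (\<Union>c\<in>A. cdom c)"
  using smooth by (simp add: smooth_manifold_def)

lemma smooth_transition: "c \<in> A \<Longrightarrow> c' \<in> A \<Longrightarrow> smooth_on (overlap c c') (transition c c')"
  using smooth by (simp add: smooth_manifold_def)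

lemma chart: assumes "c \<in> A"
  shows open_cdom: "openin X (cdom c)" and open_cimg: "open (cimg c)"
    and chart_homeomorphic: "homeomorphic_map (subtopology X (cdom c)) (top_of_set (cimg c)) (snd c)"
  using assms smooth by (auto simp: smooth_manifold_def is_chart_def)

lemma cdom_subset: "c \<in> A \<Longrightarrow> cdom c \<subseteq> topspace X"
  by (rule openin_subset[OF open_cdom])

lemma topspace_cdom: "c \<in> A \<Longrightarrow> topspace (subtopology X (cdom c)) = cdom c"
  using cdom_subset[of c] by auto

lemma chart_inj: "c \<in> A \<Longrightarrow> inj_on (snd c) (cdom c)"
  using homeomorphic_imp_injective_map[OF chart_homeomorphic] topspace_cdom by metis

lemma cinv_chart: "c \<in> A \<Longrightarrow> m \<in> cdom c \<Longrightarrow> cinv c (snd c m) = m"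
  unfolding cinv_def by (rule inv_into_f_f[OF chart_inj])

lemma chart_cinv: "x \<in> cimg c \<Longrightarrow> snd c (cinv c x) = x"
  unfolding cinv_def cimg_def by (rule f_inv_into_f)

lemma cinv_mem: "x \<in> cimg c \<Longrightarrow> cinv c x \<in> cdom c"
  unfolding cinv_def cimg_def by (rule inv_into_into)

lemma chart_mem: "m \<in> cdom c \<Longrightarrow> snd c m \<in> cimg c"
  by (simp add: cimg_def)

lemma open_chart_preimage:
  assumes "c \<in> A" "open W" shows "openin X {m \<in> cdom c. snd c m \<in> W}"
proof -
  have "openin (top_of_set (cimg c)) (cimg c \<inter> W)" using assms(2) by auto
  from openin_continuous_map_preimage[OF homeomorphic_imp_continuous_map[OF chart_homeomorphic[OF assms(1)]] this]
  have "openin (subtopology X (cdom c)) {m \<in> cdom c. snd c m \<in> cimg c \<inter> W}"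
    unfolding topspace_cdom[OF assms(1)] .
  moreover have "{m \<in> cdom c. snd c m \<in> cimg c \<inter> W} = {m \<in> cdom c. snd c m \<in> W}"
    using chart_mem[of _ c] by blast
  ultimately show ?thesis using openin_open_subtopology[OF open_cdom[OF assms(1)]] by simp
qed

lemma open_chart_image:
  assumes "c \<in> A" "openin X U" "U \<subseteq> cdom c" shows "open (snd c ` U)"
proof -
  have "openin (subtopology X (cdom c)) U"
    using assms openin_open_subtopology[OF open_cdom[OF assms(1)]] by simp
  then have "openin (top_of_set (cimg c)) (snd c ` U)"
    using homeomorphic_imp_open_map[OF chart_homeomorphic[OF assms(1)]] by (simp add: open_map_def)
  then show ?thesis using openin_open_eq[OF open_cimg[OF assms(1)]] by simp
qed

lemma chart_image_eq_vimage:
  assumes "c \<in> A" shows "snd c ` (E \<inter> cdom c) = cinv c -` E \<inter> cimg c"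
  using cinv_chart[OF assms] chart_cinv cinv_mem by (force simp: cimg_def)

lemma overlap_mem:
  assumes "c \<in> A" "c' \<in> A" "x \<in> overlap c c'"
  shows "x \<in> cimg c" "transition c c' x \<in> cimg c'" "cinv c' (transition c c' x) = cinv c x"
    "cinv c x \<in> cdom c \<inter> cdom c'"
proof -
  obtain m where m: "m \<in> cdom c" "m \<in> cdom c'" "x = snd c m"
    using assms(3) by (auto simp: overlap_def)
  then show "x \<in> cimg c" "transition c c' x \<in> cimg c'" "cinv c' (transition c c' x) = cinv c x"
    "cinv c x \<in> cdom c \<inter> cdom c'"
    using cinv_chart[of c m] cinv_chart[of c' m] assms(1,2) chart_mem[of m c] chart_mem[of m c']
    by (simp_all add: transition_def)
qed

lemma overlap_chart: "m \<in> cdom c \<Longrightarrow> m \<in> cdom c' \<Longrightarrow> snd c m \<in> overlap c c'"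
  by (simp add: overlap_def)

lemma transition_chart: "c \<in> A \<Longrightarrow> m \<in> cdom c \<Longrightarrow> transition c c' (snd c m) = snd c' m"
  by (simp add: transition_def cinv_chart)

lemma open_overlap: "c \<in> A \<Longrightarrow> c' \<in> A \<Longrightarrow> open (overlap c c')"
  unfolding overlap_def by (intro open_chart_image openin_Int open_cdom) auto

abbreviation jac :: "('m, 'd) chart \<Rightarrow> ('m, 'd) chart \<Rightarrow> (real, 'd) vec \<Rightarrow> (real, 'd) vec \<Rightarrow> (real, 'd) vec" where
  "jac c c' x \<equiv> frechet_derivative (transition c c') (at x)"

lemma transition_has_derivative:
  "c \<in> A \<Longrightarrow> c' \<in> A \<Longrightarrow> x \<in> overlap c c' \<Longrightarrow>
    (transition c c' has_derivative jac c c' x) (at x)"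
  by (rule smooth_on_imp_has_derivative[OF smooth_transition])

lemma continuous_map_charts:
  fixes f :: "'m \<Rightarrow> real"
  assumes "\<And>c. c \<in> A \<Longrightarrow> continuous_on (cimg c) (\<lambda>x. f (cinv c x))"
  shows "continuous_map X euclidean f"
  unfolding continuous_map_def
proof (intro conjI allI impI)
  fix V :: "real set" assume "openin euclidean V"
  then have V: "open V" by simp
  show "openin X {m \<in> topspace X. f m \<in> V}"
  proof (subst openin_subopen, intro ballI)
    fix m assume m: "m \<in> {m \<in> topspace X. f m \<in> V}"
    then obtain c where c: "c \<in> A" "m \<in> cdom c" using topspace_charts by auto
    have W: "open ((\<lambda>x. f (cinv c x)) -` V \<inter> cimg c)"
      using continuous_open_preimage[OF assms[OF c(1)] open_cimg[OF c(1)] V] by (simp add: Int_commute)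
    let ?T = "{m \<in> cdom c. snd c m \<in> (\<lambda>x. f (cinv c x)) -` V \<inter> cimg c}"
    have "openin X ?T" by (rule open_chart_preimage[OF c(1) W])
    moreover have "m \<in> ?T" using m c cinv_chart[OF c] chart_mem[OF c(2)] by simp
    moreover have "?T \<subseteq> {m \<in> topspace X. f m \<in> V}" using cinv_chart[OF c(1)] cdom_subset[OF c(1)] by auto
    ultimately show "\<exists>T. openin X T \<and> m \<in> T \<and> T \<subseteq> {m \<in> topspace X. f m \<in> V}" by blast
  qed
qed auto

lemma continuous_map_bounded:
  fixes f :: "'m \<Rightarrow> real"
  assumes "continuous_map X euclidean f"
  obtains B where "B \<ge> 0" "\<And>m. m \<in> topspace X \<Longrightarrow> \<bar>f m\<bar> \<le> B"
proof -
  have "compactin euclidean (f ` topspace X)"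
    using compact image_compactin[OF _ assms] by (simp add: compact_space_def)
  then have "bounded (f ` topspace X)" by (simp add: compact_imp_bounded)
  then obtain B where B: "\<forall>m\<in>topspace X. \<bar>f m\<bar> \<le> B" by (auto simp: bounded_iff)
  show ?thesis
    by (rule that[of "max B 0"]) (use B in force)+
qed

text \<open>Since bounds may be weakened, the largest of finitely many local bounds works everywhere.\<close>

lemma compact_local_to_global:
  assumes "\<And>m. m \<in> topspace X \<Longrightarrow> \<exists>U K. openin X U \<and> m \<in> U \<and> (\<forall>m'\<in>U. P K m')"
    and "\<And>K K' m. P K m \<Longrightarrow> K \<le> K' \<Longrightarrow> P (K'::real) m"
  shows "\<exists>K. \<forall>m\<in>topspace X. P K m"
proof -
  let ?\<U> = "{U. openin X U \<and> (\<exists>K. \<forall>m\<in>U. P K m)}"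
  have "topspace X \<subseteq> \<Union>?\<U>" using assms(1) by blast
  moreover have "\<forall>U\<in>?\<U>. openin X U" by simp
  ultimately have "\<exists>\<F>. finite \<F> \<and> \<F> \<subseteq> ?\<U> \<and> topspace X \<subseteq> \<Union>\<F>"
    using compact unfolding compact_space_def compactin_def by meson
  then obtain \<F> where \<F>: "finite \<F>" "\<F> \<subseteq> ?\<U>" "topspace X \<subseteq> \<Union>\<F>" by blast
  then have "\<forall>U\<in>\<F>. \<exists>K. \<forall>m\<in>U. P K m" by auto
  then obtain K where K: "\<And>U m. U \<in> \<F> \<Longrightarrow> m \<in> U \<Longrightarrow> P (K U) m" by metis
  have "P (Max (K ` \<F>)) m" if "m \<in> topspace X" for m
  proof -
    obtain U where U: "U \<in> \<F>" "m \<in> U" using \<F>(3) \<open>m \<in> topspace X\<close> by auto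
    show ?thesis by (rule assms(2)[OF K[OF U]]) (use \<F>(1) U in auto)
  qed
  then show ?thesis by (intro exI ballI)
qed

lemma finite_chart_cover:
  obtains K where "finite K" "K \<subseteq> A" "topspace X = (\<Union>c\<in>K. cdom c)"
proof -
  have "\<forall>U\<in>cdom ` A. openin X U" by (intro ballI) (elim imageE, simp add: open_cdom)
  moreover have "topspace X \<subseteq> \<Union>(cdom ` A)" using topspace_charts by simp
  ultimately have "\<exists>\<F>. finite \<F> \<and> \<F> \<subseteq> cdom ` A \<and> topspace X \<subseteq> \<Union>\<F>"
    using compact unfolding compact_space_def compactin_def by meson
  then obtain \<F> where \<F>: "finite \<F>" "\<F> \<subseteq> cdom ` A" "topspace X \<subseteq> \<Union>\<F>" by blast
  then obtain K where "K \<subseteq> A" "finite K" "\<F> = cdom ` K" by (meson finite_subset_image)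
  moreover have "(\<Union>c\<in>K. cdom c) \<subseteq> topspace X"
    using cdom_subset \<open>K \<subseteq> A\<close> by (intro UN_least) blast
  ultimately show ?thesis using \<F>(3) by (intro that[of K]) auto
qed

section \<open>The measure of a positive density\<close>

text \<open>The coefficient functions, chart by chart, of a positive form of top degree.\<close>

definition positive_density :: "(('m, 'd) chart \<Rightarrow> (real, 'd) vec \<Rightarrow> real) \<Rightarrow> bool" where
  "positive_density D \<longleftrightarrow> (\<forall>c\<in>A. continuous_on (cimg c) (D c) \<and> (\<forall>x\<in>cimg c. D c x > 0)) \<and>
    (\<forall>c\<in>A. \<forall>c'\<in>A. \<forall>x\<in>overlap c c'.
      D c x = det (matrix (jac c c' x)) * D c' (transition c c' x))"

definition has_density :: "'m measure \<Rightarrow> (('m, 'd) chart \<Rightarrow> (real, 'd) vec \<Rightarrow> real) \<Rightarrow> bool" where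
  "has_density \<mu> D \<longleftrightarrow> space \<mu> = topspace X \<and> sets \<mu> = sigma_sets (topspace X) {U. openin X U} \<and>
    (\<forall>c\<in>A. \<forall>E\<in>sets \<mu>. E \<subseteq> cdom c \<longrightarrow>
       emeasure \<mu> E = (\<integral>\<^sup>+x\<in>snd c ` E. ennreal (D c x) \<partial>lborel))"

definition borel_manifold :: "'m measure" where
  "borel_manifold = sigma (topspace X) {U. openin X U}"

lemma openin_Pow: "{U. openin X U} \<subseteq> Pow (topspace X)"
  using openin_subset by auto

lemma space_borel_manifold [simp]: "space borel_manifold = topspace X"
  by (simp add: borel_manifold_def openin_Pow)

lemma sets_borel_manifold: "sets borel_manifold = sigma_sets (topspace X) {U. openin X U}"
  by (simp add: borel_manifold_def openin_Pow)

lemma open_in_sets: "openin X U \<Longrightarrow> U \<in> sets borel_manifold"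
  by (simp add: sets_borel_manifold)

lemma has_density_sets: "has_density \<mu> D \<Longrightarrow> sets \<mu> = sets borel_manifold"
  by (simp add: has_density_def sets_borel_manifold)

lemma has_density_space: "has_density \<mu> D \<Longrightarrow> space \<mu> = topspace X"
  by (simp add: has_density_def)

lemma has_density_emeasure:
  "has_density \<mu> D \<Longrightarrow> c \<in> A \<Longrightarrow> E \<in> sets borel_manifold \<Longrightarrow> E \<subseteq> cdom c \<Longrightarrow>
    emeasure \<mu> E = (\<integral>\<^sup>+x\<in>snd c ` E. ennreal (D c x) \<partial>lborel)"
  unfolding has_density_def sets_borel_manifold by blast

lemma continuous_map_measurable:
  fixes f :: "'m \<Rightarrow> real"
  assumes "continuous_map X euclidean f" shows "f \<in> borel_measurable borel_manifold"
proof (rule borel_measurableI)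
  fix S :: "real set" assume "open S"
  then have "openin X {m \<in> topspace X. f m \<in> S}"
    using assms by (simp add: continuous_map_def)
  moreover have "{m \<in> topspace X. f m \<in> S} = f -` S \<inter> space borel_manifold" by auto
  ultimately show "f -` S \<inter> space borel_manifold \<in> sets borel_manifold"
    using open_in_sets by metis
qed

lemma cinv_measurable:
  assumes "c \<in> A" shows "cinv c \<in> measurable (restrict_space lborel (cimg c)) borel_manifold"
proof -
  have "cinv c -` U \<inter> space (restrict_space lborel (cimg c)) \<in> sets (restrict_space lborel (cimg c))"
    if "openin X U" for U
  proof -
    have "open (cinv c -` U \<inter> cimg c)"
      using open_chart_image[OF assms, of "U \<inter> cdom c"] that open_cdom[OF assms] chart_image_eq_vimage[OF assms, of U]
      by auto
    then show ?thesis using open_cimg[OF assms]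
      by (auto simp: space_restrict_space sets_restrict_space_iff)
  qed
  moreover have "cinv c x \<in> topspace X" if "x \<in> cimg c" for x
    using cinv_mem[OF that] cdom_subset[OF assms] by blast
  ultimately show ?thesis
    using openin_Pow by (intro measurable_sigma_sets[OF sets_borel_manifold])
      (auto simp: space_restrict_space)
qed

lemma chart_image_measurable:
  assumes "c \<in> A" "E \<in> sets borel_manifold" "E \<subseteq> cdom c" shows "snd c ` E \<in> sets borel"
proof -
  have "cinv c -` E \<inter> cimg c \<in> sets (restrict_space lborel (cimg c))"
    using measurable_sets[OF cinv_measurable[OF assms(1)] assms(2)] by (simp add: space_restrict_space)
  moreover have "cinv c -` E \<inter> cimg c = snd c ` E"
    using chart_image_eq_vimage[OF assms(1), of E] assms(3) by (simp add: Int_absorb2)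
  ultimately show ?thesis
    using open_cimg[OF assms(1)] by (auto simp: sets_restrict_space_iff)
qed

definition chart_measure :: "(('m, 'd) chart \<Rightarrow> (real, 'd) vec \<Rightarrow> real) \<Rightarrow> ('m, 'd) chart \<Rightarrow> 'm measure" where
  "chart_measure D c =
    distr (density (restrict_space lborel (cimg c)) (\<lambda>x. ennreal (D c x))) borel_manifold (cinv c)"

lemma sets_chart_measure [simp]: "sets (chart_measure D c) = sets borel_manifold"
  by (simp add: chart_measure_def)

lemma density_measurable_chart:
  assumes "c \<in> A" "continuous_on (cimg c) (D c)"
  shows "(\<lambda>x. ennreal (D c x)) \<in> borel_measurable (restrict_space lborel (cimg c))"
proof -
  have "D c \<in> borel_measurable (restrict_space borel (cimg c))"
    by (rule borel_measurable_continuous_on_restrict[OF assms(2)])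
  then have "D c \<in> borel_measurable (restrict_space lborel (cimg c))"
    by (subst measurable_cong_sets[OF sets_restrict_space_cong[OF sets_lborel] refl])
  then show ?thesis by simp
qed

lemma nn_integral_chart_measure:
  assumes c: "c \<in> A" and D: "continuous_on (cimg c) (D c)" and f: "f \<in> borel_measurable borel_manifold"
    and E: "E \<in> sets borel_manifold" "E \<subseteq> cdom c"
  shows "(\<integral>\<^sup>+m\<in>E. f m \<partial>chart_measure D c) = (\<integral>\<^sup>+x\<in>snd c ` E. ennreal (D c x) * f (cinv c x) \<partial>lborel)"
proof -
  note [measurable] = cinv_measurable[OF c] density_measurable_chart[of c D, OF c D] f E(1)
  have cinv: "cinv c \<in> measurable (density (restrict_space lborel (cimg c)) (\<lambda>x. ennreal (D c x))) borel_manifold"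
    by simp
  have fE: "(\<lambda>m. f m * indicator E m) \<in> borel_measurable borel_manifold" by measurable
  have "(\<integral>\<^sup>+m\<in>E. f m \<partial>chart_measure D c) = (\<integral>\<^sup>+x. ennreal (D c x) * (f (cinv c x) * indicator E (cinv c x))
      \<partial>restrict_space lborel (cimg c))"
    unfolding chart_measure_def nn_integral_distr[OF cinv, of "\<lambda>m. f m * indicator E m", simplified measurable_distr_eq1, OF fE]
    by (subst nn_integral_density) (auto intro!: measurable_compose[OF cinv_measurable[OF c] fE] density_measurable_chart[of c D] c D)
  also have "\<dots> = (\<integral>\<^sup>+x. ennreal (D c x) * (f (cinv c x) * indicator E (cinv c x)) * indicator (cimg c) x \<partial>lborel)"
    by (rule nn_integral_restrict_space) (use open_cimg[OF c] in auto)
  also have "\<dots> = (\<integral>\<^sup>+x\<in>snd c ` E. ennreal (D c x) * f (cinv c x) \<partial>lborel)"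
  proof (rule nn_integral_cong)
    fix x
    have "indicator E (cinv c x) * indicator (cimg c) x = (indicator (snd c ` E) x :: ennreal)"
      using chart_image_eq_vimage[OF c, of E] E(2) by (auto simp: indicator_def Int_absorb2)
    then show "ennreal (D c x) * (f (cinv c x) * indicator E (cinv c x)) * indicator (cimg c) x =
        ennreal (D c x) * f (cinv c x) * indicator (snd c ` E) x"
      by (simp add: mult.assoc)
  qed
  finally show ?thesis .
qed

lemma emeasure_chart_measure:
  assumes c: "c \<in> A" and D: "continuous_on (cimg c) (D c)"
    and E: "E \<in> sets borel_manifold" "E \<subseteq> cdom c"
  shows "emeasure (chart_measure D c) E = (\<integral>\<^sup>+x\<in>snd c ` E. ennreal (D c x) \<partial>lborel)"
  using nn_integral_chart_measure[where f="\<lambda>_. 1" and D=D, OF c D _ E] E(1) by simp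

end

text \<open>This reduces the change of variables for nonnegative integrals, whose values may be infinite, to the
  one for absolutely integrable functions: two values in \<open>[0, \<infinity>]\<close> that equal the same finite numbers
  are equal.\<close>

lemma nn_integral_absolutely_integrable_iff:
  fixes f :: "'a::euclidean_space \<Rightarrow> real"
  assumes "(\<lambda>x. indicator S x *\<^sub>R f x) \<in> borel_measurable lebesgue" "\<And>x. x \<in> S \<Longrightarrow> f x \<ge> 0" "b \<ge> 0"
  shows "(\<integral>\<^sup>+x\<in>S. ennreal (f x) \<partial>lborel) = ennreal b \<longleftrightarrow>
    f absolutely_integrable_on S \<and> integral S f = b"
proof -
  have nonneg: "0 \<le> indicator S x *\<^sub>R f x" for x using assms(2) by (auto simp: indicator_def)
  have "(\<integral>\<^sup>+x\<in>S. ennreal (f x) \<partial>lborel) = (\<integral>\<^sup>+x. ennreal (indicator S x *\<^sub>R f x) \<partial>lebesgue)"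
    unfolding nn_integral_completion
    by (intro nn_integral_cong) (auto simp: indicator_def)
  also have "\<dots> = ennreal b \<longleftrightarrow> integrable lebesgue (\<lambda>x. indicator S x *\<^sub>R f x) \<and>
      integral\<^sup>L lebesgue (\<lambda>x. indicator S x *\<^sub>R f x) = b"
    using assms nonneg by (intro nn_integral_eq_integrable) auto
  also have "\<dots> \<longleftrightarrow> f absolutely_integrable_on S \<and> integral S f = b"
    using set_lebesgue_integral_eq_integral(2)[of S f]
    by (auto simp: set_integrable_def set_lebesgue_integral_def)
  finally show ?thesis .
qed

lemma nn_integral_change_of_variables:
  fixes f k :: "(real, 'd::{finite,wellorder}) vec \<Rightarrow> real" and g :: "(real, 'd) vec \<Rightarrow> (real, 'd) vec"
  assumes S: "S \<in> sets lebesgue" and der: "\<And>x. x \<in> S \<Longrightarrow> (g has_derivative g' x) (at x within S)"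
    and inj: "inj_on g S" and k: "\<And>x. x \<in> S \<Longrightarrow> k x = \<bar>det (matrix (g' x))\<bar> * f (g x)"
    and meas: "(\<lambda>x. indicator S x *\<^sub>R k x) \<in> borel_measurable lebesgue"
      "(\<lambda>x. indicator (g ` S) x *\<^sub>R f x) \<in> borel_measurable lebesgue"
    and f: "\<And>x. x \<in> g ` S \<Longrightarrow> f x \<ge> 0"
  shows "(\<integral>\<^sup>+x\<in>g ` S. ennreal (f x) \<partial>lborel) = (\<integral>\<^sup>+x\<in>S. ennreal (k x) \<partial>lborel)"
proof -
  have k0: "k x \<ge> 0" if "x \<in> S" for x using k f that by simp
  have "(\<lambda>x. \<bar>det (matrix (g' x))\<bar> *\<^sub>R (vec (f (g x)) :: real^1)) absolutely_integrable_on S \<and>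
      integral S (\<lambda>x. \<bar>det (matrix (g' x))\<bar> *\<^sub>R (vec (f (g x)) :: real^1)) = vec b
    \<longleftrightarrow> (\<lambda>x. vec (f x) :: real^1) absolutely_integrable_on g ` S \<and>
      integral (g ` S) (\<lambda>x. vec (f x) :: real^1) = vec b" for b
    by (rule has_absolute_integral_change_of_variables[OF S der inj])
  then have real: "(\<lambda>x. \<bar>det (matrix (g' x))\<bar> * f (g x)) absolutely_integrable_on S \<and>
      integral S (\<lambda>x. \<bar>det (matrix (g' x))\<bar> * f (g x)) = b
    \<longleftrightarrow> f absolutely_integrable_on g ` S \<and> integral (g ` S) f = b" for b
    unfolding absolutely_integrable_on_1_iff integral_on_1_eq by (simp add: vec_eq_iff)
  have "k absolutely_integrable_on S \<longleftrightarrow> (\<lambda>x. \<bar>det (matrix (g' x))\<bar> * f (g x)) absolutely_integrable_on S"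
    by (rule set_integrable_cong) (simp_all add: k)
  moreover have "integral S k = integral S (\<lambda>x. \<bar>det (matrix (g' x))\<bar> * f (g x))"
    by (rule integral_cong) (simp add: k)
  ultimately have iff: "(\<integral>\<^sup>+x\<in>g ` S. ennreal (f x) \<partial>lborel) = ennreal b \<longleftrightarrow>
      (\<integral>\<^sup>+x\<in>S. ennreal (k x) \<partial>lborel) = ennreal b" if "b \<ge> 0" for b
    using nn_integral_absolutely_integrable_iff[OF meas(1) k0 that]
      nn_integral_absolutely_integrable_iff[OF meas(2) f that] real[of b] by auto
  then show ?thesis
    by (cases "\<integral>\<^sup>+x\<in>g ` S. ennreal (f x) \<partial>lborel"; cases "\<integral>\<^sup>+x\<in>S. ennreal (k x) \<partial>lborel") (metis top_neq_ennreal)+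
qed

context closed_oriented_manifold begin

lemma positive_densityD:
  assumes "positive_density D"
  shows "c \<in> A \<Longrightarrow> continuous_on (cimg c) (D c)" "c \<in> A \<Longrightarrow> x \<in> cimg c \<Longrightarrow> D c x > 0"
    "c \<in> A \<Longrightarrow> c' \<in> A \<Longrightarrow> x \<in> overlap c c' \<Longrightarrow>
      D c x = det (matrix (jac c c' x)) * D c' (transition c c' x)"
  using assms by (auto simp: positive_density_def)

lemma indicator_density_measurable:
  assumes "positive_density D" "c \<in> A" "S \<in> sets borel" "S \<subseteq> cimg c"
  shows "(\<lambda>x. indicator S x *\<^sub>R D c x) \<in> borel_measurable lebesgue"
proof -
  have "D c \<in> borel_measurable (restrict_space borel (cimg c))"
    by (rule borel_measurable_continuous_on_restrict[OF positive_densityD(1)[OF assms(1,2)]])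
  then have "(\<lambda>x. indicator (cimg c) x *\<^sub>R D c x) \<in> borel_measurable borel"
    using open_cimg[OF assms(2)] by (subst (asm) borel_measurable_restrict_space_iff) auto
  then have "(\<lambda>x. indicator S x *\<^sub>R (indicator (cimg c) x *\<^sub>R D c x)) \<in> borel_measurable borel"
    using assms(3) by measurable
  moreover have "(\<lambda>x. indicator S x *\<^sub>R (indicator (cimg c) x *\<^sub>R D c x)) = (\<lambda>x. indicator S x *\<^sub>R D c x)"
    using assms(4) by (auto simp: indicator_def fun_eq_iff)
  ultimately show ?thesis by (simp add: measurable_completion)
qed

text \<open>The transformation law of densities has the determinant where the change of variables formula has its
  absolute value; the orientation of the atlas makes them equal.\<close>

lemma chart_measures_agree:
  assumes D: "positive_density D" and c: "c \<in> A" "c' \<in> A"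
    and E: "E \<in> sets borel_manifold" "E \<subseteq> cdom c" "E \<subseteq> cdom c'"
  shows "emeasure (chart_measure D c') E = emeasure (chart_measure D c) E"
proof -
  let ?\<tau> = "transition c c'" and ?S = "snd c ` E"
  have S: "?S \<subseteq> overlap c c'" using E by (auto simp: overlap_def)
  have img: "snd c' ` E = ?\<tau> ` ?S"
    unfolding image_image using E(2) by (intro image_cong) (auto simp: transition_chart[OF c(1)])
  have inj: "inj_on ?\<tau> ?S"
  proof (rule inj_onI)
    fix x y assume xy: "x \<in> ?S" "y \<in> ?S" "?\<tau> x = ?\<tau> y"
    then obtain a b where ab: "a \<in> E" "x = snd c a" "b \<in> E" "y = snd c b" by blast
    then have "snd c' a = snd c' b"
      using xy(3) E(2) by (auto simp: transition_chart[OF c(1)] subset_iff)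
    then have "a = b" using ab E(3) by (intro inj_onD[OF chart_inj[OF c(2)]]) auto
    then show "x = y" using ab by simp
  qed
  have borel: "?S \<in> sets borel" "?\<tau> ` ?S \<in> sets borel"
    using chart_image_measurable[OF c(1) E(1,2)] chart_image_measurable[OF c(2) E(1,3)] img by auto
  have sub: "?S \<subseteq> cimg c" "?\<tau> ` ?S \<subseteq> cimg c'"
    using overlap_mem(1,2)[OF c] S by auto
  have "(\<integral>\<^sup>+x\<in>?\<tau> ` ?S. ennreal (D c' x) \<partial>lborel) = (\<integral>\<^sup>+x\<in>?S. ennreal (D c x) \<partial>lborel)"
  proof (rule nn_integral_change_of_variables[OF _ _ inj])
    show "?S \<in> sets lebesgue" using borel(1) by simp
    show "(?\<tau> has_derivative frechet_derivative ?\<tau> (at x)) (at x within ?S)" if "x \<in> ?S" for x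
      using transition_has_derivative[OF c, of x] S that has_derivative_at_withinI by blast
    show "D c x = \<bar>det (matrix (frechet_derivative ?\<tau> (at x)))\<bar> * D c' (?\<tau> x)" if "x \<in> ?S" for x
      using positive_densityD(3)[OF D c, of x] oriented[OF c, of x] S that by auto
    show "D c' x \<ge> 0" if "x \<in> ?\<tau> ` ?S" for x
      using positive_densityD(2)[OF D c(2)] sub that by (meson less_imp_le subsetD)
  qed (intro indicator_density_measurable[OF D] c borel sub)+
  then show ?thesis
    using emeasure_chart_measure[of _ D, OF c(1) positive_densityD(1)[OF D c(1)] E(1,2)]
      emeasure_chart_measure[of _ D, OF c(2) positive_densityD(1)[OF D c(2)] E(1,3)] img by simp
qed

text \<open>Cutting the manifold into finitely many pieces, each inside one chart, reduces statements
  about a measure on the manifold to statements in single charts.\<close>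

definition chart_partition :: "nat \<Rightarrow> (nat \<Rightarrow> ('m, 'd) chart) \<Rightarrow> (nat \<Rightarrow> 'm set) \<Rightarrow> bool" where
  "chart_partition k c P \<longleftrightarrow> (\<forall>i<k. c i \<in> A \<and> P i \<subseteq> cdom (c i)) \<and>
    (\<forall>i. P i \<in> sets borel_manifold) \<and> disjoint_family P \<and> topspace X = (\<Union>i<k. P i)"

lemma chart_partitionD:
  assumes "chart_partition k c P"
  shows "\<And>i. i < k \<Longrightarrow> c i \<in> A" "\<And>i. i < k \<Longrightarrow> P i \<subseteq> cdom (c i)"
    "\<And>i. P i \<in> sets borel_manifold" "disjoint_family P" "topspace X = (\<Union>i<k. P i)"
  using assms unfolding chart_partition_def by blast+

lemma chart_partition_exists: "\<exists>k c P. chart_partition k c P"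
proof -
  obtain K where K: "finite K" "K \<subseteq> A" "topspace X = (\<Union>c\<in>K. cdom c)"
    by (rule finite_chart_cover)
  obtain c and k :: nat where ck: "K = c ` {..<k}"
    using finite_imp_nat_seg_image_inj_on[OF K(1)] by (metis lessThan_def)
  define B where "B i = (if i < k then cdom (c i) else {})" for i
  have cA: "c i \<in> A" if "i < k" for i using K(2) ck that by auto
  have B: "B i \<in> sets borel_manifold" for i
    using open_in_sets[OF open_cdom[OF cA]] by (simp add: B_def)
  have "(\<Union>i<k. disjointed B i) = (\<Union>i<k. B i)"
    using finite_UN_disjointed_eq[of B k] by (simp add: atLeast0LessThan)
  also have "\<dots> = topspace X" by (simp add: K(3) ck B_def)
  finally have "topspace X = (\<Union>i<k. disjointed B i)" ..
  moreover have "disjointed B i \<in> sets borel_manifold" for i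
    using sets.range_disjointed_sets[of B] B by auto
  moreover have "disjointed B i \<subseteq> cdom (c i)" if "i < k" for i
    using disjointed_subset[of B i] that by (auto simp: B_def)
  ultimately have "chart_partition k c (disjointed B)"
    using cA disjoint_family_disjointed[of B] unfolding chart_partition_def by blast
  then show ?thesis by blast
qed

lemma emeasure_partition:
  assumes "sets \<mu> = sets borel_manifold" "E \<in> sets borel_manifold"
    and "\<And>i. P i \<in> sets borel_manifold" "disjoint_family P" "topspace X = (\<Union>i<k::nat. P i)"
  shows "emeasure \<mu> E = (\<Sum>i<k. emeasure \<mu> (E \<inter> P i))"
proof -
  have "E \<subseteq> topspace X" using sets.sets_into_space[OF assms(2)] by simp
  then have E: "(\<Union>i<k. E \<inter> P i) = E" using assms(5) by auto
  have "disjoint_family_on (\<lambda>i. E \<inter> P i) {..<k}"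
    using assms(4) by (auto simp: disjoint_family_on_def)
  then have "(\<Sum>i<k. emeasure \<mu> (E \<inter> P i)) = emeasure \<mu> (\<Union>i<k. E \<inter> P i)"
    using assms(1,2,3) by (intro sum_emeasure) auto
  then show ?thesis unfolding E by simp
qed

lemma has_density_unique:
  assumes D: "has_density \<mu> D" "has_density \<nu> D" shows "\<mu> = \<nu>"
proof (rule measure_eqI)
  show "sets \<mu> = sets \<nu>" using D by (simp add: has_density_def)
  fix E assume "E \<in> sets \<mu>"
  then have E: "E \<in> sets borel_manifold" using has_density_sets[OF D(1)] by simp
  obtain k c P where "chart_partition k c P" using chart_partition_exists by blast
  note P = chart_partitionD[OF this]
  have "emeasure \<mu> (E \<inter> P i) = emeasure \<nu> (E \<inter> P i)" if "i < k" for i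
  proof -
    have *: "E \<inter> P i \<in> sets borel_manifold" "E \<inter> P i \<subseteq> cdom (c i)"
      using E P(2)[OF that] P(3)[of i] by auto
    show ?thesis
      using has_density_emeasure[OF D(1) P(1)[OF that] *] has_density_emeasure[OF D(2) P(1)[OF that] *] by simp
  qed
  then show "emeasure \<mu> E = emeasure \<nu> E"
    using emeasure_partition[OF has_density_sets[OF D(1)] E P(3-5)]
      emeasure_partition[OF has_density_sets[OF D(2)] E P(3-5)] by simp
qed

lemma has_density_exists:
  assumes D: "positive_density D" shows "\<exists>\<mu>. has_density \<mu> D"
proof -
  obtain k c P where "chart_partition k c P" using chart_partition_exists by blast
  note P = chart_partitionD[OF this]
  define m where "m E = (\<Sum>i<k. emeasure (chart_measure D (c i)) (E \<inter> P i))" for E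
  define \<mu> where "\<mu> = measure_of (topspace X) (sets borel_manifold) m"
  have closed: "sets borel_manifold \<subseteq> Pow (topspace X)" using sets.space_closed[of borel_manifold] by simp
  have sigma: "sigma_sets (topspace X) (sets borel_manifold) = sets borel_manifold"
    using sets.sigma_sets_eq[of borel_manifold] by simp
  have sets: "sets \<mu> = sets borel_manifold" and space: "space \<mu> = topspace X"
    unfolding \<mu>_def using closed sigma by simp_all
  have add: "countably_additive (sets \<mu>) m"
  proof (rule countably_additiveI)
    fix B :: "nat \<Rightarrow> 'm set" assume B: "range B \<subseteq> sets \<mu>" "disjoint_family B"
    have "(\<Sum>j. m (B j)) = (\<Sum>i<k. \<Sum>j. emeasure (chart_measure D (c i)) (B j \<inter> P i))"
      unfolding m_def by (rule suminf_sum) auto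
    also have "\<dots> = (\<Sum>i<k. emeasure (chart_measure D (c i)) (\<Union>j. B j \<inter> P i))"
      using B P(3) sets by (intro sum.cong suminf_emeasure refl) (auto simp: disjoint_family_on_def)
    also have "\<dots> = m (\<Union>j. B j)" unfolding m_def by (intro sum.cong) auto
    finally show "(\<Sum>j. m (B j)) = m (\<Union>j. B j)" .
  qed
  have em: "emeasure \<mu> E = m E" if "E \<in> sets borel_manifold" for E
  proof (rule emeasure_measure_of[OF \<mu>_def closed])
    show "positive (sets \<mu>) m" by (simp add: positive_def m_def)
  qed (use add that sets in auto)
  have "emeasure \<mu> E = (\<integral>\<^sup>+x\<in>snd c' ` E. ennreal (D c' x) \<partial>lborel)"
    if c': "c' \<in> A" and E: "E \<in> sets borel_manifold" "E \<subseteq> cdom c'" for c' E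
  proof -
    have "emeasure (chart_measure D (c i)) (E \<inter> P i) = emeasure (chart_measure D c') (E \<inter> P i)" if "i < k" for i
      using E P(1,2)[OF that] P(3)[of i] by (intro chart_measures_agree[OF D c']) auto
    then have "emeasure \<mu> E = (\<Sum>i<k. emeasure (chart_measure D c') (E \<inter> P i))"
      unfolding em[OF E(1)] m_def by simp
    also have "\<dots> = emeasure (chart_measure D c') E"
      by (rule emeasure_partition[OF sets_chart_measure E(1) P(3-5), symmetric])
    also have "\<dots> = (\<integral>\<^sup>+x\<in>snd c' ` E. ennreal (D c' x) \<partial>lborel)"
      by (rule emeasure_chart_measure[of _ D, OF c' positive_densityD(1)[OF D c'] E])
    finally show ?thesis .
  qed
  then have "has_density \<mu> D" using sets space by (simp add: has_density_def sets_borel_manifold)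
  then show ?thesis ..
qed

lemma has_density_nn_integral:
  assumes \<mu>: "has_density \<mu> D" and D: "positive_density D" and c: "c \<in> A"
    and E: "E \<in> sets borel_manifold" "E \<subseteq> cdom c" and f: "f \<in> borel_measurable borel_manifold"
  shows "(\<integral>\<^sup>+m\<in>E. f m \<partial>\<mu>) = (\<integral>\<^sup>+x\<in>snd c ` E. ennreal (D c x) * f (cinv c x) \<partial>lborel)"
proof -
  have sets: "sets \<mu> = sets borel_manifold" by (rule has_density_sets[OF \<mu>])
  have sp: "space \<mu> = space (chart_measure D c)"
    using sets sets_chart_measure by (metis sets_eq_imp_space_eq)
  have "restrict_space \<mu> E = restrict_space (chart_measure D c) E"
  proof (rule measure_eqI)
    show "sets (restrict_space \<mu> E) = sets (restrict_space (chart_measure D c) E)"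
      by (intro sets_restrict_space_cong) (simp add: sets)
    fix B assume "B \<in> sets (restrict_space \<mu> E)"
    then have B: "B \<in> sets borel_manifold" "B \<subseteq> E"
      using E(1) sets sets.sets_into_space[of E \<mu>] by (auto simp: sets_restrict_space_iff)
    then show "emeasure (restrict_space \<mu> E) B = emeasure (restrict_space (chart_measure D c) E) B"
      using E sets has_density_emeasure[OF \<mu> c B(1)]
        emeasure_chart_measure[of _ D, OF c positive_densityD(1)[OF D c] B(1)]
      by (simp add: emeasure_restrict_space)
  qed
  then have "(\<integral>\<^sup>+m. f m \<partial>restrict_space \<mu> E) = (\<integral>\<^sup>+m. f m \<partial>restrict_space (chart_measure D c) E)" by simp
  then have "(\<integral>\<^sup>+m\<in>E. f m \<partial>\<mu>) = (\<integral>\<^sup>+m\<in>E. f m \<partial>chart_measure D c)"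
    using E(1) sets by (simp add: nn_integral_restrict_space)
  then show ?thesis
    using nn_integral_chart_measure[of _ D, OF c positive_densityD(1)[OF D c] f E] by simp
qed

lemma has_density_finite:
  assumes \<mu>: "has_density \<mu> D" and D: "positive_density D" shows "finite_measure \<mu>"
proof
  have "\<exists>U. openin X U \<and> m \<in> U \<and> emeasure \<mu> U < \<infinity>" if m: "m \<in> topspace X" for m
  proof -
    obtain c where c: "c \<in> A" "m \<in> cdom c" using m topspace_charts by auto
    obtain r where r: "r > 0" "cball (snd c m) r \<subseteq> cimg c"
      using open_contains_cball open_cimg[OF c(1)] chart_mem[OF c(2)] by blast
    have "compact (D c ` cball (snd c m) r)"
      by (intro compact_continuous_image continuous_on_subset[OF positive_densityD(1)[OF D c(1)] r(2)] compact_cball)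
    then obtain B where B: "\<And>x. x \<in> cball (snd c m) r \<Longrightarrow> D c x \<le> B"
      using compact_imp_bounded[of "D c ` cball (snd c m) r"] unfolding bounded_iff
      by (metis abs_le_D1 image_eqI real_norm_def)
    let ?U = "{m' \<in> cdom c. snd c m' \<in> ball (snd c m) r}"
    have U: "openin X ?U" by (rule open_chart_preimage[OF c(1)]) simp
    have img: "snd c ` ?U \<in> sets borel" by (rule chart_image_measurable[OF c(1) open_in_sets[OF U]]) auto
    have "emeasure \<mu> ?U = (\<integral>\<^sup>+x\<in>snd c ` ?U. ennreal (D c x) \<partial>lborel)"
      by (rule has_density_emeasure[OF \<mu> c(1) open_in_sets[OF U]]) auto
    also have "\<dots> \<le> (\<integral>\<^sup>+x. ennreal B * indicator (cball (snd c m) r) x \<partial>lborel)"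
      using B by (intro nn_integral_mono) (auto simp: indicator_def intro!: ennreal_leI)
    also have "\<dots> = ennreal B * emeasure lborel (cball (snd c m) r)"
      by (rule nn_integral_cmult_indicator) simp
    also have "\<dots> < \<infinity>"
      using emeasure_bounded_finite[OF bounded_cball, of "snd c m" r] by (simp add: ennreal_mult_less_top)
    finally show ?thesis using U c r by (intro exI[of _ ?U]) auto
  qed
  note local = this
  let ?\<U> = "{U. openin X U \<and> emeasure \<mu> U < \<infinity>}"
  have "topspace X \<subseteq> \<Union>?\<U>" using local by blast
  moreover have "\<forall>U\<in>?\<U>. openin X U" by simp
  ultimately have "\<exists>\<F>. finite \<F> \<and> \<F> \<subseteq> ?\<U> \<and> topspace X \<subseteq> \<Union>\<F>"
    using compact unfolding compact_space_def compactin_def by meson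
  then obtain \<F> where \<F>: "finite \<F>" "\<F> \<subseteq> ?\<U>" "topspace X \<subseteq> \<Union>\<F>" by blast
  have fs: "(\<lambda>U. U) ` \<F> \<subseteq> sets \<mu>" using \<F>(2) open_in_sets has_density_sets[OF \<mu>] by auto
  have "space \<mu> \<subseteq> \<Union>\<F>" using \<F>(3) has_density_space[OF \<mu>] by simp
  then have "emeasure \<mu> (space \<mu>) \<le> emeasure \<mu> (\<Union>\<F>)"
    using fs \<F>(1) by (intro emeasure_mono) auto
  also have "\<dots> \<le> (\<Sum>U\<in>\<F>. emeasure \<mu> U)"
    using emeasure_subadditive_finite[OF \<F>(1) fs] by simp
  also have "\<dots> < \<infinity>"
    using \<F>(1,2) by (induction \<F> rule: finite_induct) (auto simp: ennreal_add_eq_top less_top)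
  finally show "emeasure \<mu> (space \<mu>) \<noteq> \<infinity>" by simp
qed

text \<open>With this lemma the measures of all contact forms become densities over one reference measure.\<close>

lemma has_density_change:
  assumes \<mu>: "has_density \<mu> D0" and D0: "positive_density D0" and f: "f \<in> borel_measurable borel_manifold"
    and D: "\<And>c m. c \<in> A \<Longrightarrow> m \<in> cdom c \<Longrightarrow> D c (snd c m) = f m * D0 c (snd c m)"
    and pos: "\<And>m. m \<in> topspace X \<Longrightarrow> f m \<ge> 0"
  shows "has_density (density \<mu> (\<lambda>m. ennreal (f m))) D"
  unfolding has_density_def
proof (intro conjI ballI impI)
  have sets: "sets \<mu> = sets borel_manifold" by (rule has_density_sets[OF \<mu>])
  then show "sets (density \<mu> (\<lambda>m. ennreal (f m))) = sigma_sets (topspace X) {U. openin X U}"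
    by (simp add: sets_borel_manifold)
  show "space (density \<mu> (\<lambda>m. ennreal (f m))) = topspace X"
    using has_density_space[OF \<mu>] by simp
  fix c E assume c: "c \<in> A" and "E \<in> sets (density \<mu> (\<lambda>m. ennreal (f m)))" and Ec: "E \<subseteq> cdom c"
  then have E: "E \<in> sets borel_manifold" using sets by simp
  have fm: "(\<lambda>m. ennreal (f m)) \<in> borel_measurable borel_manifold" using f by measurable
  then have "(\<lambda>m. ennreal (f m)) \<in> borel_measurable \<mu>" using measurable_cong_sets[OF sets refl] by blast
  then have "emeasure (density \<mu> (\<lambda>m. ennreal (f m))) E = (\<integral>\<^sup>+m\<in>E. ennreal (f m) \<partial>\<mu>)"
    using E sets by (intro emeasure_density) auto
  also have "\<dots> = (\<integral>\<^sup>+x\<in>snd c ` E. ennreal (D0 c x) * ennreal (f (cinv c x)) \<partial>lborel)"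
    by (rule has_density_nn_integral[OF \<mu> D0 c E Ec fm])
  also have "\<dots> = (\<integral>\<^sup>+x\<in>snd c ` E. ennreal (D c x) \<partial>lborel)"
  proof (rule nn_integral_cong)
    fix x
    show "ennreal (D0 c x) * ennreal (f (cinv c x)) * indicator (snd c ` E) x =
        ennreal (D c x) * indicator (snd c ` E) x"
    proof (cases "x \<in> snd c ` E")
      case True
      then obtain m where m: "m \<in> E" "m \<in> cdom c" "x = snd c m" using Ec by auto
      then have "D0 c x > 0" "f m \<ge> 0"
        using positive_densityD(2)[OF D0 c] chart_mem[OF m(2)] pos cdom_subset[OF c] by auto
      then show ?thesis using D[OF c m(2)] m cinv_chart[OF c m(2)]
        by (simp add: ennreal_mult mult.commute)
    qed simp
  qed
  finally show "emeasure (density \<mu> (\<lambda>m. ennreal (f m))) E = (\<integral>\<^sup>+x\<in>snd c ` E. ennreal (D c x) \<partial>lborel)" .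
qed

lemma form_measure_eqI:
  assumes "has_density \<mu> (\<lambda>c x. \<omega> c x std_frame)" shows "form_measure X A \<omega> = \<mu>"
proof -
  have "form_measure X A \<omega> = (THE \<mu>. has_density \<mu> (\<lambda>c x. \<omega> c x std_frame))"
    unfolding form_measure_def has_density_def ..
  also have "\<dots> = \<mu>"
    by (rule the_equality[of "\<lambda>\<mu>. has_density \<mu> (\<lambda>c x. \<omega> c x std_frame)", OF assms])
      (rule has_density_unique[OF _ assms])
  finally show ?thesis .
qed

end

section \<open>Densities of contact forms and their variation\<close>

text \<open>Functions of a parameter \<open>t\<close> and a point, with a Taylor expansion of order one in \<open>t\<close> that is
  locally uniform in the point.  They form an algebra, so it suffices to expand the coefficients
  of a family of 1-forms in order to expand its volume form.\<close>

definition taylor_functions :: "'a::topological_space set \<Rightarrow> (real \<times> 'a \<Rightarrow> real) set" where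
  "taylor_functions U = {f. \<exists>g0 g1 r. continuous_on U g0 \<and> continuous_on U g1 \<and>
     continuous_on (UNIV \<times> U) r \<and> (\<forall>t. \<forall>x\<in>U. f (t, x) = g0 x + t * g1 x + t^2 * r (t, x))}"

lemma taylor_functionsI:
  assumes "continuous_on U g0" "continuous_on U g1" "continuous_on (UNIV \<times> U) r"
    "\<And>t x. x \<in> U \<Longrightarrow> f (t, x) = g0 x + t * g1 x + t^2 * r (t, x)"
  shows "f \<in> taylor_functions U"
  using assms unfolding taylor_functions_def by blast

lemma function_algebra_taylor: "function_algebra (taylor_functions U)"
  unfolding function_algebra_def
proof (intro conjI allI ballI)
  show "(\<lambda>z. c) \<in> taylor_functions U" for c
    by (rule taylor_functionsI[of _ "\<lambda>_. c" "\<lambda>_. 0" "\<lambda>_. 0"]) (auto intro: continuous_intros)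
next
  fix f g assume "f \<in> taylor_functions U" "g \<in> taylor_functions U"
  then obtain f0 f1 r g0 g1 s where f: "continuous_on U f0" "continuous_on U f1" "continuous_on (UNIV \<times> U) r"
      "\<And>t x. x \<in> U \<Longrightarrow> f (t, x) = f0 x + t * f1 x + t^2 * r (t, x)"
    and g: "continuous_on U g0" "continuous_on U g1" "continuous_on (UNIV \<times> U) s"
      "\<And>t x. x \<in> U \<Longrightarrow> g (t, x) = g0 x + t * g1 x + t^2 * s (t, x)"
    unfolding taylor_functions_def by blast
  have lift: "continuous_on (UNIV \<times> U) (\<lambda>z. h (snd z))" if "continuous_on U h" for h :: "'a \<Rightarrow> real"
    by (rule continuous_on_compose2[OF that continuous_on_snd[OF continuous_on_id]]) auto
  show "(\<lambda>z. f z + g z) \<in> taylor_functions U"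
    by (rule taylor_functionsI[of _ "\<lambda>x. f0 x + g0 x" "\<lambda>x. f1 x + g1 x" "\<lambda>z. r z + s z"])
      (use f g in \<open>auto intro!: continuous_intros simp: algebra_simps\<close>)
  show "(\<lambda>z. f z * g z) \<in> taylor_functions U"
  proof (rule taylor_functionsI[of _ "\<lambda>x. f0 x * g0 x" "\<lambda>x. f0 x * g1 x + f1 x * g0 x"
        "\<lambda>z. f0 (snd z) * s z + f1 (snd z) * g1 (snd z) + fst z * f1 (snd z) * s z +
          r z * g0 (snd z) + fst z * r z * g1 (snd z) + (fst z)^2 * r z * s z"])
    show "continuous_on (UNIV \<times> U) (\<lambda>z. f0 (snd z) * s z + f1 (snd z) * g1 (snd z) + fst z * f1 (snd z) * s z +
          r z * g0 (snd z) + fst z * r z * g1 (snd z) + (fst z)^2 * r z * s z)"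
      by (intro continuous_intros lift f g)
  qed (use f g in \<open>auto intro!: continuous_intros simp: algebra_simps power2_eq_square\<close>)
qed

text \<open>Quadratic bounds can be integrated, so differentiability of integrals in a parameter needs no
  dominated convergence.\<close>

lemma has_derivative_of_quadratic_bound:
  fixes f :: "real \<Rightarrow> real"
  assumes "\<epsilon> > 0" "\<And>t. \<bar>t\<bar> < \<epsilon> \<Longrightarrow> \<bar>f t - f 0 - t * a\<bar> \<le> K * t^2"
  shows "(f has_real_derivative a) (at 0)"
proof -
  have "((\<lambda>t. (f t - f 0) / t - a) \<longlongrightarrow> 0) (at 0)"
  proof (rule Lim_null_comparison)
    have "norm ((f t - f 0) / t - a) \<le> K * \<bar>t\<bar>" if "t \<noteq> 0" "\<bar>t\<bar> < \<epsilon>" for t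
    proof -
      have "(f t - f 0) / t - a = (f t - f 0 - t * a) / t" using that by (simp add: field_simps)
      then have "norm ((f t - f 0) / t - a) = \<bar>f t - f 0 - t * a\<bar> / \<bar>t\<bar>" by simp
      also have "\<dots> \<le> K * t^2 / \<bar>t\<bar>" by (rule divide_right_mono[OF assms(2)[OF that(2)]]) simp
      also have "\<dots> = K * \<bar>t\<bar>" using that(1) by (simp add: power2_eq_square abs_if)
      finally show ?thesis .
    qed
    then show "\<forall>\<^sub>F t in at 0. norm ((f t - f 0) / t - a) \<le> K * \<bar>t\<bar>"
      unfolding eventually_at using assms(1) by (intro exI[of _ \<epsilon>]) auto
    show "((\<lambda>t. K * \<bar>t\<bar>) \<longlongrightarrow> 0) (at 0)"
      by (auto intro!: tendsto_eq_intros)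
  qed
  then have "((\<lambda>t. (f t - f 0) / t) \<longlongrightarrow> a) (at 0)" by (rule LIM_zero_cancel)
  then show ?thesis by (simp add: has_field_derivative_iff)
qed

locale closed_contact_manifold = closed_oriented_manifold X A
  for X :: "'m topology" and A :: "('m, 'd::{finite,wellorder}) chart set" +
  fixes n :: nat and lam0 :: "('m, 'd) oneform"
  assumes dim: "CARD('d) = 2 * n + 1" and lam0: "lam0 \<in> pos_contact_forms A n"
begin

abbreviation vol :: "('m, 'd) oneform \<Rightarrow> ('m, 'd) chart \<Rightarrow> (real, 'd) vec \<Rightarrow> real" where
  "vol lam c x \<equiv> contact_volume_form n lam c x std_frame"

abbreviation contact_forms :: "('m, 'd) oneform set" where
  "contact_forms \<equiv> pos_contact_forms A n"

lemma lam0_Omega1: "lam0 \<in> Omega1 A"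
  using lam0 by (simp add: pos_contact_forms_def)

lemma pos_Omega1: "lam \<in> contact_forms \<Longrightarrow> lam \<in> Omega1 A"
  by (simp add: pos_contact_forms_def)

lemma vol_pos: "lam \<in> contact_forms \<Longrightarrow> c \<in> A \<Longrightarrow> x \<in> cimg c \<Longrightarrow> vol lam c x > 0"
  by (simp add: pos_contact_forms_def)

lemma Omega1_covector:
  "\<alpha> \<in> Omega1 A \<Longrightarrow> c \<in> A \<Longrightarrow> covector_field (cimg c) (\<alpha> c)"
  by (simp add: Omega1_def covector_field_def)

lemma Omega1_off: "\<alpha> \<in> Omega1 A \<Longrightarrow> \<not> (c \<in> A \<and> x \<in> cimg c) \<Longrightarrow> \<alpha> c x v = 0"
  unfolding Omega1_def by blast

lemma Omega1_transition:
  "\<alpha> \<in> Omega1 A \<Longrightarrow> c \<in> A \<Longrightarrow> c' \<in> A \<Longrightarrow> x \<in> overlap c c' \<Longrightarrow>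
    \<alpha> c x v = \<alpha> c' (transition c c' x) (jac c c' x v)"
  unfolding Omega1_def by blast

lemma vol_transition:
  assumes \<alpha>: "\<alpha> \<in> Omega1 A" and c: "c \<in> A" "c' \<in> A" and x: "x \<in> overlap c c'"
  shows "vol \<alpha> c x = det (matrix (jac c c' x)) * vol \<alpha> c' (transition c c' x)"
proof -
  let ?\<tau> = "transition c c'" let ?D = "frechet_derivative ?\<tau> (at x)"
  have img: "?\<tau> ` overlap c c' \<subseteq> cimg c'" using overlap_mem(2)[OF c] by blast
  have "ext_deriv (\<alpha> c) x = (\<lambda>v. ext_deriv (\<alpha> c') (?\<tau> x) (\<lambda>i. ?D (v i)))"
    using ext_deriv_pullback[OF open_overlap[OF c] x open_cimg[OF c(2)] smooth_transition[OF c] img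
        Omega1_covector[OF \<alpha> c(2)], of "\<alpha> c"] Omega1_transition[OF \<alpha> c] by blast
  moreover have "one_altform (\<alpha> c x) = (\<lambda>v. one_altform (\<alpha> c' (?\<tau> x)) (\<lambda>i. ?D (v i)))"
    using Omega1_transition[OF \<alpha> c x] by (simp add: one_altform_def fun_eq_iff)
  ultimately have "vol \<alpha> c x = contact_volume_form n \<alpha> c' (?\<tau> x) (\<lambda>i. ?D (std_frame i))"
    unfolding contact_volume_form_def by (simp only: wedge_power_compose wedge_compose)
  also have "\<dots> = det (matrix ?D) * vol \<alpha> c' (?\<tau> x)"
  proof (rule alternating_form_linear_image)
    show "multilinear_form CARD('d) (contact_volume_form n \<alpha> c' (?\<tau> x))"
      using multilinear_contact_volume_form[of "cimg c'" "?\<tau> x" \<alpha> c' n]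
        open_cimg[OF c(2)] overlap_mem(2)[OF c x] Omega1_covector[OF \<alpha> c(2)] dim by (simp add: add.commute)
    show "alternating_form CARD('d) (contact_volume_form n \<alpha> c' (?\<tau> x))"
      using alternating_contact_volume_form[of n \<alpha> c' "?\<tau> x"] dim by (simp add: add.commute)
    show "linear ?D" by (rule has_derivative_linear[OF transition_has_derivative[OF c x]])
  qed
  finally show ?thesis .
qed

lemma smooth_vol:
  assumes "\<alpha> \<in> Omega1 A" "c \<in> A" shows "smooth_on (cimg c) (vol \<alpha> c)"
proof -
  let ?Q = "{f :: (real, 'd) vec \<Rightarrow> real. smooth_on (cimg c) f}"
  have Q: "function_algebra ?Q"
    unfolding function_algebra_def
    using open_cimg[OF assms(2)] by (simp add: smooth_on_const smooth_on_add smooth_on_mult)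
  have s: "smooth_on (cimg c) (\<lambda>x. \<alpha> c x v)" for v
    using Omega1_covector[OF assms] by (simp add: covector_field_def)
  have "(\<lambda>x. vol \<alpha> c x) \<in> ?Q"
    by (rule function_algebra_contact_volume_form[OF Q, of "\<lambda>_. \<alpha>" c "\<lambda>x. x" n])
      (simp_all add: s smooth_on_frechet_derivative)
  then show ?thesis by simp
qed

lemma positive_density_vol:
  assumes "lam \<in> contact_forms" shows "positive_density (vol lam)"
  unfolding positive_density_def
  using smooth_on_imp_continuous_on[OF smooth_vol[OF pos_Omega1[OF assms]]]
    vol_pos[OF assms] vol_transition[OF pos_Omega1[OF assms]] by blast

text \<open>The density of the measure of \<open>lam\<close> relative to that of \<open>lam0\<close>.  The choice of the chart does not
  matter, since both coefficients change by the same determinant (\<open>dens_chart\<close>).\<close>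

definition dens :: "('m, 'd) oneform \<Rightarrow> 'm \<Rightarrow> real" where
  "dens lam m = (let c = SOME c. c \<in> A \<and> m \<in> cdom c in vol lam c (snd c m) / vol lam0 c (snd c m))"

abbreviation dens_line :: "('m, 'd) oneform \<Rightarrow> ('m, 'd) oneform \<Rightarrow> real \<Rightarrow> 'm \<Rightarrow> real" where
  "dens_line lam \<alpha> t \<equiv> dens (form_add_scaled lam t \<alpha>)"

abbreviation dens_error :: "('m, 'd) oneform \<Rightarrow> ('m, 'd) oneform \<Rightarrow> real \<Rightarrow> real \<Rightarrow> 'm \<Rightarrow> real" where
  "dens_error lam \<alpha> a t m \<equiv> \<bar>dens_line lam \<alpha> t m - dens lam m - t * a\<bar>"

lemma dens_chart:
  assumes \<alpha>: "\<alpha> \<in> Omega1 A" and c: "c \<in> A" "m \<in> cdom c"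
  shows "dens \<alpha> m = vol \<alpha> c (snd c m) / vol lam0 c (snd c m)"
proof -
  define c' where "c' = (SOME c. c \<in> A \<and> m \<in> cdom c)"
  have c': "c' \<in> A" "m \<in> cdom c'"
    using someI[of "\<lambda>c. c \<in> A \<and> m \<in> cdom c" c] c by (auto simp: c'_def)
  note x = overlap_chart[OF c'(2) c(2)]
  have "det (matrix (frechet_derivative (transition c' c) (at (snd c' m)))) \<noteq> 0"
    using oriented[OF c'(1) c(1) x] by simp
  then show ?thesis
    unfolding dens_def Let_def c'_def[symmetric]
    using vol_transition[OF \<alpha> c'(1) c(1) x] vol_transition[OF lam0_Omega1 c'(1) c(1) x]
      transition_chart[OF c'] by simp
qed

lemma dens_cinv:
  assumes "\<alpha> \<in> Omega1 A" "c \<in> A" "x \<in> cimg c"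
  shows "dens \<alpha> (cinv c x) = vol \<alpha> c x / vol lam0 c x"
  using dens_chart[OF assms(1,2) cinv_mem[OF assms(3)]] chart_cinv[OF assms(3)] by simp

lemma continuous_dens:
  assumes "\<alpha> \<in> Omega1 A" shows "continuous_map X euclidean (dens \<alpha>)"
proof (rule continuous_map_charts)
  fix c assume c: "c \<in> A"
  have "continuous_on (cimg c) (\<lambda>x. vol \<alpha> c x / vol lam0 c x)"
    using vol_pos[OF lam0 c]
    by (intro continuous_on_divide smooth_on_imp_continuous_on[OF smooth_vol] assms c lam0_Omega1) force
  then show "continuous_on (cimg c) (\<lambda>x. dens \<alpha> (cinv c x))"
    by (subst continuous_on_cong[OF refl dens_cinv[OF assms c]])
qed

lemma topspace_chart: assumes "m \<in> topspace X" obtains c where "c \<in> A" "m \<in> cdom c"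
  using assms topspace_charts by auto

lemma dens_pos:
  assumes "lam \<in> contact_forms" "m \<in> topspace X" shows "dens lam m > 0"
proof -
  obtain c where c: "c \<in> A" "m \<in> cdom c" by (rule topspace_chart[OF assms(2)])
  show ?thesis
    using dens_chart[OF pos_Omega1[OF assms(1)] c] vol_pos[OF assms(1) c(1) chart_mem[OF c(2)]]
      vol_pos[OF lam0 c(1) chart_mem[OF c(2)]] by simp
qed

lemma pos_contact_formsI:
  assumes "\<alpha> \<in> Omega1 A" "\<And>m. m \<in> topspace X \<Longrightarrow> dens \<alpha> m > 0" shows "\<alpha> \<in> contact_forms"
  unfolding pos_contact_forms_def
proof (intro CollectI conjI ballI assms(1))
  fix c x assume c: "c \<in> A" "x \<in> cimg c"
  then have "cinv c x \<in> topspace X" using cinv_mem cdom_subset by blast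
  then have "vol \<alpha> c x / vol lam0 c x > 0" using dens_cinv[OF assms(1) c] assms(2) by metis
  then show "vol \<alpha> c x > 0" using vol_pos[OF lam0 c] by (simp add: zero_less_divide_iff)
qed

lemma dens_lam0: "m \<in> topspace X \<Longrightarrow> dens lam0 m = 1"
  using dens_chart[OF lam0_Omega1] vol_pos[OF lam0] chart_mem topspace_chart
  by (metis divide_self less_irrefl)

lemma Omega1_form_add_scaled:
  assumes \<alpha>: "lam \<in> Omega1 A" "\<alpha> \<in> Omega1 A" shows "form_add_scaled lam t \<alpha> \<in> Omega1 A"
  unfolding Omega1_def
proof (intro CollectI conjI allI ballI impI)
  fix c assume c: "c \<in> A"
  note f = Omega1_covector[OF \<alpha>(1) c, unfolded covector_field_def]
    Omega1_covector[OF \<alpha>(2) c, unfolded covector_field_def]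
  show "linear (form_add_scaled lam t \<alpha> c x)" if "x \<in> cimg c" for x
  proof -
    have "linear (lam c x)" "linear (\<alpha> c x)" using f that by blast+
    then show ?thesis by (simp add: form_add_scaled_def linear_iff algebra_simps)
  qed
  show "smooth_on (cimg c) (\<lambda>x. form_add_scaled lam t \<alpha> c x v)" for v
    using f open_cimg[OF c] unfolding form_add_scaled_def
    by (intro smooth_on_add smooth_on_mult smooth_on_const) auto
next
  show "form_add_scaled lam t \<alpha> c x v = 0" if "\<not> (c \<in> A \<and> x \<in> cimg c)" for c x v
    by (simp add: form_add_scaled_def Omega1_off[OF \<alpha>(1) that] Omega1_off[OF \<alpha>(2) that])
  show "form_add_scaled lam t \<alpha> c x v = form_add_scaled lam t \<alpha> c' (transition c c' x)
      (jac c c' x v)" if "c \<in> A" "c' \<in> A" "x \<in> overlap c c'" for c c' x v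
    unfolding form_add_scaled_def
    using Omega1_transition[OF \<alpha>(1) that] Omega1_transition[OF \<alpha>(2) that] by simp
qed

lemma Omega1_fun_mult_form:
  assumes h: "smooth_fun A h" and \<alpha>: "\<alpha> \<in> Omega1 A" shows "fun_mult_form h \<alpha> \<in> Omega1 A"
  unfolding Omega1_def
proof (intro CollectI conjI allI ballI impI)
  fix c assume c: "c \<in> A"
  note f = Omega1_covector[OF \<alpha> c, unfolded covector_field_def]
  show "linear (fun_mult_form h \<alpha> c x)" if "x \<in> cimg c" for x
  proof -
    have "linear (\<alpha> c x)" using f that by blast
    then show ?thesis by (simp add: fun_mult_form_def linear_iff algebra_simps)
  qed
  have "smooth_on (cimg c) (\<lambda>x. h (cinv c x))" using h c by (simp add: smooth_fun_def o_def)
  then show "smooth_on (cimg c) (\<lambda>x. fun_mult_form h \<alpha> c x v)" for v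
    using f open_cimg[OF c] unfolding fun_mult_form_def by (intro smooth_on_mult) auto
next
  show "fun_mult_form h \<alpha> c x v = 0" if "\<not> (c \<in> A \<and> x \<in> cimg c)" for c x v
    by (simp add: fun_mult_form_def Omega1_off[OF \<alpha> that])
  show "fun_mult_form h \<alpha> c x v = fun_mult_form h \<alpha> c' (transition c c' x)
      (jac c c' x v)" if "c \<in> A" "c' \<in> A" "x \<in> overlap c c'" for c c' x v
    unfolding fun_mult_form_def
    using Omega1_transition[OF \<alpha> that] overlap_mem(3)[OF that] by simp
qed

lemma dens_fun_mult_form:
  assumes h: "smooth_fun A h" and \<alpha>: "\<alpha> \<in> Omega1 A" and m: "m \<in> topspace X"
  shows "dens (fun_mult_form h \<alpha>) m = h m ^ Suc n * dens \<alpha> m"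
proof -
  obtain c where c: "c \<in> A" "m \<in> cdom c" by (rule topspace_chart[OF m])
  have "vol (fun_mult_form h \<alpha>) c (snd c m) = h (cinv c (snd c m)) ^ Suc n * vol \<alpha> c (snd c m)"
    using h c(1) by (intro contact_volume_form_fun_mult[where lam=\<alpha> and c=c, OF dim open_cimg[OF c(1)] chart_mem[OF c(2)]
          Omega1_covector[OF \<alpha> c(1)]]) (simp add: smooth_fun_def)
  then show ?thesis
    unfolding dens_chart[OF \<alpha> c] dens_chart[OF Omega1_fun_mult_form[OF h \<alpha>] c] cinv_chart[OF c]
    by simp
qed

definition ddens :: "('m, 'd) oneform \<Rightarrow> ('m, 'd) oneform \<Rightarrow> 'm \<Rightarrow> real" where
  "ddens lam \<alpha> m = deriv (\<lambda>t. dens_line lam \<alpha> t m) 0"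

lemma form_add_scaled_0 [simp]: "form_add_scaled lam 0 \<alpha> = lam"
  by (simp add: form_add_scaled_def)

lemma vol_taylor:
  assumes \<alpha>: "lam \<in> Omega1 A" "\<alpha> \<in> Omega1 A" and c: "c \<in> A"
  shows "(\<lambda>z. vol (form_add_scaled lam (fst z) \<alpha>) c (snd z)) \<in> taylor_functions (cimg c)"
proof (rule function_algebra_contact_volume_form[OF function_algebra_taylor])
  have s: "smooth_on (cimg c) (\<lambda>x. lam c x v)" "smooth_on (cimg c) (\<lambda>x. \<alpha> c x v)" for v
    using Omega1_covector[OF \<alpha>(1) c] Omega1_covector[OF \<alpha>(2) c] by (simp_all add: covector_field_def)
  show "(\<lambda>z. form_add_scaled lam (fst z) \<alpha> c (snd z) v) \<in> taylor_functions (cimg c)" for v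
    by (rule taylor_functionsI[OF s(1)[THEN smooth_on_imp_continuous_on]
          s(2)[THEN smooth_on_imp_continuous_on] continuous_on_const[of _ 0]])
      (simp add: form_add_scaled_def)
  show "(\<lambda>z. frechet_derivative (\<lambda>y. form_add_scaled lam (fst z) \<alpha> c y v) (at (snd z)) w)
      \<in> taylor_functions (cimg c)" for v w
  proof (rule taylor_functionsI[OF s(1)[THEN smooth_on_frechet_derivative, THEN smooth_on_imp_continuous_on]
          s(2)[THEN smooth_on_frechet_derivative, THEN smooth_on_imp_continuous_on] continuous_on_const[of _ 0]])
    fix t x assume x: "x \<in> cimg c"
    have "((\<lambda>y. lam c y v + t * \<alpha> c y v) has_derivative
        (\<lambda>w. frechet_derivative (\<lambda>y. lam c y v) (at x) w + t * frechet_derivative (\<lambda>y. \<alpha> c y v) (at x) w)) (at x)"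
      by (intro has_derivative_add has_derivative_mult_right smooth_on_imp_has_derivative[OF _ x] s)
    from frechet_derivative_eqI[OF this]
    show "frechet_derivative (\<lambda>y. form_add_scaled lam (fst (t, x)) \<alpha> c y v) (at (snd (t, x))) w =
        frechet_derivative (\<lambda>y. lam c y v) (at x) w + t * frechet_derivative (\<lambda>y. \<alpha> c y v) (at x) w + t^2 * 0"
      by (simp add: form_add_scaled_def)
  qed
qed

lemma dens_taylor_chart:
  assumes \<alpha>: "lam \<in> Omega1 A" "\<alpha> \<in> Omega1 A" and c: "c \<in> A"
  obtains g r where "continuous_on (cimg c) g" "continuous_on (UNIV \<times> cimg c) r"
    "\<And>t x. x \<in> cimg c \<Longrightarrow> dens_line lam \<alpha> t (cinv c x) = dens lam (cinv c x) + t * g x + t^2 * r (t, x)"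
proof -
  obtain g0 g1 r where r: "continuous_on (cimg c) g1" "continuous_on (UNIV \<times> cimg c) r"
    "\<And>t x. x \<in> cimg c \<Longrightarrow> vol (form_add_scaled lam t \<alpha>) c x = g0 x + t * g1 x + t^2 * r (t, x)"
    using vol_taylor[OF assms] unfolding taylor_functions_def by auto
  have v0: "continuous_on (cimg c) (vol lam0 c)" "\<And>x. x \<in> cimg c \<Longrightarrow> vol lam0 c x \<noteq> 0"
    using smooth_on_imp_continuous_on[OF smooth_vol[OF lam0_Omega1 c]] vol_pos[OF lam0 c] by force+
  show ?thesis
  proof
    show "continuous_on (cimg c) (\<lambda>x. g1 x / vol lam0 c x)"
      using v0 by (intro continuous_on_divide r(1)) auto
    have "continuous_on (UNIV \<times> cimg c) (\<lambda>z. vol lam0 c (snd z))"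
      by (rule continuous_on_compose2[OF v0(1) continuous_on_snd[OF continuous_on_id]]) auto
    then show "continuous_on (UNIV \<times> cimg c) (\<lambda>z. r z / vol lam0 c (snd z))"
      using v0(2) by (intro continuous_on_divide r(2)) auto
    fix t x assume x: "x \<in> cimg c"
    have "vol lam c x = g0 x" using r(3)[OF x, of 0] by simp
    then show "dens_line lam \<alpha> t (cinv c x) =
        dens lam (cinv c x) + t * (g1 x / vol lam0 c x) + t^2 * (r (t, x) / vol lam0 c (snd (t, x)))"
      unfolding dens_cinv[OF Omega1_form_add_scaled[OF \<alpha>] c x] dens_cinv[OF \<alpha>(1) c x]
      using r(3)[OF x, of t] by (simp add: add_divide_distrib)
  qed
qed

text \<open>Each chart provides a quadratic remainder with a continuous coefficient.  It shows that the linear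
  coefficient is \<open>ddens\<close>, hence the same in all charts, and compactness makes the bound uniform.\<close>

lemma dens_taylor:
  assumes \<alpha>: "lam \<in> Omega1 A" "\<alpha> \<in> Omega1 A"
  shows "continuous_map X euclidean (ddens lam \<alpha>)"
    and "\<exists>K. \<forall>m\<in>topspace X. \<forall>t. \<bar>t\<bar> < 1 \<longrightarrow>
      dens_error lam \<alpha> (ddens lam \<alpha> m) t m \<le> K * t^2"
proof -
  have bound: "\<exists>d>0. \<exists>K. \<forall>y\<in>ball x d \<inter> cimg c. \<forall>t. \<bar>t\<bar> < 1 \<longrightarrow>
      dens_error lam \<alpha> (g y) t (cinv c y) \<le> K * t^2"
    if c: "c \<in> A" and x: "x \<in> cimg c" and r: "continuous_on (UNIV \<times> cimg c) r"
      "\<And>t x. x \<in> cimg c \<Longrightarrow> dens_line lam \<alpha> t (cinv c x) = dens lam (cinv c x) + t * g x + t^2 * r (t, x)"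
    for c x g r
  proof -
    obtain d where d: "d > 0" "cball x d \<subseteq> cimg c" using open_cimg[OF c] x open_contains_cball by blast
    have "compact (r ` ({-1..1} \<times> cball x d))"
      using d(2) by (intro compact_continuous_image continuous_on_subset[OF r(1)] compact_Times) auto
    then obtain K where "\<forall>z\<in>r ` ({-1..1} \<times> cball x d). norm z \<le> K"
      using compact_imp_bounded[of "r ` ({-1..1} \<times> cball x d)"] unfolding bounded_iff by blast
    then have K: "\<bar>r (t, y)\<bar> \<le> K" if "t \<in> {-1..1}" "y \<in> cball x d" for t y
      using that by (auto simp del: mem_cball)
    have "dens_error lam \<alpha> (g y) t (cinv c y) \<le> K * t^2"
      if "y \<in> ball x d \<inter> cimg c" "\<bar>t\<bar> < 1" for t y
    proof -
      have "dens_line lam \<alpha> t (cinv c y) - dens lam (cinv c y) - t * g y = t^2 * r (t, y)"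
        using r(2)[of y t] that by simp
      then have "dens_error lam \<alpha> (g y) t (cinv c y) = \<bar>r (t, y)\<bar> * t^2"
        by (simp add: abs_mult)
      also have "\<dots> \<le> K * t^2" using that K[of t y] by (intro mult_right_mono) (auto simp: abs_less_iff)
      finally show ?thesis .
    qed
    then show ?thesis using d(1) by blast
  qed
  have ddens: "ddens lam \<alpha> (cinv c x) = g x"
    if c: "c \<in> A" and x: "x \<in> cimg c" and r: "continuous_on (UNIV \<times> cimg c) r"
      "\<And>t x. x \<in> cimg c \<Longrightarrow> dens_line lam \<alpha> t (cinv c x) = dens lam (cinv c x) + t * g x + t^2 * r (t, x)"
    for c x g r
  proof -
    obtain d K where "d > 0" and K: "\<forall>y\<in>ball x d \<inter> cimg c. \<forall>t. \<bar>t\<bar> < 1 \<longrightarrow>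
      dens_error lam \<alpha> (g y) t (cinv c y) \<le> K * t^2"
      using bound[OF c x r] by blast
    have "((\<lambda>t. dens_line lam \<alpha> t (cinv c x)) has_real_derivative g x) (at 0)"
      by (rule has_derivative_of_quadratic_bound[of 1 _ _ K]) (use K x \<open>d > 0\<close> in auto)
    then show ?thesis unfolding ddens_def by (rule DERIV_imp_deriv)
  qed
  show "continuous_map X euclidean (ddens lam \<alpha>)"
  proof (rule continuous_map_charts)
    fix c assume c: "c \<in> A"
    obtain g r where g: "continuous_on (cimg c) g" "continuous_on (UNIV \<times> cimg c) r"
      "\<And>t x. x \<in> cimg c \<Longrightarrow> dens_line lam \<alpha> t (cinv c x) = dens lam (cinv c x) + t * g x + t^2 * r (t, x)"
      by (rule dens_taylor_chart[OF \<alpha> c]) metis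
    show "continuous_on (cimg c) (\<lambda>x. ddens lam \<alpha> (cinv c x))"
      by (subst continuous_on_cong[OF refl ddens[OF c _ g(2,3)]]) (simp_all add: g(1))
  qed
  show "\<exists>K. \<forall>m\<in>topspace X. \<forall>t. \<bar>t\<bar> < 1 \<longrightarrow>
      dens_error lam \<alpha> (ddens lam \<alpha> m) t m \<le> K * t^2"
  proof (rule compact_local_to_global)
    fix m assume "m \<in> topspace X"
    then obtain c where c: "c \<in> A" "m \<in> cdom c" by (rule topspace_chart)
    obtain g r where g: "continuous_on (cimg c) g" "continuous_on (UNIV \<times> cimg c) r"
      "\<And>t x. x \<in> cimg c \<Longrightarrow> dens_line lam \<alpha> t (cinv c x) = dens lam (cinv c x) + t * g x + t^2 * r (t, x)"
      by (rule dens_taylor_chart[OF \<alpha> c(1)]) metis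
    obtain d K where d: "d > 0" and K: "\<forall>y\<in>ball (snd c m) d \<inter> cimg c. \<forall>t. \<bar>t\<bar> < 1 \<longrightarrow>
      dens_error lam \<alpha> (g y) t (cinv c y) \<le> K * t^2"
      using bound[OF c(1) chart_mem[OF c(2)] g(2,3)] by blast
    let ?U = "{m' \<in> cdom c. snd c m' \<in> ball (snd c m) d}"
    have "dens_error lam \<alpha> (ddens lam \<alpha> m') t m' \<le> K * t^2"
      if "m' \<in> ?U" "\<bar>t\<bar> < 1" for m' t
    proof -
      have m': "m' \<in> cdom c" "snd c m' \<in> ball (snd c m) d \<inter> cimg c" using that(1) chart_mem[of m' c] by auto
      show ?thesis
        using K[rule_format, OF m'(2) that(2)] ddens[OF c(1) _ g(2,3), of "snd c m'"] m'(2)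
          cinv_chart[OF c(1) m'(1)] by simp
    qed
    moreover have "openin X ?U" by (rule open_chart_preimage[OF c(1)]) simp
    moreover have "m \<in> ?U" using c(2) d by simp
    ultimately show "\<exists>U K. openin X U \<and> m \<in> U \<and> (\<forall>m'\<in>U. \<forall>t. \<bar>t\<bar> < 1 \<longrightarrow>
      dens_error lam \<alpha> (ddens lam \<alpha> m') t m' \<le> K * t^2)" by blast
  next
    fix K K' :: real and m
    assume "\<forall>t. \<bar>t\<bar> < 1 \<longrightarrow>
      dens_error lam \<alpha> (ddens lam \<alpha> m) t m \<le> K * t^2" "K \<le> K'"
    then show "\<forall>t. \<bar>t\<bar> < 1 \<longrightarrow>
      dens_error lam \<alpha> (ddens lam \<alpha> m) t m \<le> K' * t^2"
      by (meson mult_right_mono order_trans zero_le_power2)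
  qed
qed

end

section \<open>Observables and entropy as integrals\<close>

lemma integral_has_derivative_quadratic:
  fixes f :: "real \<Rightarrow> 'a \<Rightarrow> real"
  assumes \<mu>: "finite_measure \<mu>" and \<epsilon>: "\<epsilon> > 0" and f: "\<And>t. \<bar>t\<bar> < \<epsilon> \<Longrightarrow> integrable \<mu> (f t)"
    and g: "integrable \<mu> g"
    and bound: "\<And>t m. \<bar>t\<bar> < \<epsilon> \<Longrightarrow> m \<in> space \<mu> \<Longrightarrow> \<bar>f t m - f 0 m - t * g m\<bar> \<le> K * t^2"
    and \<Phi>: "\<And>t. \<bar>t\<bar> < \<epsilon> \<Longrightarrow> \<Phi> t = integral\<^sup>L \<mu> (f t)"
  shows "(\<Phi> has_real_derivative integral\<^sup>L \<mu> g) (at 0)"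
proof (rule has_derivative_of_quadratic_bound[OF \<epsilon>])
  fix t :: real assume t: "\<bar>t\<bar> < \<epsilon>"
  interpret finite_measure \<mu> by fact
  have "\<Phi> t - \<Phi> 0 - t * integral\<^sup>L \<mu> g = (\<integral>m. f t m - f 0 m - t * g m \<partial>\<mu>)"
    using f[OF t] f[of 0] g \<epsilon> by (simp add: \<Phi>[OF t] \<Phi>)
  also have "\<bar>\<dots>\<bar> \<le> (\<integral>m. \<bar>f t m - f 0 m - t * g m\<bar> \<partial>\<mu>)"
    by (rule integral_abs_bound)
  also have "\<dots> \<le> (\<integral>m. K * t^2 \<partial>\<mu>)"
    using f[OF t] f[of 0] g \<epsilon> bound[OF t] by (intro integral_mono) auto
  finally show "\<bar>\<Phi> t - \<Phi> 0 - t * integral\<^sup>L \<mu> g\<bar> \<le> (K * measure \<mu> (space \<mu>)) * t^2"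
    by (simp add: mult_ac)
qed

text \<open>The two inequalities are \<open>ln z \<le> z - 1\<close> at \<open>z = a / y\<close> and at \<open>z = y / a\<close>.\<close>

lemma entropy_function_expansion:
  fixes a y :: real
  assumes "a > 0" "y > 0"
  shows "\<bar>y * ln y - a * ln a - (ln a + 1) * (y - a)\<bar> \<le> (y - a)^2 / a"
proof -
  have eq: "y * ln y - a * ln a - (ln a + 1) * (y - a) = y * (ln y - ln a) - (y - a)"
    by (simp add: algebra_simps)
  have "ln (a / y) \<le> a / y - 1" "ln (y / a) \<le> y / a - 1"
    using assms by (auto intro!: ln_le_minus_one)
  then have l: "ln a - ln y \<le> a / y - 1" "ln y - ln a \<le> y / a - 1"
    using assms by (simp_all add: ln_div)
  have "y * (ln a - ln y) \<le> y * (a / y - 1)" by (rule mult_left_mono[OF l(1)]) (use assms in simp)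
  then have "y * (ln y - ln a) - (y - a) \<ge> 0" using assms by (simp add: algebra_simps)
  moreover have "y * (ln y - ln a) \<le> y * (y / a - 1)" by (rule mult_left_mono[OF l(2)]) (use assms in simp)
  then have "y * (ln y - ln a) - (y - a) \<le> (y - a)^2 / a"
    using assms by (simp add: field_simps power2_eq_square)
  ultimately show ?thesis unfolding eq by simp
qed

context closed_contact_manifold begin

definition \<mu>0 :: "'m measure" where "\<mu>0 = contact_measure X A n lam0"

lemma has_density_\<mu>0: "has_density \<mu>0 (vol lam0)"
proof -
  obtain \<mu> where \<mu>: "has_density \<mu> (vol lam0)"
    using has_density_exists[OF positive_density_vol[OF lam0]] by blast
  then show ?thesis unfolding \<mu>0_def contact_measure_def using form_measure_eqI[where \<omega>="contact_volume_form n lam0", OF \<mu>] by simp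
qed

lemma sets_\<mu>0: "sets \<mu>0 = sets borel_manifold" by (rule has_density_sets[OF has_density_\<mu>0])
lemma space_\<mu>0: "space \<mu>0 = topspace X" by (rule has_density_space[OF has_density_\<mu>0])

lemma finite_\<mu>0: "finite_measure \<mu>0"
  by (rule has_density_finite[OF has_density_\<mu>0 positive_density_vol[OF lam0]])

lemma measurable_\<mu>0: "borel_measurable \<mu>0 = borel_measurable borel_manifold"
  by (rule measurable_cong_sets[OF sets_\<mu>0 refl])

lemma contact_measure_density:
  assumes "lam \<in> contact_forms"
  shows "contact_measure X A n lam = density \<mu>0 (\<lambda>m. ennreal (dens lam m))"
    and "has_density (contact_measure X A n lam) (vol lam)"
proof -
  have "vol lam c (snd c m) = dens lam m * vol lam0 c (snd c m)" if "c \<in> A" "m \<in> cdom c" for c m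
    using dens_chart[OF pos_Omega1[OF assms] that] vol_pos[OF lam0 that(1) chart_mem[OF that(2)]] by simp
  then have d: "has_density (density \<mu>0 (\<lambda>m. ennreal (dens lam m))) (vol lam)"
    using dens_pos[OF assms] continuous_map_measurable[OF continuous_dens[OF pos_Omega1[OF assms]]]
    by (intro has_density_change[OF has_density_\<mu>0 positive_density_vol[OF lam0]]) (auto intro: less_imp_le)
  then show eq: "contact_measure X A n lam = density \<mu>0 (\<lambda>m. ennreal (dens lam m))"
    unfolding contact_measure_def by (rule form_measure_eqI)
  show "has_density (contact_measure X A n lam) (vol lam)" unfolding eq by (rule d)
qed

abbreviation continuous_fun :: "('m \<Rightarrow> real) \<Rightarrow> bool" where
  "continuous_fun f \<equiv> continuous_map X euclidean f"

lemma continuous_fun_arith: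
  assumes "continuous_fun f" "continuous_fun g"
  shows "continuous_fun (\<lambda>m. f m + g m)" "continuous_fun (\<lambda>m. f m - g m)" "continuous_fun (\<lambda>m. f m * g m)"
  using assms by (auto intro: continuous_map_add continuous_map_diff continuous_map_real_mult)

lemma continuous_fun_const: "continuous_fun (\<lambda>m. c)" by simp

lemma continuous_fun_sum:
  assumes "\<And>i. i \<in> I \<Longrightarrow> continuous_fun (f i)" shows "continuous_fun (\<lambda>m. \<Sum>i\<in>I. f i m)"
proof (cases "finite I")
  case True
  then show ?thesis using assms by (intro continuous_map_sum) auto
qed simp

lemma continuous_fun_compose:
  assumes "continuous_fun f" "continuous_on S \<phi>" "\<And>m. m \<in> topspace X \<Longrightarrow> f m \<in> S"
  shows "continuous_fun (\<lambda>m. (\<phi> (f m) :: real))"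
proof -
  have "continuous_map X (top_of_set S) f"
    using assms(1,3) by (auto simp: continuous_map_in_subtopology)
  from continuous_map_compose[OF this, of euclidean \<phi>] show ?thesis
    using assms(2) by (simp add: o_def)
qed

lemma smooth_fun_continuous: "smooth_fun A f \<Longrightarrow> continuous_fun f"
  by (rule continuous_map_charts)
    (auto simp: smooth_fun_def o_def dest!: bspec intro: smooth_on_imp_continuous_on)

lemma continuous_fun_integrable: assumes "continuous_fun f" shows "integrable \<mu>0 f"
proof -
  obtain B where B: "\<And>m. m \<in> topspace X \<Longrightarrow> \<bar>f m\<bar> \<le> B" using continuous_map_bounded[OF assms] by metis
  show ?thesis
    using continuous_map_measurable[OF assms] B
    by (intro finite_measure.integrable_const_bound[OF finite_\<mu>0, of _ B])
      (auto simp: measurable_\<mu>0 space_\<mu>0)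
qed

lemma continuous_fun_ln_dens:
  assumes "lam \<in> contact_forms" shows "continuous_fun (\<lambda>m. ln (dens lam m))"
  using dens_pos[OF assms]
  by (intro continuous_fun_compose[OF continuous_dens[OF pos_Omega1[OF assms]], of "{0<..}"])
    (auto intro!: continuous_intros)

lemma AE_dens_nonneg: "lam \<in> contact_forms \<Longrightarrow> AE m in \<mu>0. 0 \<le> dens lam m"
  using dens_pos[of lam] by (intro AE_I2) (simp add: space_\<mu>0 less_imp_le)

lemma obs_integral:
  assumes "lam \<in> contact_forms" "continuous_fun f"
  shows "obs X A n f lam = (\<integral>m. f m * dens lam m \<partial>\<mu>0)"
proof -
  have "obs X A n f lam = (\<integral>m. dens lam m *\<^sub>R f m \<partial>\<mu>0)"
    unfolding obs_def contact_measure_density(1)[OF assms(1)]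
    using continuous_map_measurable[OF assms(2)] AE_dens_nonneg[OF assms(1)]
      continuous_map_measurable[OF continuous_dens[OF pos_Omega1[OF assms(1)]]]
    by (intro integral_density) (auto simp: measurable_\<mu>0)
  then show ?thesis by (simp add: mult.commute)
qed

text \<open>Radon-Nikodym derivatives are determined almost everywhere, which suffices inside the integral.\<close>

lemma rel_entropy_integral:
  assumes "lam \<in> contact_forms"
  shows "rel_entropy X A n lam0 lam = (\<integral>m. dens lam m * ln (dens lam m) \<partial>\<mu>0)"
proof -
  interpret finite_measure \<mu>0 by (rule finite_\<mu>0)
  let ?\<nu> = "contact_measure X A n lam"
  have meas: "dens lam \<in> borel_measurable \<mu>0"
    using continuous_map_measurable[OF continuous_dens[OF pos_Omega1[OF assms]]] by (simp add: measurable_\<mu>0)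
  have fin: "finite_measure ?\<nu>"
    by (rule has_density_finite[OF contact_measure_density(2)[OF assms] positive_density_vol[OF assms]])
  have "AE m in \<mu>0. ennreal (dens lam m) = RN_deriv \<mu>0 ?\<nu> m"
    using meas contact_measure_density(1)[OF assms] finite_measure.axioms(1)[OF fin]
    by (intro RN_deriv_unique_sigma_finite) auto
  then have ae: "AE m in \<mu>0. dens lam m * ln (enn2real (RN_deriv \<mu>0 ?\<nu> m)) = dens lam m * ln (dens lam m)"
  proof (rule AE_mp, intro AE_I2 impI)
    fix m assume m: "m \<in> space \<mu>0" and eq: "ennreal (dens lam m) = RN_deriv \<mu>0 ?\<nu> m"
    have "enn2real (RN_deriv \<mu>0 ?\<nu> m) = dens lam m"
      unfolding eq[symmetric] using dens_pos[OF assms] m by (simp add: space_\<mu>0 less_imp_le)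
    then show "dens lam m * ln (enn2real (RN_deriv \<mu>0 ?\<nu> m)) = dens lam m * ln (dens lam m)" by simp
  qed
  have "rel_entropy X A n lam0 lam = (\<integral>m. ln (enn2real (RN_deriv \<mu>0 ?\<nu> m)) \<partial>density \<mu>0 (\<lambda>m. ennreal (dens lam m)))"
    unfolding rel_entropy_def \<mu>0_def[symmetric] contact_measure_density(1)[OF assms, symmetric] ..
  also have "\<dots> = (\<integral>m. dens lam m *\<^sub>R ln (enn2real (RN_deriv \<mu>0 ?\<nu> m)) \<partial>\<mu>0)"
    using meas AE_dens_nonneg[OF assms] by (intro integral_density) auto
  also have "\<dots> = (\<integral>m. dens lam m * ln (dens lam m) \<partial>\<mu>0)"
    using ae meas by (intro integral_cong_AE) auto
  finally show ?thesis .
qed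

lemma inverse_dens_bounded:
  assumes lam: "lam \<in> contact_forms"
  obtains I where "I \<ge> 0" "\<And>m. m \<in> topspace X \<Longrightarrow> \<bar>inverse (dens lam m)\<bar> \<le> I"
proof -
  have "continuous_fun (\<lambda>m. inverse (dens lam m))"
    using dens_pos[OF lam]
    by (intro continuous_fun_compose[OF continuous_dens[OF pos_Omega1[OF lam]], of "{0<..}"]) (auto intro!: continuous_intros)
  then show ?thesis using that continuous_map_bounded by metis
qed

text \<open>Positivity of the volume form is an open condition: a density is bounded away from zero on the
  compact manifold and changes by at most a multiple of \<open>t\<close>.\<close>

lemma dens_variation:
  assumes lam: "lam \<in> contact_forms" and \<alpha>: "\<alpha> \<in> Omega1 A"
  obtains \<epsilon> K where "0 < \<epsilon>" "\<epsilon> \<le> 1" "K \<ge> 0"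
    "\<And>t. \<bar>t\<bar> < \<epsilon> \<Longrightarrow> form_add_scaled lam t \<alpha> \<in> contact_forms"
    "\<And>t m. \<bar>t\<bar> < \<epsilon> \<Longrightarrow> m \<in> topspace X \<Longrightarrow>
      dens_error lam \<alpha> (ddens lam \<alpha> m) t m \<le> K * t^2"
    "\<And>t m. \<bar>t\<bar> < \<epsilon> \<Longrightarrow> m \<in> topspace X \<Longrightarrow> \<bar>dens_line lam \<alpha> t m - dens lam m\<bar> \<le> K * \<bar>t\<bar>"
proof -
  note \<Omega> = pos_Omega1[OF lam] \<alpha>
  obtain K1 where K1: "\<And>m t. m \<in> topspace X \<Longrightarrow> \<bar>t\<bar> < 1 \<Longrightarrow>
      dens_error lam \<alpha> (ddens lam \<alpha> m) t m \<le> K1 * t^2"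
    using dens_taylor(2)[OF \<Omega>] by blast
  obtain B where B: "B \<ge> 0" "\<And>m. m \<in> topspace X \<Longrightarrow> \<bar>ddens lam \<alpha> m\<bar> \<le> B"
    using continuous_map_bounded[OF dens_taylor(1)[OF \<Omega>]] by metis
  obtain I where I: "I \<ge> 0" "\<And>m. m \<in> topspace X \<Longrightarrow> \<bar>inverse (dens lam m)\<bar> \<le> I"
    using inverse_dens_bounded[OF lam] by metis
  define K where "K = \<bar>K1\<bar> + B"
  \<comment> \<open>Densities are at least \<open>1 / I\<close> and change by at most \<open>K * \<bar>t\<bar>\<close>; the summands 1 avoid division by 0.\<close>
  define \<epsilon> where "\<epsilon> = min 1 (1 / ((K + 1) * (I + 1)))"
  have K0: "K \<ge> 0" "K1 \<le> K" "\<bar>K1\<bar> \<le> K" using B(1) by (auto simp: K_def)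
  have \<epsilon>: "0 < \<epsilon>" "\<epsilon> \<le> 1" using K0(1) I(1) by (auto simp: \<epsilon>_def)
  have second: "dens_error lam \<alpha> (ddens lam \<alpha> m) t m \<le> K * t^2"
    if "\<bar>t\<bar> < \<epsilon>" "m \<in> topspace X" for t m
    using K1[OF that(2), of t] that(1) \<epsilon>(2) mult_right_mono[OF K0(2), of "t^2"] by simp
  have first: "\<bar>dens_line lam \<alpha> t m - dens lam m\<bar> \<le> K * \<bar>t\<bar>"
    if "\<bar>t\<bar> < \<epsilon>" "m \<in> topspace X" for t m
  proof -
    have t: "\<bar>t\<bar> < 1" using that \<epsilon>(2) by simp
    then have "t^2 \<le> \<bar>t\<bar>" using mult_left_le_one_le[of "\<bar>t\<bar>" "\<bar>t\<bar>"] by (simp add: power2_eq_square)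
    then have "K1 * t^2 \<le> \<bar>K1\<bar> * \<bar>t\<bar>" by (intro mult_mono) auto
    moreover have "\<bar>t * ddens lam \<alpha> m\<bar> \<le> B * \<bar>t\<bar>"
      using mult_left_mono[OF B(2)[OF that(2)], of "\<bar>t\<bar>"] by (simp add: abs_mult mult.commute)
    ultimately show ?thesis using K1[OF that(2) t] by (simp add: K_def algebra_simps)
  qed
  have "form_add_scaled lam t \<alpha> \<in> contact_forms" if t: "\<bar>t\<bar> < \<epsilon>" for t
  proof (rule pos_contact_formsI[OF Omega1_form_add_scaled[OF \<Omega>]])
    fix m assume m: "m \<in> topspace X"
    have pos: "dens lam m > 0" by (rule dens_pos[OF lam m])
    have "1 = inverse (dens lam m) * dens lam m" using pos by simp
    also have "\<dots> \<le> I * dens lam m" using I(2)[OF m] pos by (intro mult_right_mono) auto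
    also have "\<dots> < (I + 1) * dens lam m" using pos by simp
    finally have i: "1 / (I + 1) < dens lam m" using I(1) by (simp add: field_simps)
    have "K * \<bar>t\<bar> \<le> (K + 1) * \<bar>t\<bar>" by (intro mult_right_mono) auto
    also have "\<dots> \<le> (K + 1) * (1 / ((K + 1) * (I + 1)))"
      using t K0(1) by (intro mult_left_mono) (auto simp: \<epsilon>_def)
    also have "\<dots> = 1 / (I + 1)" using K0(1) by simp
    finally show "dens_line lam \<alpha> t m > 0" using first[OF t m] i by linarith
  qed
  then show ?thesis using that \<epsilon> K0(1) second first by metis
qed

lemma obs_form_differential:
  assumes lam: "lam \<in> contact_forms" and \<alpha>: "\<alpha> \<in> Omega1 A" and f: "continuous_fun f"
  shows "form_differential (obs X A n f) lam \<alpha> = (\<integral>m. f m * ddens lam \<alpha> m \<partial>\<mu>0)"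
proof -
  obtain \<epsilon> K where v: "0 < \<epsilon>" "\<epsilon> \<le> 1" "K \<ge> 0"
    "\<And>t. \<bar>t\<bar> < \<epsilon> \<Longrightarrow> form_add_scaled lam t \<alpha> \<in> contact_forms"
    "\<And>t m. \<bar>t\<bar> < \<epsilon> \<Longrightarrow> m \<in> topspace X \<Longrightarrow>
      dens_error lam \<alpha> (ddens lam \<alpha> m) t m \<le> K * t^2"
    using dens_variation[OF lam \<alpha>] by metis
  obtain B where B: "B \<ge> 0" "\<And>m. m \<in> topspace X \<Longrightarrow> \<bar>f m\<bar> \<le> B" using continuous_map_bounded[OF f] by metis
  have "((\<lambda>t. obs X A n f (form_add_scaled lam t \<alpha>)) has_real_derivative (\<integral>m. f m * ddens lam \<alpha> m \<partial>\<mu>0)) (at 0)"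
  proof (rule integral_has_derivative_quadratic[OF finite_\<mu>0 v(1)])
    show "integrable \<mu>0 (\<lambda>m. f m * dens_line lam \<alpha> t m)" if "\<bar>t\<bar> < \<epsilon>" for t
      by (intro continuous_fun_integrable continuous_fun_arith(3) f continuous_dens pos_Omega1 v(4) that)
    show "integrable \<mu>0 (\<lambda>m. f m * ddens lam \<alpha> m)"
      by (intro continuous_fun_integrable continuous_fun_arith(3) f dens_taylor(1) pos_Omega1 lam \<alpha>)
    show "obs X A n f (form_add_scaled lam t \<alpha>) = (\<integral>m. f m * dens_line lam \<alpha> t m \<partial>\<mu>0)"
      if "\<bar>t\<bar> < \<epsilon>" for t by (rule obs_integral[OF v(4)[OF that] f])
    fix t m assume t: "\<bar>t\<bar> < \<epsilon>" and "m \<in> space \<mu>0"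
    then have m: "m \<in> topspace X" by (simp add: space_\<mu>0)
    let ?r = "dens_line lam \<alpha> t m - dens lam m - t * ddens lam \<alpha> m"
    have "f m * dens_line lam \<alpha> t m - f m * dens_line lam \<alpha> 0 m - t * (f m * ddens lam \<alpha> m) = f m * ?r"
      by (simp add: algebra_simps)
    moreover have "\<bar>f m\<bar> * \<bar>?r\<bar> \<le> B * (K * t^2)" using B(1) B(2)[OF m] v(5)[OF t m] by (intro mult_mono) auto
    ultimately show "\<bar>f m * dens_line lam \<alpha> t m - f m * dens_line lam \<alpha> 0 m -
        t * (f m * ddens lam \<alpha> m)\<bar> \<le> (B * K) * t^2" by (simp add: abs_mult)
  qed
  then show ?thesis unfolding form_differential_def by (rule DERIV_imp_deriv)
qed

lemma rel_entropy_form_differential: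
  assumes lam: "lam \<in> contact_forms" and \<alpha>: "\<alpha> \<in> Omega1 A"
  shows "form_differential (rel_entropy X A n lam0) lam \<alpha> =
    (\<integral>m. (ln (dens lam m) + 1) * ddens lam \<alpha> m \<partial>\<mu>0)"
proof -
  obtain \<epsilon> K where v: "0 < \<epsilon>" "\<epsilon> \<le> 1" "K \<ge> 0"
    "\<And>t. \<bar>t\<bar> < \<epsilon> \<Longrightarrow> form_add_scaled lam t \<alpha> \<in> contact_forms"
    "\<And>t m. \<bar>t\<bar> < \<epsilon> \<Longrightarrow> m \<in> topspace X \<Longrightarrow>
      dens_error lam \<alpha> (ddens lam \<alpha> m) t m \<le> K * t^2"
    "\<And>t m. \<bar>t\<bar> < \<epsilon> \<Longrightarrow> m \<in> topspace X \<Longrightarrow> \<bar>dens_line lam \<alpha> t m - dens lam m\<bar> \<le> K * \<bar>t\<bar>"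
    using dens_variation[OF lam \<alpha>] by metis
  have ln1: "continuous_fun (\<lambda>m. ln (dens lam m) + 1)"
    by (intro continuous_fun_arith(1) continuous_fun_ln_dens lam continuous_fun_const)
  obtain B where B: "B \<ge> 0" "\<And>m. m \<in> topspace X \<Longrightarrow> \<bar>ln (dens lam m) + 1\<bar> \<le> B"
    using continuous_map_bounded[OF ln1] by metis
  obtain I where I: "I \<ge> 0" "\<And>m. m \<in> topspace X \<Longrightarrow> \<bar>inverse (dens lam m)\<bar> \<le> I"
    using inverse_dens_bounded[OF lam] by metis
  let ?f = "\<lambda>t m. dens_line lam \<alpha> t m * ln (dens_line lam \<alpha> t m)"
  have "((\<lambda>t. rel_entropy X A n lam0 (form_add_scaled lam t \<alpha>)) has_real_derivative
      (\<integral>m. (ln (dens lam m) + 1) * ddens lam \<alpha> m \<partial>\<mu>0)) (at 0)"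
  proof (rule integral_has_derivative_quadratic[OF finite_\<mu>0 v(1), where f="?f"])
    show "integrable \<mu>0 (?f t)" if "\<bar>t\<bar> < \<epsilon>" for t
      by (intro continuous_fun_integrable continuous_fun_arith(3) continuous_fun_ln_dens continuous_dens pos_Omega1 v(4) that)
    show "integrable \<mu>0 (\<lambda>m. (ln (dens lam m) + 1) * ddens lam \<alpha> m)"
      by (intro continuous_fun_integrable continuous_fun_arith(3) ln1 dens_taylor(1) pos_Omega1 lam \<alpha>)
    show "rel_entropy X A n lam0 (form_add_scaled lam t \<alpha>) = integral\<^sup>L \<mu>0 (?f t)" if "\<bar>t\<bar> < \<epsilon>" for t
      by (rule rel_entropy_integral[OF v(4)[OF that]])
    fix t m assume t: "\<bar>t\<bar> < \<epsilon>" and "m \<in> space \<mu>0"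
    then have m: "m \<in> topspace X" by (simp add: space_\<mu>0)
    define a y \<delta> where "a = dens lam m" and "y = dens_line lam \<alpha> t m" and "\<delta> = ddens lam \<alpha> m"
    have a: "a > 0" and y: "y > 0" unfolding a_def y_def by (rule dens_pos[OF _ m] lam v(4)[OF t])+
    have "(y - a)^2 / a = \<bar>y - a\<bar> * \<bar>y - a\<bar> * \<bar>inverse a\<bar>"
      using a by (simp add: power2_eq_square field_simps)
    also have "\<dots> \<le> (K * \<bar>t\<bar>) * (K * \<bar>t\<bar>) * I"
      using v(6)[OF t m] I(2)[OF m] v(3) unfolding a_def[symmetric] y_def[symmetric] by (intro mult_mono) auto
    finally have 1: "(y - a)^2 / a \<le> K^2 * I * t^2" by (simp add: power2_eq_square mult_ac)
    have "\<bar>(ln a + 1) * (y - a - t * \<delta>)\<bar> \<le> B * (K * t^2)"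
      unfolding abs_mult using B(1) B(2)[OF m] v(5)[OF t m] unfolding a_def[symmetric] y_def[symmetric] \<delta>_def[symmetric]
      by (intro mult_mono) auto
    moreover have "y * ln y - a * ln a - t * ((ln a + 1) * \<delta>) =
        (y * ln y - a * ln a - (ln a + 1) * (y - a)) + (ln a + 1) * (y - a - t * \<delta>)"
      by (simp add: algebra_simps)
    ultimately have "\<bar>y * ln y - a * ln a - t * ((ln a + 1) * \<delta>)\<bar> \<le> K^2 * I * t^2 + B * (K * t^2)"
      using entropy_function_expansion[OF a y] 1 by linarith
    then show "\<bar>?f t m - ?f 0 m - t * ((ln (dens lam m) + 1) * ddens lam \<alpha> m)\<bar> \<le> (K^2 * I + B * K) * t^2"
      by (simp add: a_def y_def \<delta>_def algebra_simps)
  qed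
  then show ?thesis unfolding form_differential_def by (rule DERIV_imp_deriv)
qed

text \<open>Conformal directions realise every smooth function as a relative variation of the density; this is
  why the big and the small phase space have the same critical densities.\<close>

lemma ddens_fun_mult_form:
  assumes lam: "lam \<in> Omega1 A" and h: "smooth_fun A h" and m: "m \<in> topspace X"
  shows "ddens lam (fun_mult_form h lam) m = real (Suc n) * h m * dens lam m"
proof -
  have smooth: "smooth_fun A (\<lambda>m. 1 + t * h m)" for t
    unfolding smooth_fun_def o_def
    using h open_cimg by (intro ballI smooth_on_add smooth_on_mult smooth_on_const) (auto simp: smooth_fun_def o_def)
  have "form_add_scaled lam t (fun_mult_form h lam) = fun_mult_form (\<lambda>m. 1 + t * h m) lam" for t
    by (simp add: form_add_scaled_def fun_mult_form_def fun_eq_iff algebra_simps)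
  then have "dens (form_add_scaled lam t (fun_mult_form h lam)) m = (1 + t * h m) ^ Suc n * dens lam m" for t
    using dens_fun_mult_form[OF smooth lam m] by simp
  moreover have "((\<lambda>t. (1 + t * h m) ^ Suc n * dens lam m) has_real_derivative real (Suc n) * h m * dens lam m) (at 0)"
    by (auto intro!: derivative_eq_intros simp: algebra_simps)
  ultimately show ?thesis unfolding ddens_def by (simp add: DERIV_imp_deriv)
qed

end

section \<open>Exponential families\<close>

lemma exp_minus_linear_bound:
  fixes s :: real
  assumes "\<bar>s\<bar> \<le> 1" shows "\<bar>exp s - 1 - s\<bar> \<le> s^2"
proof (cases "s \<ge> 0")
  case True
  have "1 + s \<le> exp s" by (rule exp_ge_add_one_self)
  moreover have "exp s \<le> 1 + s + s^2" by (rule exp_bound) (use True assms in auto)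
  ultimately show ?thesis by linarith
next
  case False
  define u where "u = - s"
  have u: "0 < u" "u \<le> 1" using False assms by (auto simp: u_def)
  have "1 \<le> (1 - u + u^2) * (1 + u)" using u by (simp add: algebra_simps power2_eq_square)
  also have "\<dots> \<le> (1 - u + u^2) * exp u"
    using exp_ge_add_one_self[of u] u by (intro mult_left_mono) auto
  finally have "exp (- u) \<le> 1 - u + u^2" by (simp add: exp_minus field_simps)
  then have "exp s \<le> 1 + s + s^2" by (simp add: u_def)
  moreover have "1 + s \<le> exp s" by (rule exp_ge_add_one_self)
  ultimately show ?thesis by linarith
qed

context closed_contact_manifold begin

text \<open>Because of this, a continuous function that vanishes almost everywhere vanishes.\<close>

lemma emeasure_open_pos:
  assumes "openin X U" "U \<noteq> {}" shows "emeasure \<mu>0 U \<noteq> 0"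
proof
  assume 0: "emeasure \<mu>0 U = 0"
  obtain m where m: "m \<in> U" using assms(2) by auto
  then have "m \<in> topspace X" using openin_subset[OF assms(1)] by auto
  then obtain c where c: "c \<in> A" "m \<in> cdom c" by (rule topspace_chart)
  let ?V = "U \<inter> cdom c"
  have V: "openin X ?V" by (intro openin_Int assms(1) open_cdom c(1))
  have W: "open (snd c ` ?V)" by (rule open_chart_image[OF c(1) V]) simp
  have "emeasure \<mu>0 ?V \<le> emeasure \<mu>0 U"
    using open_in_sets[OF assms(1)] sets_\<mu>0 by (intro emeasure_mono) auto
  then have "(\<integral>\<^sup>+x\<in>snd c ` ?V. ennreal (vol lam0 c x) \<partial>lborel) = 0"
    using 0 has_density_emeasure[OF has_density_\<mu>0 c(1) open_in_sets[OF V]] by simp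
  moreover have "(\<lambda>x. ennreal (vol lam0 c x) * indicator (snd c ` ?V) x) \<in> borel_measurable lborel"
  proof -
    have "continuous_on (snd c ` ?V) (vol lam0 c)"
      by (rule continuous_on_subset[OF smooth_on_imp_continuous_on[OF smooth_vol[OF lam0_Omega1 c(1)]]])
        (auto simp: cimg_def)
    then have "(\<lambda>x. indicator (snd c ` ?V) x *\<^sub>R vol lam0 c x) \<in> borel_measurable borel"
      by (rule borel_measurable_continuous_on_indicator[rotated]) (use W in auto)
    then have "(\<lambda>x. ennreal (indicator (snd c ` ?V) x *\<^sub>R vol lam0 c x)) \<in> borel_measurable borel" by measurable
    moreover have "(\<lambda>x. ennreal (indicator (snd c ` ?V) x *\<^sub>R vol lam0 c x)) =
        (\<lambda>x. ennreal (vol lam0 c x) * indicator (snd c ` ?V) x)"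
      by (auto simp: indicator_def fun_eq_iff)
    ultimately show ?thesis by simp
  qed
  ultimately have "AE x in lborel. ennreal (vol lam0 c x) * indicator (snd c ` ?V) x = 0"
    by (simp add: nn_integral_0_iff_AE)
  then have "AE x in lborel. x \<notin> snd c ` ?V"
  proof (rule AE_mp, intro AE_I2 impI notI)
    fix x assume "ennreal (vol lam0 c x) * indicator (snd c ` ?V) x = 0" and x: "x \<in> snd c ` ?V"
    then have "ennreal (vol lam0 c x) = 0" by simp
    moreover have "vol lam0 c x > 0" using x by (intro vol_pos[OF lam0 c(1)]) (auto simp: cimg_def)
    ultimately show False by (simp add: ennreal_eq_0_iff)
  qed
  then have "snd c ` ?V \<in> null_sets lborel"
    using W by (subst AE_iff_null_sets) auto
  then have "negligible (snd c ` ?V)"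
    by (simp add: negligible_iff_null_sets null_sets_completionI)
  moreover have "snd c ` ?V \<noteq> {}" using m c by auto
  ultimately show False using open_not_negligible[OF W] by blast
qed

lemma continuous_integral_zero:
  assumes f: "continuous_fun f" and nonneg: "\<And>m. m \<in> topspace X \<Longrightarrow> f m \<ge> 0"
    and zero: "(\<integral>m. f m \<partial>\<mu>0) = 0" and m: "m \<in> topspace X"
  shows "f m = 0"
proof (rule ccontr)
  assume "f m \<noteq> 0"
  let ?U = "{m \<in> topspace X. f m \<in> - {0}}"
  have "AE m in \<mu>0. 0 \<le> f m" using nonneg by (intro AE_I2) (simp add: space_\<mu>0)
  then have ae: "AE m in \<mu>0. f m = 0"
    using integral_nonneg_eq_0_iff_AE[OF continuous_fun_integrable[OF f]] zero by simp
  have "open (- {0::real})" by (rule open_Compl[OF closed_singleton])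
  then have U: "openin X ?U" using f unfolding continuous_map_def by (simp only: open_openin)
  have "?U \<in> sets \<mu>0" using open_in_sets[OF U] sets_\<mu>0 by simp
  moreover have "{m \<in> space \<mu>0. \<not> f m = 0} = ?U" by (auto simp: space_\<mu>0)
  ultimately have "emeasure \<mu>0 ?U = 0" by (rule AE_iff_measurable[THEN iffD1, OF _ _ ae])
  then show False using emeasure_open_pos[OF U] m \<open>f m \<noteq> 0\<close> by auto
qed

end

locale contact_equilibrium = closed_contact_manifold X A n lam0
  for X :: "'m topology" and A :: "('m, 'd::{finite,wellorder}) chart set" and n lam0 +
  fixes F :: "'N::finite \<Rightarrow> 'm \<Rightarrow> real" and C :: "('m, 'd) oneform set"
    and T :: "('m, 'd) oneform \<Rightarrow> ('m, 'd) oneform set"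
  assumes smooth_F: "smooth_fun A (F i)"
    and phase_space: "(C = pos_contact_forms A n \<and> T = (\<lambda>_. Omega1 A)) \<or>
         (C = pos_contact_forms_ker A n (form_kernel lam0) \<and> T = conformal_tangent A)"
    and submersion: "observation_submersion X A n F C T"
begin

lemma C_pos: "lam \<in> C \<Longrightarrow> lam \<in> contact_forms"
  using phase_space by (auto simp: pos_contact_forms_ker_def)

lemma T_Omega1: "lam \<in> C \<Longrightarrow> \<alpha> \<in> T lam \<Longrightarrow> \<alpha> \<in> Omega1 A"
  using phase_space C_pos pos_Omega1 Omega1_fun_mult_form by (auto simp: conformal_tangent_def)

lemma conformal_T: "lam \<in> C \<Longrightarrow> smooth_fun A h \<Longrightarrow> fun_mult_form h lam \<in> T lam"
  using phase_space C_pos pos_Omega1 Omega1_fun_mult_form by (auto simp: conformal_tangent_def)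

lemma continuous_F: "continuous_fun (F i)"
  by (rule smooth_fun_continuous[OF smooth_F])

definition potential :: "real^'N \<Rightarrow> 'm \<Rightarrow> real" where
  "potential p m = (\<Sum>i\<in>UNIV. p $ i * F i m)"

lemma potential_add: "potential (p + q) m = potential p m + potential q m"
  by (simp add: potential_def algebra_simps sum.distrib)

lemma potential_scale: "potential (r *\<^sub>R p) m = r * potential p m"
  by (simp add: potential_def sum_distrib_left mult.assoc)

lemma continuous_potential: "continuous_fun (potential p)"
  unfolding potential_def by (intro continuous_fun_sum continuous_fun_arith(3) continuous_fun_const continuous_F)

lemma smooth_fun_potential: "smooth_fun A (potential p)"
  unfolding smooth_fun_def potential_def o_def
  using smooth_F open_cimg
  by (intro ballI smooth_on_sum smooth_on_mult smooth_on_const) (auto simp: smooth_fun_def o_def)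

lemma potential_bounded: obtains B where "B > 0" "\<And>p m. m \<in> topspace X \<Longrightarrow> \<bar>potential p m\<bar> \<le> B * norm p"
proof -
  have "\<forall>i. \<exists>b\<ge>0. \<forall>m\<in>topspace X. \<bar>F i m\<bar> \<le> b"
    using continuous_map_bounded[OF continuous_F] by metis
  then obtain b where b: "\<And>i. b i \<ge> 0" "\<And>i m. m \<in> topspace X \<Longrightarrow> \<bar>F i m\<bar> \<le> b i" by metis
  have "\<bar>potential p m\<bar> \<le> ((\<Sum>i\<in>UNIV. b i) + 1) * norm p" if m: "m \<in> topspace X" for p m
  proof -
    have "\<bar>potential p m\<bar> \<le> (\<Sum>i\<in>UNIV. \<bar>p $ i * F i m\<bar>)" unfolding potential_def by (rule sum_abs)
    also have "\<dots> \<le> (\<Sum>i\<in>UNIV. norm p * b i)"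
      unfolding abs_mult using b m component_le_norm_cart[of p] by (intro sum_mono mult_mono) auto
    also have "\<dots> = (\<Sum>i\<in>UNIV. b i) * norm p" by (simp add: sum_distrib_left[symmetric] mult.commute)
    also have "\<dots> \<le> ((\<Sum>i\<in>UNIV. b i) + 1) * norm p" by (intro mult_right_mono) auto
    finally show ?thesis .
  qed
  moreover have "(\<Sum>i\<in>UNIV. b i) + 1 > 0" using b(1) by (smt (verit) sum_nonneg)
  ultimately show ?thesis using that by blast
qed

text \<open>Moments of the critical densities.  The constant in the exponent comes from the derivative
  \<open>ln f + 1\<close> of \<open>f * ln f\<close>.\<close>

definition moment :: "('m \<Rightarrow> real) \<Rightarrow> real^'N \<Rightarrow> real" where
  "moment G p = (\<integral>m. G m * exp (potential p m - 1) \<partial>\<mu>0)"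

lemma continuous_exp_potential: "continuous_fun (\<lambda>m. exp (potential p m - 1))"
  by (rule continuous_fun_compose[OF continuous_potential, of UNIV "\<lambda>y. exp (y - 1)"])
    (auto intro!: continuous_intros)

lemma moment_integrable: "continuous_fun G \<Longrightarrow> integrable \<mu>0 (\<lambda>m. G m * exp (potential p m - 1))"
  by (intro continuous_fun_integrable continuous_fun_arith(3) continuous_exp_potential)

lemma moment_add: "continuous_fun G \<Longrightarrow> continuous_fun H \<Longrightarrow> moment (\<lambda>m. G m + H m) p = moment G p + moment H p"
  unfolding moment_def using moment_integrable[of G p] moment_integrable[of H p] by (simp add: distrib_right)

lemma moment_scale: "moment (\<lambda>m. r * G m) p = r * moment G p"
  unfolding moment_def by (simp add: mult.assoc)

lemma moment_potential: "moment (potential v) p = (\<Sum>i\<in>UNIV. v $ i * moment (F i) p)"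
proof -
  have "moment (potential v) p = (\<integral>m. (\<Sum>i\<in>UNIV. v $ i * (F i m * exp (potential p m - 1))) \<partial>\<mu>0)"
    unfolding moment_def potential_def[of v] by (simp add: sum_distrib_right mult.assoc)
  also have "\<dots> = (\<Sum>i\<in>UNIV. v $ i * moment (F i) p)"
    unfolding moment_def using moment_integrable[OF continuous_F] by (subst Bochner_Integration.integral_sum) auto
  finally show ?thesis .
qed

text \<open>Differentiating a moment of an exponential family gives a moment again, so one derivative
  yields all of them.\<close>

lemma moment_has_derivative:
  assumes G: "continuous_fun G"
  shows "(moment G has_derivative (\<lambda>v. moment (\<lambda>m. G m * potential v m) p)) (at p)"
proof -
  obtain B where B: "B > 0" "\<And>p m. m \<in> topspace X \<Longrightarrow> \<bar>potential p m\<bar> \<le> B * norm p" by (rule potential_bounded) blast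
  obtain K where K: "K \<ge> 0" "\<And>m. m \<in> topspace X \<Longrightarrow> \<bar>G m * exp (potential p m - 1)\<bar> \<le> K"
    using continuous_map_bounded[OF continuous_fun_arith(3)[OF G continuous_exp_potential[of p]]] by metis
  have GF: "continuous_fun (\<lambda>m. G m * potential v m)" for v
    by (intro continuous_fun_arith(3) G continuous_potential)
  have "linear (\<lambda>v. moment (\<lambda>m. G m * potential v m) p)"
  proof (rule linearI)
    show "moment (\<lambda>m. G m * potential (v + w) m) p = moment (\<lambda>m. G m * potential v m) p + moment (\<lambda>m. G m * potential w m) p" for v w
      using moment_add[OF GF[of v] GF[of w]] by (simp add: potential_add distrib_left)
    show "moment (\<lambda>m. G m * potential (r *\<^sub>R v) m) p = r *\<^sub>R moment (\<lambda>m. G m * potential v m) p" for r v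
      using moment_scale[of r "\<lambda>m. G m * potential v m" p] by (simp add: potential_scale mult.left_commute)
  qed
  then have lin: "bounded_linear (\<lambda>v. moment (\<lambda>m. G m * potential v m) p)" by (rule linear_conv_bounded_linear[THEN iffD1])
  interpret finite_measure \<mu>0 by (rule finite_\<mu>0)
  let ?M = "measure \<mu>0 (space \<mu>0)"
  have est: "\<bar>moment G (p + v) - moment G p - moment (\<lambda>m. G m * potential v m) p\<bar> \<le> (K * B^2 * ?M) * (norm v)^2"
    if v: "norm v \<le> 1 / B" for v
  proof -
    define d where "d m = G m * exp (potential (p + v) m - 1) - G m * exp (potential p m - 1) - G m * potential v m * exp (potential p m - 1)" for m
    note int = moment_integrable[OF G, of "p + v"] moment_integrable[OF G, of p] moment_integrable[OF GF[of v], of p]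
    have d_int: "integrable \<mu>0 d"
      unfolding d_def by (rule Bochner_Integration.integrable_diff[OF Bochner_Integration.integrable_diff[OF int(1,2)] int(3)])
    have "moment G (p + v) - moment G p - moment (\<lambda>m. G m * potential v m) p = (\<integral>m. d m \<partial>\<mu>0)"
      unfolding moment_def d_def
      by (simp only: Bochner_Integration.integral_diff[OF Bochner_Integration.integrable_diff[OF int(1,2)] int(3)]
          Bochner_Integration.integral_diff[OF int(1,2)])
    also have "\<bar>\<dots>\<bar> \<le> (\<integral>m. \<bar>d m\<bar> \<partial>\<mu>0)"
      by (rule integral_abs_bound)
    also have "\<dots> \<le> (\<integral>m. K * (B * norm v)^2 \<partial>\<mu>0)"
    proof (rule Bochner_Integration.integral_mono[OF integrable_abs[OF d_int]])
      fix m assume "m \<in> space \<mu>0"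
      then have m: "m \<in> topspace X" by (simp add: space_\<mu>0)
      let ?s = "potential v m"
      have s: "\<bar>?s\<bar> \<le> B * norm v" by (rule B(2)[OF m])
      also have "\<dots> \<le> 1" using v B(1) by (simp add: field_simps)
      finally have s1: "\<bar>?s\<bar> \<le> 1" .
      have "?s^2 \<le> (B * norm v)^2" using power_mono[OF s, of 2] by simp
      then have e: "\<bar>exp ?s - 1 - ?s\<bar> \<le> (B * norm v)^2" using exp_minus_linear_bound[OF s1] by linarith
      have "exp (potential (p + v) m - 1) = exp (potential p m - 1) * exp ?s"
        unfolding potential_add exp_add[symmetric] by (simp add: add_ac diff_add_eq)
      then have "d m = (G m * exp (potential p m - 1)) * (exp ?s - 1 - ?s)"
        by (simp add: d_def algebra_simps)
      then show "\<bar>d m\<bar> \<le> K * (B * norm v)^2"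
        using mult_mono[OF K(2)[OF m] e K(1)] by (simp add: abs_mult)
    qed simp
    finally show ?thesis by (simp add: power_mult_distrib mult_ac)
  qed
  show ?thesis
  proof (rule has_derivativeI_sandwich[OF _ lin])
    show "1 / B > 0" using B(1) by simp
    fix y assume y: "y \<noteq> p" "dist y p < 1 / B"
    have "norm (moment G y - moment G p - moment (\<lambda>m. G m * potential (y - p) m) p) \<le> (K * B^2 * ?M) * (norm (y - p))^2"
      using est[of "y - p"] y(2) by (simp add: dist_norm)
    then have "norm (moment G y - moment G p - moment (\<lambda>m. G m * potential (y - p) m) p) / norm (y - p)
        \<le> (K * B^2 * ?M) * (norm (y - p))^2 / norm (y - p)"
      by (rule divide_right_mono) simp
    also have "\<dots> = (K * B^2 * ?M) * norm (y - p)" by (simp add: power2_eq_square)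
    finally show "norm (moment G y - moment G p - moment (\<lambda>m. G m * potential (y - p) m) p) / norm (y - p)
        \<le> (K * B^2 * ?M) * norm (y - p)" .
  next
    show "((\<lambda>y. (K * B^2 * ?M) * norm (y - p)) \<longlongrightarrow> 0) (at p)"
      by (auto intro!: tendsto_eq_intros)
  qed
qed

lemma smooth_on_moment: assumes "continuous_fun G" shows "smooth_on UNIV (moment G)"
proof -
  have "Ck_on k UNIV (moment G)" if "continuous_fun G" for k G
    using that
  proof (induction k arbitrary: G)
    case 0
    have "continuous_on UNIV (moment G)"
      using has_derivative_continuous[OF moment_has_derivative[OF 0]]
      by (intro continuous_at_imp_continuous_on) blast
    then show ?case by simp
  next
    case (Suc k)
    show ?case
      by (rule Ck_on_Suc_I[OF open_UNIV moment_has_derivative[OF Suc.prems]])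
        (intro Suc.IH continuous_fun_arith(3) Suc.prems continuous_potential)
  qed
  then show ?thesis using assms by (simp add: smooth_on_def)
qed

end

lemma second_countable_space_top_of_set:
  fixes S :: "'a::second_countable_topology set"
  shows "second_countable_space (top_of_set S)"
proof -
  obtain \<B> :: "'a set set" where \<B>: "countable \<B>" "topological_basis \<B>"
    using ex_countable_basis by blast
  let ?\<B> = "(\<lambda>V. S \<inter> V) ` \<B>"
  have "\<exists>V\<in>?\<B>. x \<in> V \<and> V \<subseteq> U" if U: "openin (top_of_set S) U" "x \<in> U" for U x
  proof -
    have "\<exists>W. open W \<and> U = S \<inter> W" using U(1) by (simp add: openin_open)
    then obtain W where W: "open W" "U = S \<inter> W" by (elim exE conjE)
    then have "x \<in> W" using U(2) by simp
    then obtain V where V: "V \<in> \<B>" "x \<in> V" "V \<subseteq> W"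
      by (rule topological_basisE[OF \<B>(2) W(1)])
    have "S \<inter> V \<in> ?\<B>" "x \<in> S \<inter> V" "S \<inter> V \<subseteq> U" using V W U(2) by auto
    then show ?thesis by (intro bexI[of _ "S \<inter> V"] conjI)
  qed
  moreover have "openin (top_of_set S) V" if "V \<in> ?\<B>" for V
    using that topological_basis_open[OF \<B>(2)] by (auto simp: openin_open)
  ultimately show ?thesis
    unfolding second_countable_space_def using \<B>(1)
    by (intro exI[of _ ?\<B>] conjI ballI allI impI) (simp_all only: countable_image)
qed

section \<open>Critical points of the relative entropy\<close>

context contact_equilibrium begin

abbreviation dO :: "'N \<Rightarrow> ('m, 'd) oneform \<Rightarrow> ('m, 'd) oneform \<Rightarrow> real" where
  "dO i lam \<alpha> \<equiv> form_differential (obs X A n (F i)) lam \<alpha>"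

lemma obs_differential_component:
  assumes "lam \<in> C" "\<alpha> \<in> T lam"
  shows "dO i lam \<alpha> = (\<integral>m. F i m * ddens lam \<alpha> m \<partial>\<mu>0)"
  by (rule obs_form_differential[OF C_pos[OF assms(1)] T_Omega1[OF assms] continuous_F])

lemma potential_differential:
  assumes lam: "lam \<in> C" "\<alpha> \<in> T lam"
  shows "(\<Sum>i\<in>UNIV. p $ i * dO i lam \<alpha>) = (\<integral>m. potential p m * ddens lam \<alpha> m \<partial>\<mu>0)"
proof -
  have int: "integrable \<mu>0 (\<lambda>m. F i m * ddens lam \<alpha> m)" for i
    by (intro continuous_fun_integrable continuous_fun_arith(3) continuous_F
        dens_taylor(1)[OF pos_Omega1[OF C_pos[OF lam(1)]] T_Omega1[OF lam]])
  have "(\<integral>m. potential p m * ddens lam \<alpha> m \<partial>\<mu>0) = (\<integral>m. (\<Sum>i\<in>UNIV. p $ i * (F i m * ddens lam \<alpha> m)) \<partial>\<mu>0)"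
    by (simp add: potential_def sum_distrib_right mult.assoc)
  also have "\<dots> = (\<Sum>i\<in>UNIV. p $ i * (\<integral>m. F i m * ddens lam \<alpha> m \<partial>\<mu>0))"
    using int by (subst Bochner_Integration.integral_sum) auto
  finally show ?thesis by (simp add: obs_differential_component[OF lam])
qed

lemma submersion_obtain:
  assumes "lam \<in> C"
  obtains \<alpha> where "\<alpha> \<in> T lam" "\<And>i. dO i lam \<alpha> = v $ i"
proof -
  have "v \<in> obs_differential X A n F lam ` T lam"
    using submersion assms by (simp add: observation_submersion_def)
  then obtain \<alpha> where \<alpha>: "\<alpha> \<in> T lam" "v = obs_differential X A n F lam \<alpha>" by blast
  show ?thesis by (rule that[OF \<alpha>(1)]) (simp add: \<alpha>(2) obs_differential_def)
qed

text \<open>Surjectivity of the differential of the observation map makes the observables linearly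
  independent; hence Lagrange multipliers are unique.\<close>

lemma multiplier_zero:
  assumes lam: "lam \<in> C" and zero: "\<And>\<alpha>. \<alpha> \<in> T lam \<Longrightarrow> (\<Sum>i\<in>UNIV. v $ i * dO i lam \<alpha>) = 0"
  shows "v = 0"
proof -
  obtain \<alpha> where \<alpha>: "\<alpha> \<in> T lam" "\<And>i. dO i lam \<alpha> = v $ i"
    using submersion_obtain[OF lam] by metis
  have "v \<bullet> v = 0" using zero[OF \<alpha>(1)] by (simp add: \<alpha>(2) inner_vec_def)
  then show ?thesis by simp
qed

lemma entropy_differential_multiplier:
  assumes lam: "lam \<in> C" and p: "\<And>m. m \<in> topspace X \<Longrightarrow> ln (dens lam m) + 1 = potential p m" and \<alpha>: "\<alpha> \<in> T lam"
  shows "form_differential (rel_entropy X A n lam0) lam \<alpha> =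
    (\<Sum>i\<in>UNIV. p $ i * dO i lam \<alpha>)"
proof -
  have "(\<integral>m. (ln (dens lam m) + 1) * ddens lam \<alpha> m \<partial>\<mu>0) = (\<integral>m. potential p m * ddens lam \<alpha> m \<partial>\<mu>0)"
    by (rule Bochner_Integration.integral_cong) (simp_all add: p space_\<mu>0)
  then show ?thesis
    unfolding potential_differential[OF lam \<alpha>] rel_entropy_form_differential[OF C_pos[OF lam] T_Omega1[OF lam \<alpha>]] .
qed

lemma multiplier_critical:
  assumes lam: "lam \<in> C" and p: "\<And>m. m \<in> topspace X \<Longrightarrow> ln (dens lam m) + 1 = potential p m"
  shows "lam \<in> vertical_critical_set X A n F C T lam0" "lagrange_multiplier X A n F T lam0 lam = p"
proof -
  have eq: "form_differential (rel_entropy X A n lam0) lam \<alpha> =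
      (\<Sum>i\<in>UNIV. p $ i * dO i lam \<alpha>)" if "\<alpha> \<in> T lam" for \<alpha>
    by (rule entropy_differential_multiplier[OF lam _ that]) (rule p)
  have "form_differential (rel_entropy X A n lam0) lam \<alpha> = 0"
    if "\<alpha> \<in> T lam" "obs_differential X A n F lam \<alpha> = 0" for \<alpha>
    using eq[OF that(1)] that(2) by (simp add: obs_differential_def vec_eq_iff)
  then show "lam \<in> vertical_critical_set X A n F C T lam0"
    using lam by (simp add: vertical_critical_set_def)
  show "lagrange_multiplier X A n F T lam0 lam = p"
    unfolding lagrange_multiplier_def
  proof (rule the_equality)
    show "\<forall>\<alpha>\<in>T lam. form_differential (rel_entropy X A n lam0) lam \<alpha> =
        (\<Sum>i\<in>UNIV. p $ i * dO i lam \<alpha>)" by (intro ballI eq)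
    fix q assume q: "\<forall>\<alpha>\<in>T lam. form_differential (rel_entropy X A n lam0) lam \<alpha> =
        (\<Sum>i\<in>UNIV. q $ i * dO i lam \<alpha>)"
    have "q - p = 0"
    proof (rule multiplier_zero[OF lam])
      fix \<alpha> assume \<alpha>: "\<alpha> \<in> T lam"
      have "(\<Sum>i\<in>UNIV. q $ i * dO i lam \<alpha>) =
          (\<Sum>i\<in>UNIV. p $ i * dO i lam \<alpha>)"
        by (rule trans[OF sym[OF bspec[OF q \<alpha>]] eq[OF \<alpha>]])
      then show "(\<Sum>i\<in>UNIV. (q - p) $ i * dO i lam \<alpha>) = 0"
        by (simp add: left_diff_distrib sum_subtractf)
    qed
    then show "q = p" by simp
  qed
qed

lemma smooth_fun_entropy_gradient:
  assumes lam: "lam \<in> C"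
  shows "smooth_fun A (\<lambda>m. ln (dens lam m) + 1 - potential p m)"
  unfolding smooth_fun_def
proof
  fix c assume c: "c \<in> A"
  note pos = C_pos[OF lam]
  have "smooth_on (cimg c) (\<lambda>x. (ln (vol lam c x) + (-1) * ln (vol lam0 c x)) + (1 + (-1) * potential p (cinv c x)))"
    using smooth_fun_potential[of p] c vol_pos[OF pos c] vol_pos[OF lam0 c]
    by (intro smooth_on_add smooth_on_mult smooth_on_const smooth_on_ln open_cimg
        smooth_vol pos_Omega1 pos lam0_Omega1) (auto simp: smooth_fun_def o_def)
  moreover have "(ln (vol lam c x) + (-1) * ln (vol lam0 c x)) + (1 + (-1) * potential p (cinv c x)) =
      ((\<lambda>m. ln (dens lam m) + 1 - potential p m) \<circ> cinv c) x" if "x \<in> cimg c" for x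
    using vol_pos[OF pos c that] vol_pos[OF lam0 c that] dens_cinv[OF pos_Omega1[OF pos] c that]
    by (simp add: ln_div)
  ultimately show "smooth_on (cimg c) ((\<lambda>m. ln (dens lam m) + 1 - potential p m) \<circ> cinv c)"
    by (rule smooth_on_cong[OF open_cimg[OF c], rotated])
qed

text \<open>Projecting the entropy gradient orthogonally (for the measure of the critical form) to the span
  of the observables leaves a smooth remainder \<open>h\<close>.  The conformal variation by \<open>h\<close> does not change
  the observations, so criticality makes \<open>h\<close> orthogonal to itself.\<close>

lemma critical_multiplier:
  assumes crit: "lam \<in> vertical_critical_set X A n F C T lam0"
  obtains p where "\<And>m. m \<in> topspace X \<Longrightarrow> ln (dens lam m) + 1 = potential p m"
proof -
  have lam: "lam \<in> C" using crit by (simp add: vertical_critical_set_def)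
  note pos = C_pos[OF lam]
  let ?d = "dens lam" and ?g = "\<lambda>m. ln (dens lam m) + 1"
  have cd: "continuous_fun ?d" by (rule continuous_dens[OF pos_Omega1[OF pos]])
  have cg: "continuous_fun ?g" by (intro continuous_fun_arith(1) continuous_fun_ln_dens pos continuous_fun_const)
  define ip where "ip f k = (\<integral>m. f m * k m * ?d m \<partial>\<mu>0)" for f k
  have int: "integrable \<mu>0 (\<lambda>m. f m * k m * ?d m)" if "continuous_fun f" "continuous_fun k" for f k
    by (intro continuous_fun_integrable continuous_fun_arith(3) that cd)
  have ip_potential: "ip f (potential v) = (\<Sum>i\<in>UNIV. v $ i * ip f (F i))" if f: "continuous_fun f" for f v
  proof -
    have "ip f (potential v) = (\<integral>m. (\<Sum>i\<in>UNIV. v $ i * (f m * F i m * ?d m)) \<partial>\<mu>0)"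
      unfolding ip_def potential_def by (simp add: sum_distrib_left sum_distrib_right mult_ac)
    then show ?thesis
      unfolding ip_def using int[OF f continuous_F] by (subst (asm) Bochner_Integration.integral_sum) auto
  qed
  have ip_self: "f m = 0" if f: "continuous_fun f" and 0: "ip f f = 0" and m: "m \<in> topspace X" for f m
  proof -
    have "f m * f m * ?d m = 0"
      using dens_pos[OF pos] 0 unfolding ip_def
      by (intro continuous_integral_zero[of "\<lambda>m. f m * f m * ?d m"] continuous_fun_arith(3) f cd m)
        (auto simp: less_imp_le)
    then show ?thesis using dens_pos[OF pos m] by simp
  qed
  define G :: "real^'N \<Rightarrow> real^'N" where "G v = (\<chi> j. ip (F j) (potential v))" for v
  have "linear G"
    by (rule linearI) (simp_all add: G_def vec_eq_iff ip_potential[OF continuous_F] algebra_simps sum.distrib sum_distrib_left)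
  have "inj G"
  proof (rule linear_injective_0[OF \<open>linear G\<close>, THEN iffD2], intro allI impI)
    fix v assume "G v = 0"
    then have "ip (potential v) (F j) = 0" for j
      by (simp add: G_def vec_eq_iff ip_def mult.commute)
    then have "ip (potential v) (potential v) = 0" by (simp add: ip_potential[OF continuous_potential])
    then have 0: "potential v m = 0" if "m \<in> topspace X" for m using ip_self[OF continuous_potential] that by blast
    show "v = 0"
    proof (rule multiplier_zero[OF lam])
      fix \<alpha> assume "\<alpha> \<in> T lam"
      have "(\<integral>m. potential v m * ddens lam \<alpha> m \<partial>\<mu>0) = (\<integral>m. 0 \<partial>\<mu>0)"
        by (rule Bochner_Integration.integral_cong) (simp_all add: 0 space_\<mu>0)
      then show "(\<Sum>i\<in>UNIV. v $ i * dO i lam \<alpha>) = 0"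
        unfolding potential_differential[OF lam \<open>\<alpha> \<in> T lam\<close>] by simp
    qed
  qed
  then have "surj G" by (rule linear_inj_imp_surj[OF \<open>linear G\<close>])
  then obtain p where p: "G p = (\<chi> j. ip (F j) ?g)" by (metis surjD)
  \<comment> \<open>The Gram matrix of the observables is invertible; \<open>p\<close> solves the normal equations.\<close>
  define h where "h m = ?g m - potential p m" for m
  have ch: "continuous_fun h" unfolding h_def by (intro continuous_fun_arith(2) cg continuous_potential)
  have sh: "smooth_fun A h" unfolding h_def by (rule smooth_fun_entropy_gradient[OF lam])
  have orth: "ip (F j) h = 0" for j
  proof -
    have "ip (F j) h = ip (F j) ?g - ip (F j) (potential p)"
      unfolding ip_def h_def using int[OF continuous_F cg] int[OF continuous_F continuous_potential]
      by (simp add: algebra_simps)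
    then show ?thesis using p by (simp add: G_def vec_eq_iff)
  qed
  let ?\<alpha> = "fun_mult_form h lam"
  have \<alpha>: "?\<alpha> \<in> T lam" by (rule conformal_T[OF lam sh])
  have var: "(\<integral>m. f m * ddens lam ?\<alpha> m \<partial>\<mu>0) = real (Suc n) * ip f h" for f
  proof -
    have "(\<integral>m. f m * ddens lam ?\<alpha> m \<partial>\<mu>0) = (\<integral>m. real (Suc n) * (f m * h m * ?d m) \<partial>\<mu>0)"
      by (rule Bochner_Integration.integral_cong)
        (simp_all add: ddens_fun_mult_form[OF pos_Omega1[OF pos] sh] space_\<mu>0)
    then show ?thesis by (simp add: ip_def)
  qed
  have "obs_differential X A n F lam ?\<alpha> = 0"
    by (simp add: obs_differential_def vec_eq_iff obs_differential_component[OF lam \<alpha>] var orth)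
  then have "form_differential (rel_entropy X A n lam0) lam ?\<alpha> = 0"
    using crit \<alpha> by (simp add: vertical_critical_set_def)
  then have g0: "ip ?g h = 0"
    unfolding rel_entropy_form_differential[OF pos T_Omega1[OF lam \<alpha>]] var by simp
  have "ip (potential p) h = ip h (potential p)" by (simp add: ip_def mult.commute)
  also have "\<dots> = (\<Sum>i\<in>UNIV. p $ i * ip (F i) h)"
    unfolding ip_potential[OF ch] by (simp add: ip_def mult.commute)
  also have "\<dots> = 0" by (simp add: orth)
  finally have "ip h h = ip ?g h - 0"
    unfolding ip_def h_def using int[OF cg ch] int[OF continuous_potential ch]
    by (simp add: h_def left_diff_distrib)
  then have "h m = 0" if "m \<in> topspace X" for m using ip_self[OF ch] g0 that by simp
  then show ?thesis using that[of p] by (simp add: h_def)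
qed

text \<open>The root makes the volume form of \<open>equilibrium_form p\<close> equal to \<open>exp (potential p - 1)\<close> times that
  of \<open>lam0\<close>, and a positive multiple of \<open>lam0\<close> lies in both phase spaces.\<close>

definition equilibrium_form :: "real^'N \<Rightarrow> ('m, 'd) oneform" where
  "equilibrium_form p = fun_mult_form (\<lambda>m. exp ((potential p m - 1) / real (Suc n))) lam0"

lemma smooth_fun_equilibrium_factor: "smooth_fun A (\<lambda>m. exp ((potential p m - 1) / real (Suc n)))"
  unfolding smooth_fun_def
proof
  fix c assume c: "c \<in> A"
  have "smooth_on (cimg c) (\<lambda>x. exp (1 / real (Suc n) * (potential p (cinv c x) + (-1))))"
    using smooth_fun_potential[of p] c
    by (intro smooth_on_exp smooth_on_mult smooth_on_add smooth_on_const open_cimg)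
      (auto simp: smooth_fun_def o_def)
  then show "smooth_on (cimg c) ((\<lambda>m. exp ((potential p m - 1) / real (Suc n))) \<circ> cinv c)"
    by (simp add: o_def)
qed

lemma dens_equilibrium_form:
  assumes "m \<in> topspace X" shows "dens (equilibrium_form p) m = exp (potential p m - 1)"
proof -
  have "exp ((potential p m - 1) / real (Suc n)) ^ Suc n = exp (real (Suc n) * ((potential p m - 1) / real (Suc n)))"
    by (rule exp_of_nat_mult[symmetric])
  also have "\<dots> = exp (potential p m - 1)" by simp
  finally show ?thesis
    unfolding equilibrium_form_def dens_fun_mult_form[OF smooth_fun_equilibrium_factor lam0_Omega1 assms]
    using dens_lam0[OF assms] by simp
qed

lemma equilibrium_form_C: "equilibrium_form p \<in> C"
proof -
  have \<Omega>: "equilibrium_form p \<in> Omega1 A"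
    unfolding equilibrium_form_def by (rule Omega1_fun_mult_form[OF smooth_fun_equilibrium_factor lam0_Omega1])
  have pos: "equilibrium_form p \<in> contact_forms"
    by (rule pos_contact_formsI[OF \<Omega>]) (simp add: dens_equilibrium_form)
  have "form_kernel (equilibrium_form p) = form_kernel lam0"
    by (simp add: fun_eq_iff form_kernel_def equilibrium_form_def fun_mult_form_def)
  with pos show ?thesis using phase_space by (auto simp: pos_contact_forms_ker_def)
qed

definition equilibrium_point :: "real^'N \<Rightarrow> 'N jet" where
  "equilibrium_point p =
    (\<chi> i. moment (F i) p, p, (\<Sum>i\<in>UNIV. p $ i * moment (F i) p) - moment (\<lambda>_. 1) p)"

lemma equilibrium_embedding_point:
  assumes lam: "lam \<in> C" and p: "\<And>m. m \<in> topspace X \<Longrightarrow> ln (dens lam m) + 1 = potential p m"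
  shows "equilibrium_embedding X A n F T lam0 lam = equilibrium_point p"
proof -
  have d: "dens lam m = exp (potential p m - 1)" if "m \<in> topspace X" for m
  proof -
    have "ln (dens lam m) = potential p m - 1" using p[OF that] by simp
    then show ?thesis using dens_pos[OF C_pos[OF lam] that] by (metis exp_ln)
  qed
  have "obs X A n (F i) lam = moment (F i) p" for i
    unfolding obs_integral[OF C_pos[OF lam] continuous_F] moment_def
    by (rule Bochner_Integration.integral_cong) (simp_all add: d space_\<mu>0)
  then have q: "observation_map X A n F lam = (\<chi> i. moment (F i) p)"
    by (simp add: observation_map_def)
  have "rel_entropy X A n lam0 lam = (\<integral>m. potential p m * exp (potential p m - 1) - 1 * exp (potential p m - 1) \<partial>\<mu>0)"
    unfolding rel_entropy_integral[OF C_pos[OF lam]]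
    by (rule Bochner_Integration.integral_cong) (simp_all add: d space_\<mu>0 algebra_simps)
  also have "\<dots> = moment (potential p) p - moment (\<lambda>_. 1) p"
    unfolding moment_def
    by (rule Bochner_Integration.integral_diff[OF moment_integrable[OF continuous_potential]
          moment_integrable[OF continuous_fun_const]])
  finally have z: "rel_entropy X A n lam0 lam = (\<Sum>i\<in>UNIV. p $ i * moment (F i) p) - moment (\<lambda>_. 1) p"
    unfolding moment_potential .
  have "lagrange_multiplier X A n F T lam0 lam = p"
    by (rule multiplier_critical(2)[OF lam]) (rule p)
  then show ?thesis
    by (simp add: equilibrium_embedding_def equilibrium_point_def q z)
qed

lemma equilibrium_form_multiplier:
  "m \<in> topspace X \<Longrightarrow> ln (dens (equilibrium_form p) m) + 1 = potential p m"
  by (simp add: dens_equilibrium_form)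

lemma thermodynamic_equilibrium_range:
  "thermodynamic_equilibrium X A n F C T lam0 = range equilibrium_point"
  unfolding thermodynamic_equilibrium_def
proof (intro equalityI subsetI)
  fix j assume "j \<in> equilibrium_embedding X A n F T lam0 ` vertical_critical_set X A n F C T lam0"
  then obtain lam where lam: "lam \<in> vertical_critical_set X A n F C T lam0"
    "j = equilibrium_embedding X A n F T lam0 lam" by blast
  obtain p where p: "\<And>m. m \<in> topspace X \<Longrightarrow> ln (dens lam m) + 1 = potential p m"
    using critical_multiplier[OF lam(1)] by metis
  have "lam \<in> C" using lam(1) by (simp add: vertical_critical_set_def)
  then have "equilibrium_embedding X A n F T lam0 lam = equilibrium_point p"
    by (rule equilibrium_embedding_point) (rule p)
  then show "j \<in> range equilibrium_point" using lam(2) by simp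
next
  fix j assume "j \<in> range equilibrium_point"
  then obtain p where j: "j = equilibrium_point p" by blast
  have "equilibrium_embedding X A n F T lam0 (equilibrium_form p) = j"
    unfolding j by (rule equilibrium_embedding_point[OF equilibrium_form_C]) (rule equilibrium_form_multiplier)
  moreover have "equilibrium_form p \<in> vertical_critical_set X A n F C T lam0"
    by (rule multiplier_critical(1)[OF equilibrium_form_C]) (rule equilibrium_form_multiplier)
  ultimately show "j \<in> equilibrium_embedding X A n F T lam0 ` vertical_critical_set X A n F C T lam0"
    by (rule image_eqI[OF sym])
qed

lemma equilibrium_point_in_jet_bundle:
  "equilibrium_point p \<in> jet_bundle (observation_map X A n F ` C)"
proof -
  have "equilibrium_embedding X A n F T lam0 (equilibrium_form p) = equilibrium_point p"
    by (rule equilibrium_embedding_point[OF equilibrium_form_C]) (rule equilibrium_form_multiplier)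
  then have "fst (equilibrium_point p) = observation_map X A n F (equilibrium_form p)"
    by (metis equilibrium_embedding_def fst_conv)
  then show ?thesis using equilibrium_form_C[of p] by (simp add: jet_bundle_def mem_Times_iff)
qed

section \<open>The equilibrium as a Legendrian graph\<close>

lemma smooth_on_equilibrium_point: "smooth_on UNIV equilibrium_point"
proof -
  have m: "smooth_on UNIV (moment (F i))" for i by (rule smooth_on_moment[OF continuous_F])
  have c: "smooth_on UNIV (\<lambda>p :: real^'N. p $ i)" for i
    by (rule smooth_on_linear[OF open_UNIV bounded_linear_vec_nth])
  have "smooth_on UNIV (\<lambda>p. (\<chi> i. moment (F i) p, p,
      (\<Sum>i\<in>UNIV. p $ i * moment (F i) p) + (-1) * moment (\<lambda>_. 1) p))"
    by (intro smooth_on_Pair smooth_on_vec_lambda smooth_on_add smooth_on_sum smooth_on_mult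
        smooth_on_const open_UNIV m c smooth_on_moment continuous_fun_const
        smooth_on_linear[OF open_UNIV bounded_linear_ident])
  then show ?thesis by (simp add: equilibrium_point_def[abs_def])
qed

text \<open>In the differential of \<open>z\<close> the terms \<open>\<Sum>i. q i * dp i\<close> cancel against the derivative of the
  total mass: \<open>z\<close> is the Legendre transform of that mass.\<close>

lemma equilibrium_point_derivative:
  obtains dq dz where "frechet_derivative equilibrium_point (at p) v = (dq, v, dz)"
    "dz = (\<Sum>i\<in>UNIV. p $ i * dq $ i)"
proof -
  let ?dm = "\<lambda>G v. moment (\<lambda>m. G m * potential v m) p"
  have m: "(moment (F i) has_derivative ?dm (F i)) (at p)" for i
    by (rule moment_has_derivative[OF continuous_F])
  have c: "((\<lambda>p :: real^'N. p $ i) has_derivative (\<lambda>v. v $ i)) (at p)" for i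
    by (rule bounded_linear_imp_has_derivative[OF bounded_linear_vec_nth])
  have q: "((\<lambda>p. \<chi> i. moment (F i) p) has_derivative (\<lambda>v. \<chi> i. ?dm (F i) v)) (at p)"
  proof (rule has_derivative_componentwise_within[THEN iffD2], rule ballI)
    fix b :: "real^'N" assume "b \<in> Basis"
    then obtain i where b: "b = axis i 1" by (auto simp: Basis_vec_def)
    show "((\<lambda>p. (\<chi> i. moment (F i) p) \<bullet> b) has_derivative (\<lambda>v. (\<chi> i. ?dm (F i) v) \<bullet> b)) (at p)"
      unfolding b inner_axis using m[of i] by simp
  qed
  have z: "((\<lambda>p. (\<Sum>i\<in>UNIV. p $ i * moment (F i) p) - moment (\<lambda>_. 1) p) has_derivative
      (\<lambda>v. (\<Sum>i\<in>UNIV. p $ i * ?dm (F i) v + v $ i * moment (F i) p) - ?dm (\<lambda>_. 1) v)) (at p)"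
    by (rule has_derivative_diff[OF has_derivative_sum[OF has_derivative_mult[OF c m]]
          moment_has_derivative[OF continuous_fun_const]])
  have "(equilibrium_point has_derivative (\<lambda>v. (\<chi> i. ?dm (F i) v, v,
      (\<Sum>i\<in>UNIV. p $ i * ?dm (F i) v + v $ i * moment (F i) p) - ?dm (\<lambda>_. 1) v))) (at p)"
    unfolding equilibrium_point_def[abs_def]
    by (rule has_derivative_Pair[OF q has_derivative_Pair[OF has_derivative_ident z]])
  from frechet_derivative_eqI[OF this]
  have "frechet_derivative equilibrium_point (at p) v = (\<chi> i. ?dm (F i) v, v,
      (\<Sum>i\<in>UNIV. p $ i * ?dm (F i) v + v $ i * moment (F i) p) - ?dm (\<lambda>_. 1) v)" by simp
  moreover have "?dm (\<lambda>_. 1) v = (\<Sum>i\<in>UNIV. v $ i * moment (F i) p)"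
    using moment_potential[of v p] by simp
  ultimately show ?thesis by (intro that) (auto simp: sum.distrib)
qed

text \<open>The projection to \<open>p\<close> inverts the parametrisation continuously, so the subspace topology serves and
  one chart is an atlas.\<close>

lemma immersed_legendrian_range:
  "immersed_legendrian (jet_bundle (observation_map X A n F ` C)) (range equilibrium_point)"
  unfolding immersed_legendrian_def
proof (intro conjI exI)
  let ?R = "range equilibrium_point" and ?\<pi> = "\<lambda>j :: 'N jet. fst (snd j)"
  let ?c = "(?R, ?\<pi>) :: ('N jet, 'N) chart"
  show "?R \<subseteq> jet_bundle (observation_map X A n F ` C)"
    using equilibrium_point_in_jet_bundle by blast
  have \<pi>: "?\<pi> (equilibrium_point p) = p" for p by (simp add: equilibrium_point_def)
  have dom: "cdom ?c = ?R" by (simp add: cdom_def)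
  have img: "cimg ?c = UNIV" unfolding cimg_def dom using \<pi> by (auto simp: image_image)
  have inv: "cinv ?c = equilibrium_point"
  proof
    fix p
    have "inj_on ?\<pi> ?R" by (rule inj_on_inverseI[where g=equilibrium_point]) (auto simp: \<pi>)
    then show "cinv ?c p = equilibrium_point p"
      unfolding cinv_def dom using inv_into_f_f[of ?\<pi> ?R "equilibrium_point p"] \<pi> by simp
  qed
  have cont: "continuous_on UNIV equilibrium_point"
    by (rule smooth_on_imp_continuous_on[OF smooth_on_equilibrium_point])
  have "homeomorphic_maps (top_of_set ?R) (top_of_set UNIV) ?\<pi> equilibrium_point"
    unfolding homeomorphic_maps_def using cont \<pi>
    by (auto simp: continuous_map_in_subtopology intro!: continuous_intros)
  then have "homeomorphic_map (top_of_set ?R) (top_of_set UNIV) ?\<pi>"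
    by (rule homeomorphic_maps_imp_map)
  then have chart: "is_chart (top_of_set ?R) ?c"
    unfolding is_chart_def dom img by (simp add: subtopology_subtopology)
  have "smooth_on (overlap ?c ?c) (transition ?c ?c)"
  proof -
    have o: "overlap ?c ?c = UNIV" using img by (simp add: overlap_def cimg_def)
    have t: "transition ?c ?c = (\<lambda>p. p)" unfolding transition_def inv using \<pi> by auto
    show ?thesis unfolding o t by (rule smooth_on_linear[OF open_UNIV bounded_linear_ident])
  qed
  then have "smooth_manifold (top_of_set ?R) {?c}"
    unfolding smooth_manifold_def using chart dom
    by (simp add: Hausdorff_space_subtopology second_countable_space_top_of_set)
  moreover have "inj (frechet_derivative equilibrium_point (at p))" for p
    by (rule injI) (metis equilibrium_point_derivative fst_conv snd_conv)
  ultimately show "immersed_submanifold ?R (top_of_set ?R) {?c}"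
    unfolding immersed_submanifold_def using smooth_on_equilibrium_point by (simp add: inv img)
  show "\<forall>c\<in>{?c}. \<forall>x\<in>cimg c. \<forall>v. std_contact_form (cinv c x) (frechet_derivative (cinv c) (at x) v) = 0"
  proof (intro ballI allI)
    fix c p v assume "c \<in> {?c}"
    then have c: "cinv c = equilibrium_point" using inv by simp
    obtain dq dz where d: "frechet_derivative equilibrium_point (at p) v = (dq, v, dz)"
      "dz = (\<Sum>i\<in>UNIV. p $ i * dq $ i)" by (rule equilibrium_point_derivative)
    show "std_contact_form (cinv c p) (frechet_derivative (cinv c) (at p) v) = 0"
      unfolding c d(1) using d(2) by (simp add: equilibrium_point_def std_contact_form_def)
  qed
qed

end

theorem propositionB1:
  fixes X :: "'m topology"
    and A :: "('m, 'd::{finite,wellorder}) chart set"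
    and n :: nat
    and F :: "'N::finite \<Rightarrow> 'm \<Rightarrow> real"
    and lam0 :: "('m, 'd) oneform"
    and C :: "('m, 'd) oneform set"
    and T :: "('m, 'd) oneform \<Rightarrow> ('m, 'd) oneform set"
  assumes "CARD('d) = 2 * n + 1"
    and "closed_connected_oriented_manifold X A"
    and "lam0 \<in> pos_contact_forms A n"
    and "\<And>i. smooth_fun A (F i)"
    and "(C = pos_contact_forms A n \<and> T = (\<lambda>_. Omega1 A)) \<or>
         (C = pos_contact_forms_ker A n (form_kernel lam0) \<and> T = conformal_tangent A)"
    and "observation_submersion X A n F C T"
  shows "immersed_legendrian
           (jet_bundle (observation_map X A n F ` C))
           (thermodynamic_equilibrium X A n F C T lam0)"
proof -
  interpret contact_equilibrium X A n lam0 F C T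
    by unfold_locales (use assms in auto)
  show ?thesis
    unfolding thermodynamic_equilibrium_range by (rule immersed_legendrian_range)
qed

end
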